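(* Suppose that: (a) $E\|F(x,\xi)\|^2<\infty$ for all $x\in O$; (b) the map $x\mapsto F(x,\xi(\omega))$ is continuously differentiable on $O$ for a.e. $\omega\in\Omega$, and $E\|d_xF(x,\xi)\|^2<\infty$ for all $x\in O$; (c) there exists a square integrable random variable $C$ such that $\|F(x,\xi(\omega))-F(x',\xi(\omega))\|+\|d_xF(x,\xi(\omega))-d_xF(x',\xi(\omega))\|\le C(\omega)\|x-x'\|$ for all $x,x'\in O$ and a.e. $\omega\in\Omega$. Suppose further that $x_0\in S\cap O$ solves $0\in f_0(x)+N_S(x)$ and that, with $z_0=x_0-f_0(x_0)$, $L=df_0(x_0)$, $K=T_S(x_0)\cap\{z_0-x_0\}^\perp$, the map $L_K:\mathbb{R}^q\to\mathbb{R}^q$, $L_K(h)=L(\Pi_K(h))+h-\Pi_K(h)$, is a homeomorphism from $\mathbb{R}^q$ to $\mathbb{R}^q$. Let $z_n$ be the solution of the sample average normal map equation $(f_n)_S(z)=0$ near $z_0$ and $x_n=\Pi_S(z_n)$ (as described in the context). Let $\Sigma_0$ be the covariance matrix of $F(x_0,\xi)$, let $\Sigma_n$ be the sample covariance matrix of $\{F(x_n,\xi^i)\}_{i=1}^n$, and let $\alpha\in[0,1]$ be fixed. Suppose that $\Sigma_0$ is singular. Let $\rho>0$ be the minimum of all positive eigenvalues of $\Sigma_0$, and let $l$ be the number of positive eigenvalues of $\Sigma_0$ counted with regard to their algebraic multiplicities. Let $\rho_0$ satisfy $0<\rho_0<\rho$. Decompose $\Sigma_n$ as $\Sigma_n=U_n^T\Delta_nU_n$,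 where $U_n$ is an orthogonal $q\times q$ matrix and $\Delta_n$ is a diagonal matrix with monotonically decreasing elements. Let $D_n$ be the upper-left submatrix of $\Delta_n$ whose diagonal elements are at least $\rho_0$. Let $l_n$ be the number of rows in $D_n$, let $(U_n)_1$ be the submatrix of $U_n$ that consists of its first $l_n$ rows, and let $(U_n)_2$ be the submatrix that consists of the remaining rows of $U_n$. Then for almost every $\omega$ the equality $l_n=l$ holds for sufficiently large $n$. Moreover, $$n\big[d(f_n)_S(z_n)(z_0-z_n)\big]^T(U_n)_1^TD_n^{-1}(U_n)_1\big[d(f_n)_S(z_n)(z_0-z_n)\big]\Rightarrow\chi^2_l$$ and $$n\big[d(f_n)_S(z_n)(z_0-z_n)\big]^T(U_n)_2^T(U_n)_2\big[d(f_n)_S(z_n)(z_0-z_n)\big]\Rightarrow0,$$ where $\Rightarrow$ denotes weak convergence. For each $\epsilon>0$, the set $R_{n,\epsilon}$ of all $z\in\mathbb{R}^q$ satisfying both $$n\big[d(f_n)_S(z_n)(z-z_n)\big]^T(U_n)_1^TD_n^{-1}(U_n)_1\big[d(f_n)_S(z_n)(z-z_n)\big]\le\chi^2_{l_n}(\alpha)$$ and $$\|\sqrt{n}\,(U_n)_2[d(f_n)_S(z_n)(z-z_n)]\|_\infty\le\epsilon$$ contains $z_0$ with probability converging to $1-\alpha$ (as $n\to\infty$).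
   Context: Setting. $(\Omega,\mathcal{F},P)$ is a probability space; $\xi$ is a random vector defined on $\Omega$ and supported on a closed set $\Xi\subset\mathbb{R}^d$; $O\subset\mathbb{R}^q$ is open; $F:O\times\Xi\to\mathbb{R}^q$ is measurable and $f_0(x)=E[F(x,\xi)]$ is well defined for each $x\in O$; $d_xF$ is the partial derivative of $F$ with respect to $x$ (a $q\times q$ matrix). $S\subset\mathbb{R}^q$ is a polyhedral convex set. $\xi^1,\dots,\xi^n$ are i.i.d. with the distribution of $\xi$, and $f_n(x)=f_n(x,\omega)=n^{-1}\sum_{i=1}^nF(x,\xi^i(\omega))$. Under (a)-(c), $f_0$ is continuously differentiable on $O$. Convex notions. $N_S(x)=\{v\in\mathbb{R}^q:\langle v,s-x\rangle\le0 \text{ for each } s\in S\}$; $T_S(x)=\{v\in\mathbb{R}^q:\text{there exists } t>0 \text{ with } x+tv\in S\}$ for $x\in S$; $\Pi_C$ is the Euclidean projection onto a closed convex set $C$. B-derivative. A locally Lipschitz function $g$ is B-differentiable at $x$ if there is a positively homogeneous function $G$ with $g(x+v)=g(x)+G(v)+o(v)$; $G$ is then called the B-derivative of $g$ at $x$ and denoted $dg(x)$, and $dg(x)(h)$ is the directional derivative of $g$ at $x$ along $h$. $\Pi_S$ is piecewise affine and hence B-differentiable everywhere. Normal maps. For a function $g:O\to\mathbb{R}^q$, the normal map is $g_S(z)=g(\Pi_S(z))+z-\Pi_S(z)$ for $z\in\Pi_S^{-1}(O)$. If $g$ is continuously differentiable, then $dg_S(z)(h)=dg(\Pi_S(z))(d\Pi_S(z)(h))+h-d\Pi_S(z)(h)$.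 One has $\Pi_S(z_0)=x_0$, $(f_0)_S(z_0)=0$ and $d(f_0)_S(z_0)=L_K$. Sample average solutions. It is a known result that, under the hypotheses of the first paragraph of the claim, there are neighborhoods $X_0$ of $x_0$ in $O$ and $Z$ of $z_0$ in $\mathbb{R}^q$ such that for almost every $\omega$ there is an integer $N_\omega$ such that for each $n\ge N_\omega$ the equation $(f_n)_S(z)=0$ has a unique solution $z_n$ in $Z$, and $0\in f_n(x)+N_S(x)$ has a unique solution in $X_0$ given by $x_n=\Pi_S(z_n)$; moreover $z_n\to z_0$ and $x_n\to x_0$ almost surely. These are the $z_n$ and $x_n$ in the claim. Notation. $\chi^2_l$ is a $\chi^2$ random variable with $l$ degrees of freedom, and $\chi^2_l(\alpha)$ is the number that satisfies $P(\chi^2_l>\chi^2_l(\alpha))=\alpha$. $\|\cdot\|_\infty$ is the $\infty$-norm. *)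

theory Defs
  imports "HOL-Probability.Probability" "HOL-Computational_Algebra.Polynomial"
begin

section \<open>Convex and variational notions\<close>

text \<open>For a closed convex set \<open>C\<close>, the Euclidean projection is the library's \<^const>\<open>closest_point\<close>.\<close>

definition normal_cone :: "'a::real_inner set \<Rightarrow> 'a \<Rightarrow> 'a set" where
  "normal_cone S x = {v. \<forall>s\<in>S. inner v (s - x) \<le> 0}"

definition tangent_cone :: "'a::real_vector set \<Rightarrow> 'a \<Rightarrow> 'a set" where
  "tangent_cone S x = {v. \<exists>t>0. x + t *\<^sub>R v \<in> S}"

text \<open>Solutions of the variational inequality \<open>0 \<in> g(x) + N\<^sub>S(x)\<close>.  Membership in \<open>S\<close> is
  required explicitly, since the formula defining \<open>normal_cone\<close> also yields a cone at points
  outside \<open>S\<close>.\<close>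

definition vi_solutions :: "'a::real_inner set \<Rightarrow> ('a \<Rightarrow> 'a) \<Rightarrow> 'a set" where
  "vi_solutions S g = {x \<in> S. 0 \<in> {g x + v |v. v \<in> normal_cone S x}}"

text \<open>This is meaningful at points \<open>z\<close> with \<open>\<Pi>\<^sub>S(z)\<close> in the domain of \<open>g\<close>.\<close>

definition normal_map :: "'a::euclidean_space set \<Rightarrow> ('a \<Rightarrow> 'a) \<Rightarrow> 'a \<Rightarrow> 'a" where
  "normal_map S g z = g (closest_point S z) + z - closest_point S z"

definition has_B_derivative ::
    "('a::real_normed_vector \<Rightarrow> 'b::real_normed_vector) \<Rightarrow> ('a \<Rightarrow> 'b) \<Rightarrow> 'a \<Rightarrow> bool" where
  "has_B_derivative g G x \<longleftrightarrow>
     (\<exists>V B. open V \<and> x \<in> V \<and> B-lipschitz_on V g) \<and>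
     (\<forall>t>0. \<forall>v. G (t *\<^sub>R v) = t *\<^sub>R G v) \<and>
     ((\<lambda>v. (g (x + v) - g x - G v) /\<^sub>R norm v) \<longlongrightarrow> 0) (at 0)"

text \<open>The B-derivative is unique when it exists: its value at \<open>v\<close> is the directional derivative.\<close>

definition B_deriv ::
    "('a::real_normed_vector \<Rightarrow> 'b::real_normed_vector) \<Rightarrow> 'a \<Rightarrow> 'a \<Rightarrow> 'b" where
  "B_deriv g x = (THE G. has_B_derivative g G x)"

definition C1_on :: "(real^'n) set \<Rightarrow> (real^'n \<Rightarrow> real^'m) \<Rightarrow> bool" where
  "C1_on D g \<longleftrightarrow> (\<forall>x\<in>D. g differentiable (at x)) \<and> continuous_on D (\<lambda>x. jacobian g (at x))"


section \<open>Matrices\<close>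

definition real_eigenvalue :: "real^'n^'n \<Rightarrow> real \<Rightarrow> bool" where
  "real_eigenvalue A \<mu> \<longleftrightarrow> (\<exists>v. v \<noteq> 0 \<and> A *v v = \<mu> *\<^sub>R v)"

definition charpoly :: "real^'n^'n \<Rightarrow> real poly" where
  "charpoly A = det (\<chi> i j. (if i = j then [:0, 1:] else 0) - [:A $ i $ j:])"

definition num_pos_eigenvalues :: "real^'n^'n \<Rightarrow> nat" where
  "num_pos_eigenvalues A =
     (\<Sum>\<mu> | real_eigenvalue A \<mu> \<and> 0 < \<mu>. order \<mu> (charpoly A))"

definition is_diagonal :: "real^'n^'n \<Rightarrow> bool" where
  "is_diagonal A \<longleftrightarrow> (\<forall>i j. i \<noteq> j \<longrightarrow> A $ i $ j = 0)"

definition decreasing_diagonal :: "real^'n::{finite,linorder}^'n::_ \<Rightarrow> bool" where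
  "decreasing_diagonal A \<longleftrightarrow> (\<forall>i j. i \<le> j \<longrightarrow> A $ j $ j \<le> A $ i $ i)"

definition first_indices :: "nat \<Rightarrow> 'n::{finite,linorder} set" where
  "first_indices k = {i. card {j. j < i} < k}"

text \<open>A submatrix whose size depends on the sample cannot have its size in its type.  The submatrix
  of \<open>A\<close> that consists of the rows in \<open>I\<close> is therefore padded: the other rows are replaced by zero rows
  instead of being deleted.  Similarly, for a diagonal matrix \<open>A\<close>, the inverse of its diagonal block
  with rows and columns in \<open>I\<close> is padded by zeros.  This changes neither products of the form
  \<open>B\<^sup>T D\<^sup>-\<^sup>1 B\<close> and \<open>B\<^sup>T B\<close> nor the maximum norm of \<open>B v\<close>.\<close>

definition row_block :: "'n set \<Rightarrow> real^'m^'n \<Rightarrow> real^'m^'n" where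
  "row_block I A = (\<chi> i j. if i \<in> I then A $ i $ j else 0)"

definition diag_block_inv :: "'n set \<Rightarrow> real^'n^'n \<Rightarrow> real^'n^'n" where
  "diag_block_inv I A = (\<chi> i j. if i = j \<and> i \<in> I then 1 / (A $ i $ i) else 0)"


section \<open>Probability and statistics\<close>

definition covariance_matrix :: "'w measure \<Rightarrow> ('w \<Rightarrow> real^'n) \<Rightarrow> real^'n^'n" where
  "covariance_matrix M X =
     (\<chi> i j. LINT \<omega>|M. (X \<omega> $ i - (LINT \<omega>'|M. X \<omega>' $ i)) * (X \<omega> $ j - (LINT \<omega>'|M. X \<omega>' $ j)))"

definition sample_mean :: "nat \<Rightarrow> (nat \<Rightarrow> 'a::real_vector) \<Rightarrow> 'a" where
  "sample_mean n Y = (1 / real n) *\<^sub>R (\<Sum>i=1..n. Y i)"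

text \<open>The usual unbiased normalization \<open>1 / (n - 1)\<close>.\<close>

definition sample_covariance :: "nat \<Rightarrow> (nat \<Rightarrow> real^'n) \<Rightarrow> real^'n^'n" where
  "sample_covariance n Y =
     (\<chi> j k. (1 / (real n - 1)) *
        (\<Sum>i=1..n. (Y i $ j - sample_mean n Y $ j) * (Y i $ k - sample_mean n Y $ k)))"

text \<open>The law of the sum of squares of \<open>k\<close> independent standard normal variables; it is the
  point mass at \<open>0\<close> for \<open>k = 0\<close>.\<close>

definition chi_square :: "nat \<Rightarrow> real measure" where
  "chi_square k =
     distr (\<Pi>\<^sub>M i\<in>{..<k}. std_normal_distribution) borel (\<lambda>x. \<Sum>i<k. (x i)\<^sup>2)"

text \<open>The upper quantile is extended-real valued, since for \<open>\<alpha> = 0\<close> only \<open>\<infinity>\<close> qualifies.\<close>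

definition chi_square_critical :: "nat \<Rightarrow> real \<Rightarrow> ereal \<Rightarrow> bool" where
  "chi_square_critical k \<alpha> c \<longleftrightarrow> measure (chi_square k) {x. c < ereal x} = \<alpha>"

end

theory Submission
  imports Defs
begin

text \<open>
  Since \<open>\<Pi>\<^sub>S\<close> is affine on the segment from \<open>z\<^sub>n\<close> to a nearby \<open>z\<^sub>0\<close>, the vector
  \<open>w\<^sub>n = d(f\<^sub>n)\<^sub>S(z\<^sub>n)(z\<^sub>0 - z\<^sub>n)\<close> differs from \<open>g\<^sub>n = f\<^sub>n(x\<^sub>0) - f\<^sub>0(x\<^sub>0)\<close> only by a quadratic Taylor
  remainder, and injectivity of the homogeneous map \<open>L\<^sub>K\<close> bounds \<open>\<bar>z\<^sub>n - z\<^sub>0\<bar>\<close> by a multiple of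
  \<open>\<bar>g\<^sub>n\<bar>\<close>; hence \<open>\<bar>w\<^sub>n - g\<^sub>n\<bar> = o(\<bar>g\<^sub>n\<bar>)\<close> almost surely.  By the strong law \<open>\<Sigma>\<^sub>n \<rightarrow> \<Sigma>\<^sub>0\<close>, and continuity
  of the functional calculus of symmetric matrices at the spectrum of \<open>\<Sigma>\<^sub>0\<close> shows that \<open>l\<^sub>n = l\<close>
  eventually and that the matrices of the two quadratic forms converge to the pseudo-inverse of \<open>\<Sigma>\<^sub>0\<close>
  and to the projection onto its kernel.  The quadratic forms in \<open>w\<^sub>n\<close> may thus be replaced by the
  limiting forms in \<open>g\<^sub>n\<close>.  The second one vanishes almost surely; the first one is a sum of \<open>l\<close>
  squares of normalized, uncorrelated sums.  Writing \<open>exp (- t s\<^sup>2)\<close> as a Gaussian average of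
  characteristic functions reduces the convergence of its Laplace transform to the one-dimensional
  central limit theorem.
\<close>

section \<open>Spectral decompositions\<close>

text \<open>Eigenvectors of \<open>\<Sigma> n \<omega>\<close> need not converge when \<Sigma>0 has
  multiple eigenvalues, so no limit of \<open>U\<close> is taken along the full sequence; only
  functions of the matrix, which do not depend on the chosen diagonalization, are shown to converge.
  The threshold \<rho>0 lies in the spectral gap between 0 and \<rho>, hence the cut-off functions
  jump at no eigenvalue of \<Sigma>0. Since \<open>F\<close> and its Lipschitz modulus are only
  square integrable, their squares and products have just a first moment; the strong law is
  therefore established under that condition, from a maximal inequality and the zero-one law. The
  error of replacing the quadratic forms is measured against n times the squared norm of
  \<open>g\<^sub>n\<close>, whose mean is bounded, so that Markov's inequality does the work of a
  tightness argument. Probabilities are taken in the completion because B-derivatives and sample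
  covariances agree with visibly measurable expressions only almost everywhere.\<close>

lemma order_prod_linear:
  fixes a :: "'i \<Rightarrow> 'a::idom"
  assumes "finite I"
  shows "order \<mu> (\<Prod>i\<in>I. [:- a i, 1:]) = card {i\<in>I. a i = \<mu>}"
  using assms
proof induction
  case empty
  then show ?case by (simp add: order_0I)
next
  case (insert i I)
  have nz: "[:- a i, 1:] * (\<Prod>i\<in>I. [:- a i, 1:]) \<noteq> 0"
    using insert.hyps(1) by (auto simp del: mult_pCons_left)
  have "order \<mu> [:- a i, 1:] = (if a i = \<mu> then 1 else 0)"
    using order_power_n_n[of \<mu> 1] by (auto intro!: order_0I)
  moreover have "{j \<in> insert i I. a j = \<mu>} = (if a i = \<mu> then insert i {j\<in>I. a j = \<mu>} else {j\<in>I. a j = \<mu>})"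
    by auto
  ultimately show ?case
    using insert order_mult[OF nz] by (auto simp del: mult_pCons_left)
qed

text \<open>Row \<open>V $ k\<close> belongs to the value \<open>d k\<close>, matching the shape
  \<open>U^T \<Delta> U\<close> of the theorem. The entrywise form lets limits be taken by
  continuity of sums and products.\<close>

definition spectral_matrix :: "real^'n^'n \<Rightarrow> ('n \<Rightarrow> real) \<Rightarrow> real^'n^'n" where
  "spectral_matrix V d = (\<chi> i j. \<Sum>k\<in>UNIV. V $ k $ i * d k * V $ k $ j)"

text \<open>Polymorphic in the entries: the characteristic polynomial needs diagonal matrices over
  the polynomial ring.\<close>

definition diag_of :: "('n \<Rightarrow> 'a::zero) \<Rightarrow> 'a^'n^'n" where
  "diag_of d = (\<chi> i j. if i = j then d i else 0)"

lemma matrix_mul_diag_of: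
  fixes A :: "'a::semiring_1^'n^'m"
  shows "A ** diag_of d = (\<chi> i j. A $ i $ j * d j)"
  by (simp add: matrix_matrix_mult_def diag_of_def vec_eq_iff if_distrib sum.delta cong: if_cong)

lemma diag_of_matrix_mul:
  fixes A :: "'a::semiring_1^'n^'m"
  shows "diag_of d ** A = (\<chi> i j. d i * A $ i $ j)"
  by (simp add: matrix_matrix_mult_def diag_of_def vec_eq_iff if_distrib if_distribR sum.delta cong: if_cong)

lemma spectral_matrix_eq: "spectral_matrix V d = transpose V ** diag_of d ** V"
  unfolding matrix_mul_diag_of
  by (simp add: spectral_matrix_def matrix_matrix_mult_def transpose_def)

lemma spectral_matrix_diagonal:
  assumes "is_diagonal A"
  shows "transpose V ** A ** V = spectral_matrix V (\<lambda>k. A $ k $ k)"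
proof -
  have "A = diag_of (\<lambda>k. A $ k $ k)"
    using assms by (auto simp: diag_of_def is_diagonal_def vec_eq_iff)
  then show ?thesis unfolding spectral_matrix_eq by simp
qed

lemma orthogonal_matrix_cancel:
  fixes V :: "real^'n^'n" and A :: "real^'n^'m"
  assumes "orthogonal_matrix V"
  shows "A ** V ** transpose V = A" "A ** transpose V ** V = A"
  using assms by (simp_all add: orthogonal_matrix_def flip: matrix_mul_assoc)

lemma orthogonal_matrix_entries:
  fixes V :: "real^'n^'n"
  assumes "orthogonal_matrix V"
  shows "(\<Sum>k\<in>UNIV. V $ k $ i * V $ k $ j) = (if i = j then 1 else 0)"
    and "(\<Sum>k\<in>UNIV. V $ i $ k * V $ j $ k) = (if i = j then 1 else 0)"
proof -
  have "(transpose V ** V) $ i $ j = mat 1 $ i $ j" "(V ** transpose V) $ i $ j = mat 1 $ i $ j"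
    using assms by (simp_all add: orthogonal_matrix_def)
  then show "(\<Sum>k\<in>UNIV. V $ k $ i * V $ k $ j) = (if i = j then 1 else 0)"
    "(\<Sum>k\<in>UNIV. V $ i $ k * V $ j $ k) = (if i = j then 1 else 0)"
    by (simp_all add: matrix_matrix_mult_def transpose_def mat_def)
qed

lemma orthogonal_matrix_iff_entries:
  fixes V :: "real^'n^'n"
  shows "orthogonal_matrix V \<longleftrightarrow>
    (\<forall>i j. (\<Sum>k\<in>UNIV. V $ k $ i * V $ k $ j) = (if i = j then 1 else 0))"
  by (simp add: orthogonal_matrix matrix_matrix_mult_def transpose_def mat_def vec_eq_iff)

lemma orthogonal_matrix_entry_le:
  fixes V :: "real^'n^'n"
  assumes "orthogonal_matrix V"
  shows "\<bar>V $ i $ j\<bar> \<le> 1"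
proof -
  have "(V $ i $ j)\<^sup>2 \<le> (\<Sum>k\<in>UNIV. V $ k $ j * V $ k $ j)"
    unfolding power2_eq_square by (rule member_le_sum) auto
  then show ?thesis
    using orthogonal_matrix_entries(1)[OF assms, of j j] by (simp add: abs_square_le_1)
qed

text \<open>Conjugating back, \<open>V A V^T\<close> is diagonal. The diagonal thereby becomes a
  polynomial in the entries of \<open>V\<close> and \<open>A\<close>, which gives convergence of
  eigenvalues along subsequences and, in the theorem, measurability of the diagonal of
  \<Delta>.\<close>

lemma spectral_matrix_entry_back:
  fixes V :: "real^'n^'n"
  assumes "orthogonal_matrix V" "A = spectral_matrix V d"
  shows "d k = (\<Sum>i\<in>UNIV. \<Sum>j\<in>UNIV. V $ k $ i * A $ i $ j * V $ k $ j)"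
proof -
  have "V ** A ** transpose V = (V ** transpose V) ** diag_of d ** (V ** transpose V)"
    by (simp add: assms(2) spectral_matrix_eq matrix_mul_assoc)
  also have "\<dots> = diag_of d"
    using assms(1) by (simp add: orthogonal_matrix_def)
  finally have "(V ** A ** transpose V) $ k $ k = d k"
    by (simp add: diag_of_def)
  moreover have "(V ** A ** transpose V) $ k $ k = (\<Sum>j\<in>UNIV. \<Sum>i\<in>UNIV. V $ k $ i * A $ i $ j * V $ k $ j)"
    by (simp add: matrix_matrix_mult_def transpose_def sum_distrib_right)
  ultimately show ?thesis
    by (subst sum.swap) simp
qed

lemma spectral_matrix_eigenvalue:
  fixes V :: "real^'n^'n"
  assumes V: "orthogonal_matrix V"
  shows "spectral_matrix V d *v (V $ k) = d k *\<^sub>R (V $ k)" "V $ k \<noteq> 0"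
    "real_eigenvalue (spectral_matrix V d) (d k)"
proof -
  show 1: "spectral_matrix V d *v (V $ k) = d k *\<^sub>R (V $ k)"
  proof (unfold vec_eq_iff, rule)
    fix i
    have "(spectral_matrix V d *v (V $ k)) $ i = (\<Sum>j\<in>UNIV. \<Sum>m\<in>UNIV. V $ m $ i * d m * V $ m $ j * V $ k $ j)"
      by (simp add: spectral_matrix_def matrix_vector_mult_def sum_distrib_right)
    also have "\<dots> = (\<Sum>m\<in>UNIV. V $ m $ i * d m * (\<Sum>j\<in>UNIV. V $ m $ j * V $ k $ j))"
      by (subst sum.swap) (simp add: sum_distrib_left mult.assoc)
    also have "\<dots> = (d k *\<^sub>R (V $ k)) $ i"
      by (simp add: orthogonal_matrix_entries(2)[OF V] if_distrib cong: if_cong)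
    finally show "(spectral_matrix V d *v (V $ k)) $ i = (d k *\<^sub>R (V $ k)) $ i" .
  qed
  show 2: "V $ k \<noteq> 0"
    using orthogonal_matrix_entries(2)[OF V, of k k] by auto
  show "real_eigenvalue (spectral_matrix V d) (d k)"
    using 1 2 by (auto simp: real_eigenvalue_def)
qed

lemma trace_spectral_matrix:
  fixes V :: "real^'n^'n"
  assumes V: "orthogonal_matrix V"
  shows "trace (spectral_matrix V d) = sum d UNIV"
proof -
  have "trace (spectral_matrix V d) = (\<Sum>k\<in>UNIV. d k * (\<Sum>i\<in>UNIV. V $ k $ i * V $ k $ i))"
    unfolding trace_def spectral_matrix_def sum_distrib_left
    by simp (subst sum.swap, simp add: mult_ac)
  then show ?thesis by (simp add: orthogonal_matrix_entries(2)[OF V])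
qed

text \<open>With \<open>M = V W\<^sup>T\<close>, equality of the two matrices says that \<open>M\<^sub>i\<^sub>j\<close> vanishes unless
  \<open>d\<^sub>i = e\<^sub>j\<close>, and this property is inherited by \<open>\<phi> \<circ> d\<close> and \<open>\<phi> \<circ> e\<close>.\<close>
lemma spectral_matrix_functional_calculus:
  fixes V W :: "real^'n^'n"
  assumes V: "orthogonal_matrix V" and W: "orthogonal_matrix W"
    and eq: "spectral_matrix V d = spectral_matrix W e"
  shows "spectral_matrix V (\<lambda>k. \<phi> (d k)) = spectral_matrix W (\<lambda>k. \<phi> (e k))"
proof -
  define M where "M = V ** transpose W"
  have l: "V ** spectral_matrix V d ** transpose W = diag_of d ** M" for d
    using V by (simp add: spectral_matrix_eq M_def matrix_mul_assoc orthogonal_matrix_def)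
  have r: "V ** spectral_matrix W e ** transpose W = M ** diag_of e" for e
    by (simp add: spectral_matrix_eq M_def matrix_mul_assoc orthogonal_matrix_cancel[OF W])
  have "diag_of d ** M = M ** diag_of e" by (metis l r eq)
  then have "d i * M $ i $ j = M $ i $ j * e j" for i j
    by (simp add: diag_of_matrix_mul matrix_mul_diag_of vec_eq_iff)
  then have "\<phi> (d i) * M $ i $ j = M $ i $ j * \<phi> (e j)" for i j
    by (metis mult.commute mult_cancel_left)
  then have "diag_of (\<lambda>k. \<phi> (d k)) ** M = M ** diag_of (\<lambda>k. \<phi> (e k))"
    by (simp add: diag_of_matrix_mul matrix_mul_diag_of vec_eq_iff)
  then have "V ** spectral_matrix V (\<lambda>k. \<phi> (d k)) ** transpose W
      = V ** spectral_matrix W (\<lambda>k. \<phi> (e k)) ** transpose W"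
    by (simp add: l r)
  then have "transpose V ** (V ** spectral_matrix V (\<lambda>k. \<phi> (d k)) ** transpose W) ** W
      = transpose V ** (V ** spectral_matrix W (\<lambda>k. \<phi> (e k)) ** transpose W) ** W"
    by simp
  then show ?thesis
    using V by (simp add: matrix_mul_assoc orthogonal_matrix_cancel[OF W] orthogonal_matrix_def)
qed

text \<open>Lifted to constant polynomials, \<open>V\<close> stays orthogonal, so
  \<open>X I - V^T diag(d) V = V^T diag(X - d) V\<close>; multiplicativity of the determinant then
  leaves only the diagonal factor.\<close>

lemma charpoly_spectral_matrix:
  fixes V :: "real^'n^'n"
  assumes V: "orthogonal_matrix V"
  shows "charpoly (spectral_matrix V d) = (\<Prod>k\<in>UNIV. [:- d k, 1:])"
proof -
  define P :: "real^'n^'n \<Rightarrow> real poly^'n^'n" where "P A = (\<chi> i j. [:A $ i $ j:])" for A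
  have sum_const: "(\<Sum>k\<in>I. [:g k:]) = [:\<Sum>k\<in>I. g k:]" for g :: "'n \<Rightarrow> real" and I
    by (induction I rule: infinite_finite_induct) auto
  have P_mult: "P A ** P B = P (A ** B)" for A B
    by (simp add: P_def matrix_matrix_mult_def vec_eq_iff sum_const mult.commute)
  have "P (transpose V) ** P V = P (mat 1)"
    using V by (simp add: P_mult orthogonal_matrix_def)
  also have "P (mat 1) = mat 1"
    by (simp add: P_def mat_def vec_eq_iff one_pCons)
  finally have det1: "det (P (transpose V)) * det (P V) = 1"
    by (metis det_mul det_I)
  have "(\<chi> i j. (if i = j then [:0, 1:] else 0) - [:spectral_matrix V d $ i $ j:])
      = P (transpose V) ** diag_of (\<lambda>k. [:- d k, 1:]) ** P V"
  proof -
    have "(if i = j then [:0, 1:] else 0) - [:spectral_matrix V d $ i $ j:]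
        = (\<Sum>k\<in>UNIV. [:V $ k $ i:] * [:- d k, 1:] * [:V $ k $ j:])" for i j
    proof -
      have "(\<Sum>k\<in>UNIV. [:V $ k $ i:] * [:- d k, 1:] * [:V $ k $ j:])
          = (\<Sum>k\<in>UNIV. [:0, 1:] * [:V $ k $ i * V $ k $ j:] - [:V $ k $ i * d k * V $ k $ j:])"
        by (intro sum.cong) (auto simp: mult_ac)
      also have "\<dots> = [:0, 1:] * (\<Sum>k\<in>UNIV. [:V $ k $ i * V $ k $ j:]) - (\<Sum>k\<in>UNIV. [:V $ k $ i * d k * V $ k $ j:])"
        by (simp only: sum_subtractf sum_distrib_left)
      also have "\<dots> = (if i = j then [:0, 1:] else 0) - [:spectral_matrix V d $ i $ j:]"
        by (simp add: sum_const orthogonal_matrix_entries(1)[OF V] spectral_matrix_def)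
      finally show ?thesis by simp
    qed
    then show ?thesis
      unfolding matrix_mul_diag_of by (simp add: matrix_matrix_mult_def P_def transpose_def vec_eq_iff)
  qed
  then have "charpoly (spectral_matrix V d)
      = det (P (transpose V)) * det (diag_of (\<lambda>k. [:- d k, 1:])) * det (P V)"
    by (simp add: charpoly_def det_mul)
  also have "\<dots> = det (diag_of (\<lambda>k. [:- d k, 1:]))"
    using det1 by (simp add: mult_ac)
  also have "\<dots> = (\<Prod>k\<in>UNIV. [:- d k, 1:])"
    by (subst det_diagonal) (auto simp: diag_of_def)
  finally show ?thesis .
qed

lemma real_eigenvalue_spectral_matrix:
  fixes V :: "real^'n^'n"
  assumes V: "orthogonal_matrix V"
  shows "real_eigenvalue (spectral_matrix V d) \<mu> \<longleftrightarrow> (\<exists>k. d k = \<mu>)" (is "real_eigenvalue ?A \<mu> \<longleftrightarrow> _")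
proof
  assume "real_eigenvalue ?A \<mu>"
  then obtain v where v: "v \<noteq> 0" "?A *v v = \<mu> *\<^sub>R v"
    by (auto simp: real_eigenvalue_def)
  \<comment> \<open>In the coordinates \<open>u\<close> the eigenvalue equation reads
    \<open>d k * u $ k = \<mu> * u $ k\<close>, and some coordinate of \<open>u\<close> is
    nonzero.\<close>
  define u where "u = V *v v"
  have "transpose V *v u = v"
    using V by (simp add: u_def matrix_vector_mul_assoc orthogonal_matrix_def)
  then have "u \<noteq> 0" using v(1) by auto
  then obtain k where k: "u $ k \<noteq> 0" by (auto simp: vec_eq_iff)
  have "V *v (?A *v v) = (V ** transpose V) ** diag_of d *v u"
    by (simp add: u_def spectral_matrix_eq matrix_vector_mul_assoc matrix_mul_assoc)
  also have "\<dots> = diag_of d *v u" using V by (simp add: orthogonal_matrix_def)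
  finally have "(diag_of d *v u) $ k = (V *v (\<mu> *\<^sub>R v)) $ k" using v(2) by simp
  then have "d k * u $ k = \<mu> * u $ k"
    by (simp add: diag_of_def matrix_vector_mult_def if_distribR if_distrib u_def sum_distrib_left mult_ac cong: if_cong)
  then show "\<exists>k. d k = \<mu>" using k by auto
qed (use spectral_matrix_eigenvalue(3)[OF V] in auto)

text \<open>The algebraic multiplicity of \<mu> counts the \<open>k\<close> with
  \<open>d k = \<mu>\<close>; adding these fibres over the positive eigenvalues counts every
  positive \<open>d k\<close> once. This turns \<open>l\<close> into a cardinality.\<close>

lemma num_pos_eigenvalues_spectral_matrix:
  fixes V :: "real^'n^'n"
  assumes V: "orthogonal_matrix V"
  shows "num_pos_eigenvalues (spectral_matrix V d) = card {k. 0 < d k}"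
proof -
  let ?A = "spectral_matrix V d"
  note eig = real_eigenvalue_spectral_matrix[OF V, of d]
  have "num_pos_eigenvalues ?A = (\<Sum>\<mu> | \<mu> \<in> range d \<and> 0 < \<mu>. card {k. d k = \<mu>})"
    unfolding num_pos_eigenvalues_def
    by (rule sum.cong) (auto simp: eig charpoly_spectral_matrix[OF V] order_prod_linear)
  also have "\<dots> = card (\<Union>\<mu>\<in>{\<mu>\<in>range d. 0 < \<mu>}. {k. d k = \<mu>})"
    by (rule card_UN_disjoint[symmetric]) auto
  also have "(\<Union>\<mu>\<in>{\<mu>\<in>range d. 0 < \<mu>}. {k. d k = \<mu>}) = {k. 0 < d k}" by auto
  finally show ?thesis .
qed

lemma tendsto_spectral_matrix:
  assumes "U \<longlonglongrightarrow> V" "\<And>k. (\<lambda>n. d n k) \<longlonglongrightarrow> e k"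
  shows "(\<lambda>n. spectral_matrix (U n) (d n)) \<longlonglongrightarrow> spectral_matrix V e"
  unfolding spectral_matrix_def by (intro tendsto_intros assms)

text \<open>Compactness of the orthogonal group: entries are bounded by 1 and the orthogonality
  relations are closed.\<close>

lemma orthogonal_matrix_convergent_subsequence:
  fixes U :: "nat \<Rightarrow> real^'n^'n"
  assumes "\<And>n. orthogonal_matrix (U n)"
  obtains r V where "strict_mono r" "(U \<circ> r) \<longlonglongrightarrow> V" "orthogonal_matrix V"
proof -
  have "norm (U n) \<le> real (CARD('n) * CARD('n))" for n
  proof -
    have "norm (U n) \<le> (\<Sum>i\<in>UNIV. norm (U n $ i))"
      unfolding norm_vec_def by (rule L2_set_le_sum) simp
    also have "\<dots> \<le> (\<Sum>i\<in>(UNIV :: 'n set). real CARD('n))"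
    proof (rule sum_mono)
      fix i
      have "norm (U n $ i) \<le> (\<Sum>j\<in>UNIV. \<bar>U n $ i $ j\<bar>)" by (rule norm_le_l1_cart)
      also have "\<dots> \<le> (\<Sum>j\<in>(UNIV :: 'n set). 1)"
        by (intro sum_mono orthogonal_matrix_entry_le assms)
      finally show "norm (U n $ i) \<le> real CARD('n)" by simp
    qed
    finally show ?thesis by simp
  qed
  then have "bounded (range U)" by (auto simp: bounded_iff)
  then obtain V r where r: "strict_mono (r :: nat \<Rightarrow> nat)" "(U \<circ> r) \<longlonglongrightarrow> V"
    using bounded_imp_convergent_subsequence by blast
  have "orthogonal_matrix V"
    unfolding orthogonal_matrix_iff_entries
  proof safe
    fix i j
    have "(\<lambda>n. \<Sum>k\<in>UNIV. (U \<circ> r) n $ k $ i * (U \<circ> r) n $ k $ j) \<longlonglongrightarrow> (\<Sum>k\<in>UNIV. V $ k $ i * V $ k $ j)"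
      by (intro tendsto_intros r)
    moreover have "(\<Sum>k\<in>UNIV. (U \<circ> r) n $ k $ i * (U \<circ> r) n $ k $ j) = (if i = j then 1 else 0)" for n
      using orthogonal_matrix_entries(1)[OF assms] by simp
    ultimately have "(\<lambda>n::nat. if i = j then 1 else 0 :: real) \<longlonglongrightarrow> (\<Sum>k\<in>UNIV. V $ k $ i * V $ k $ j)"
      by (simp only:)
    then show "(\<Sum>k\<in>UNIV. V $ k $ i * V $ k $ j) = (if i = j then 1 else 0)"
      using LIMSEQ_unique tendsto_const by blast
  qed
  then show ?thesis using r that by blast
qed

text \<open>\<open>U\<close> itself may oscillate, so a subsequence is unavoidable; once
  \<open>U\<close> converges along it, the values \<open>d\<close> converge too, being polynomials
  in \<open>U\<close> and the matrices. In the theorem this also supplies a diagonalization of the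
  limit matrix.\<close>

lemma spectral_subsequence:
  fixes U :: "nat \<Rightarrow> real^'n^'n"
  assumes A: "(\<lambda>n. spectral_matrix (U n) (d n)) \<longlonglongrightarrow> A" and U: "\<And>n. orthogonal_matrix (U n)"
  obtains r V e where "strict_mono r" "(U \<circ> r) \<longlonglongrightarrow> V" "orthogonal_matrix V"
    "\<forall>k. (\<lambda>n. d (r n) k) \<longlonglongrightarrow> e k" "A = spectral_matrix V e"
proof -
  obtain r V where r: "strict_mono r" "(U \<circ> r) \<longlonglongrightarrow> V" "orthogonal_matrix V"
    using orthogonal_matrix_convergent_subsequence[of U, OF U] .
  define e where "e k = (\<Sum>i\<in>UNIV. \<Sum>j\<in>UNIV. V $ k $ i * A $ i $ j * V $ k $ j)" for k
  have Ar: "(\<lambda>n. spectral_matrix ((U \<circ> r) n) (d (r n))) \<longlonglongrightarrow> A"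
    using LIMSEQ_subseq_LIMSEQ[OF A r(1)] by (simp add: o_def)
  have d: "(\<lambda>n. d (r n) k) \<longlonglongrightarrow> e k" for k
  proof -
    have "d (r n) k = (\<Sum>i\<in>UNIV. \<Sum>j\<in>UNIV. (U \<circ> r) n $ k $ i *
        spectral_matrix ((U \<circ> r) n) (d (r n)) $ i $ j * (U \<circ> r) n $ k $ j)" for n
      by (rule spectral_matrix_entry_back) (simp_all add: U)
    then show ?thesis
      unfolding e_def by (simp only:) (intro tendsto_intros r Ar)
  qed
  have "A = spectral_matrix V e"
    by (rule LIMSEQ_unique[OF Ar tendsto_spectral_matrix[OF r(2) d]])
  with r d that show ?thesis by blast
qed

text \<open>Subsequence argument: a subsequence staying away from the claimed limit has a further
  one along which the factors converge to some diagonalization \<open>W\<close>, \<open>e'\<close>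
  of the same matrix. Since the functional calculus does not see which diagonalization is used, the
  values still converge to the claimed limit. Continuity at the limiting eigenvalues suffices, which
  admits cut-off functions that jump elsewhere.\<close>

lemma tendsto_spectral_function:
  fixes U :: "nat \<Rightarrow> real^'n^'n"
  assumes A: "(\<lambda>n. spectral_matrix (U n) (d n)) \<longlonglongrightarrow> spectral_matrix V e"
    and U: "\<And>n. orthogonal_matrix (U n)" and V: "orthogonal_matrix V"
    and \<phi>: "\<And>\<mu>. real_eigenvalue (spectral_matrix V e) \<mu> \<Longrightarrow> isCont \<phi> \<mu>"
  shows "(\<lambda>n. spectral_matrix (U n) (\<lambda>k. \<phi> (d n k))) \<longlonglongrightarrow> spectral_matrix V (\<lambda>k. \<phi> (e k))"
proof (rule LIMSEQ_I, rule ccontr)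
  fix r :: real
  let ?X = "\<lambda>n. spectral_matrix (U n) (\<lambda>k. \<phi> (d n k))" and ?L = "spectral_matrix V (\<lambda>k. \<phi> (e k))"
  assume r: "0 < r" "\<not> (\<exists>n0. \<forall>n\<ge>n0. norm (?X n - ?L) < r)"
  then have "infinite {n. \<not> norm (?X n - ?L) < r}"
    unfolding infinite_nat_iff_unbounded_le by auto
  then obtain s :: "nat \<Rightarrow> nat" where s: "strict_mono s" "\<And>n. s n \<in> {n. \<not> norm (?X n - ?L) < r}"
    using infinite_enumerate by blast
  have "(\<lambda>n. spectral_matrix (U (s n)) (d (s n))) \<longlonglongrightarrow> spectral_matrix V e"
    using LIMSEQ_subseq_LIMSEQ[OF A s(1)] by (simp add: o_def)
  then obtain t W e' where t: "strict_mono t"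
    "((\<lambda>n. U (s n)) \<circ> t) \<longlonglongrightarrow> W" "orthogonal_matrix W" "\<forall>k. (\<lambda>n. d (s (t n)) k) \<longlonglongrightarrow> e' k"
    "spectral_matrix V e = spectral_matrix W e'"
    by (rule spectral_subsequence) (rule U)
  have "(\<lambda>n. \<phi> (d (s (t n)) k)) \<longlonglongrightarrow> \<phi> (e' k)" for k
  proof (rule isCont_tendsto_compose[OF _ t(4)[rule_format]])
    show "isCont \<phi> (e' k)"
      by (rule \<phi>) (unfold t(5), rule spectral_matrix_eigenvalue(3)[OF t(3)])
  qed
  from tendsto_spectral_matrix[OF t(2) this]
  have "(\<lambda>n. ?X (s (t n))) \<longlonglongrightarrow> spectral_matrix W (\<lambda>k. \<phi> (e' k))"
    by (simp add: o_def)
  then have "(\<lambda>n. ?X (s (t n))) \<longlonglongrightarrow> ?L"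
    unfolding spectral_matrix_functional_calculus[OF V t(3) t(5)] .
  from LIMSEQ_D[OF this r(1)] obtain n0 where "\<forall>n\<ge>n0. norm (?X (s (t n)) - ?L) < r" by blast
  then show False using s(2)[of "t n0"] by auto
qed

text \<open>The count is the trace of the matrix obtained by applying the indicator of the half-line
  from \<rho> on, a function continuous away from \<rho>; a convergent sequence of integers is
  eventually constant.\<close>

lemma eventually_card_spectrum_above:
  fixes U :: "nat \<Rightarrow> real^'n^'n"
  assumes A: "(\<lambda>n. spectral_matrix (U n) (d n)) \<longlonglongrightarrow> spectral_matrix V e"
    and U: "\<And>n. orthogonal_matrix (U n)" and V: "orthogonal_matrix V"
    and \<mu>: "\<not> real_eigenvalue (spectral_matrix V e) \<rho>"
  shows "\<forall>\<^sub>F n in sequentially. card {k. \<rho> \<le> d n k} = card {k. \<rho> \<le> e k}"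
proof -
  define \<phi> :: "real \<Rightarrow> real" where "\<phi> = (\<lambda>t. if \<rho> \<le> t then 1 else 0)"
  have "isCont \<phi> \<mu>" if "\<mu> \<noteq> \<rho>" for \<mu>
  proof (cases "\<mu> < \<rho>")
    case True
    then have "\<forall>\<^sub>F t in nhds \<mu>. \<phi> t = 0"
      by (intro eventually_mono[OF eventually_nhds_in_open[of "{..<\<rho>}"]]) (auto simp: \<phi>_def)
    then show ?thesis using isCont_cong[THEN iffD2] continuous_const by fast
  next
    case False
    then have "\<forall>\<^sub>F t in nhds \<mu>. \<phi> t = 1"
      using that by (intro eventually_mono[OF eventually_nhds_in_open[of "{\<rho><..}"]]) (auto simp: \<phi>_def)
    then show ?thesis using isCont_cong[THEN iffD2] continuous_const by fast
  qed
  then have "(\<lambda>n. spectral_matrix (U n) (\<lambda>k. \<phi> (d n k))) \<longlonglongrightarrow> spectral_matrix V (\<lambda>k. \<phi> (e k))"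
    using \<mu> by (intro tendsto_spectral_function[OF A U V]) metis
  then have "(\<lambda>n. trace (spectral_matrix (U n) (\<lambda>k. \<phi> (d n k)))) \<longlonglongrightarrow> trace (spectral_matrix V (\<lambda>k. \<phi> (e k)))"
    unfolding trace_def by (intro tendsto_intros)
  moreover have "(\<Sum>k\<in>UNIV. \<phi> (g k)) = real (card {k. \<rho> \<le> g k})" for g :: "'n \<Rightarrow> real"
    by (simp add: \<phi>_def sum.If_cases)
  ultimately have "(\<lambda>n. real (card {k. \<rho> \<le> d n k})) \<longlonglongrightarrow> real (card {k. \<rho> \<le> e k})"
    by (simp add: trace_spectral_matrix U V)
  then have "\<forall>\<^sub>F n in sequentially. dist (real (card {k. \<rho> \<le> d n k})) (real (card {k. \<rho> \<le> e k})) < 1"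
    by (rule tendstoD) simp
  then show ?thesis by eventually_elim (simp add: dist_real_def)
qed

text \<open>For a decreasing diagonal the indices above the threshold form an initial segment of the
  index type, and an initial segment of size \<open>k\<close> consists of the indices with fewer
  than \<open>k\<close> predecessors.\<close>

lemma first_indices_decreasing:
  fixes A :: "real^'n::{finite,linorder}^'n::_"
  assumes "decreasing_diagonal A"
  shows "first_indices (card {i. \<rho> \<le> A $ i $ i}) = {i. \<rho> \<le> A $ i $ i}"
proof -
  let ?I = "{i. \<rho> \<le> A $ i $ i}"
  have down: "j \<in> ?I" if "i \<in> ?I" "j \<le> i" for i j
    using assms that unfolding decreasing_diagonal_def by force
  have "card {j. j < i} < card ?I \<longleftrightarrow> i \<in> ?I" for i
  proof
    assume "i \<in> ?I"
    then have "insert i {j. j < i} \<subseteq> ?I" using down by (auto simp: less_imp_le)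
    then have "card (insert i {j. j < i}) \<le> card ?I" by (intro card_mono) auto
    then show "card {j. j < i} < card ?I" by simp
  next
    assume lt: "card {j. j < i} < card ?I"
    show "i \<in> ?I"
    proof (rule ccontr)
      assume "i \<notin> ?I"
      then have "?I \<subseteq> {j. j < i}" using down by (auto simp: not_less[symmetric])
      then have "card ?I \<le> card {j. j < i}" by (intro card_mono) auto
      then show False using lt by simp
    qed
  qed
  then show ?thesis by (auto simp: first_indices_def)
qed

text \<open>Zero padding brings both matrices into the form \<open>spectral_matrix U\<close>, so
  that continuity of the functional calculus applies although the block sizes vary.\<close>

lemma row_block_products:
  fixes U :: "real^'n^'n"
  shows "transpose (row_block I U) ** diag_block_inv I A ** row_block I U
      = spectral_matrix U (\<lambda>k. if k \<in> I then 1 / A $ k $ k else 0)"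
    and "transpose (row_block I U) ** row_block I U
      = spectral_matrix U (\<lambda>k. if k \<in> I then 1 else 0)"
proof -
  have "diag_block_inv I A = diag_of (\<lambda>k. if k \<in> I then 1 / A $ k $ k else 0)"
    by (auto simp: diag_block_inv_def diag_of_def vec_eq_iff)
  then show "transpose (row_block I U) ** diag_block_inv I A ** row_block I U
      = spectral_matrix U (\<lambda>k. if k \<in> I then 1 / A $ k $ k else 0)"
    by (simp only: matrix_mul_diag_of)
      (auto simp: matrix_matrix_mult_def transpose_def spectral_matrix_def row_block_def vec_eq_iff intro!: sum.cong)
  show "transpose (row_block I U) ** row_block I U
      = spectral_matrix U (\<lambda>k. if k \<in> I then 1 else 0)"
    by (auto simp: matrix_matrix_mult_def transpose_def spectral_matrix_def row_block_def vec_eq_iff intro!: sum.cong)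
qed

section \<open>Projections onto polyhedra and normal maps\<close>

text \<open>The variational inequality is also sufficient: in the expansion of
  \<open>norm (a - s) ^ 2\<close> around \<open>p\<close> the mixed term has the favourable
  sign.\<close>

lemma closest_point_eqI:
  fixes S :: "'a::euclidean_space set"
  assumes "convex S" "closed S" "p \<in> S" and p: "\<And>s. s \<in> S \<Longrightarrow> inner (a - p) (s - p) \<le> 0"
  shows "closest_point S a = p"
proof (rule closest_point_unique[OF assms(1-3), symmetric], rule)
  fix s assume "s \<in> S"
  have "(norm (a - s))\<^sup>2 = (norm (a - p))\<^sup>2 - 2 * inner (a - p) (s - p) + (norm (s - p))\<^sup>2"
    by (simp add: power2_norm_eq_inner inner_diff_left inner_diff_right inner_commute)
  then have "(norm (a - p))\<^sup>2 \<le> (norm (a - s))\<^sup>2" using p[OF \<open>s \<in> S\<close>] zero_le_power2[of "norm (s - p)"] by linarith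
  then show "dist a p \<le> dist a s" unfolding dist_norm by (rule power2_le_imp_le) simp
qed

lemma polyhedron_obtains_inequalities:
  fixes S :: "'a::euclidean_space set"
  assumes "polyhedron S"
  obtains I :: "('a \<times> real) set" where "finite I" "S = {y. \<forall>p\<in>I. inner (fst p) y \<le> snd p}"
proof -
  obtain \<F> where F: "finite \<F>" "S = \<Inter>\<F>" "\<forall>h\<in>\<F>. \<exists>a b. a \<noteq> 0 \<and> h = {x. inner a x \<le> b}"
    using assms unfolding polyhedron_def by blast
  define q :: "'a set \<Rightarrow> 'a \<times> real" where "q h = (SOME p. h = {x. inner (fst p) x \<le> snd p})" for h
  have q: "h = {x. inner (fst (q h)) x \<le> snd (q h)}" if h: "h \<in> \<F>" for h
  proof -
    obtain a b where "h = {x. inner a x \<le> b}" using F(3) h by blast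
    then have "h = {x. inner (fst (a, b)) x \<le> snd (a, b)}" by simp
    then show ?thesis unfolding q_def by (rule someI)
  qed
  have "x \<in> S \<longleftrightarrow> (\<forall>h\<in>\<F>. inner (fst (q h)) x \<le> snd (q h))" for x
    unfolding F(2) using q by blast
  then have "S = {y. \<forall>p\<in>q ` \<F>. inner (fst p) y \<le> snd p}" by auto
  with F(1) that[of "q ` \<F>"] show ?thesis by blast
qed

text \<open>Constraints that are strict at \<open>x\<close> stay strict nearby, so only the active
  ones restrict directions. The second claim, a radius valid for all tangent directions at once, is
  what polyhedrality gives beyond convexity.\<close>

lemma tangent_cone_polyhedron:
  fixes S :: "'a::euclidean_space set"
  assumes I: "finite I" and S: "S = {y. \<forall>p\<in>I. inner (fst p) y \<le> snd p}" and x: "x \<in> S"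
  shows "tangent_cone S x = {v. \<forall>p\<in>I. inner (fst p) x = snd p \<longrightarrow> inner (fst p) v \<le> 0}"
    and "\<exists>\<delta>>0. \<forall>v\<in>tangent_cone S x. norm v < \<delta> \<longrightarrow> x + v \<in> S"
proof -
  let ?T = "{v. \<forall>p\<in>I. inner (fst p) x = snd p \<longrightarrow> inner (fst p) v \<le> 0}"
  have "\<forall>\<^sub>F v in nhds 0. \<forall>p\<in>I. inner (fst p) x < snd p \<longrightarrow> inner (fst p) (x + v) < snd p"
  proof (rule eventually_ball_finite[OF I], rule)
    fix p assume "p \<in> I"
    show "\<forall>\<^sub>F v in nhds 0. inner (fst p) x < snd p \<longrightarrow> inner (fst p) (x + v) < snd p"
    proof (cases "inner (fst p) x < snd p")
      case True
      have "((\<lambda>v. inner (fst p) (x + v)) \<longlongrightarrow> inner (fst p) (x + 0)) (nhds 0)"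
        by (intro tendsto_intros tendsto_ident_at[of _ UNIV, simplified] filterlim_ident)
      then have "\<forall>\<^sub>F v in nhds 0. inner (fst p) (x + v) < snd p"
        by (rule order_tendstoD(2)) (simp add: True)
      then show ?thesis by eventually_elim simp
    qed simp
  qed
  then obtain \<delta> where \<delta>: "\<delta> > 0" "\<And>v p. norm v < \<delta> \<Longrightarrow> p \<in> I \<Longrightarrow> inner (fst p) x < snd p \<Longrightarrow>
      inner (fst p) (x + v) < snd p"
    unfolding eventually_nhds_metric by (auto simp: dist_norm)
  have step: "x + v \<in> S" if v: "v \<in> ?T" "norm v < \<delta>" for v
  proof -
    have "inner (fst p) (x + v) \<le> snd p" if p: "p \<in> I" for p
    proof (cases "inner (fst p) x = snd p")
      case True
      then show ?thesis using v(1) p by (auto simp: inner_add_right)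
    next
      case False
      then show ?thesis using \<delta>(2)[OF v(2) p] x p by (force simp: S)
    qed
    then show ?thesis by (simp add: S)
  qed
  show T: "tangent_cone S x = ?T"
  proof (intro equalityI subsetI)
    fix v assume "v \<in> tangent_cone S x"
    then obtain t where t: "t > 0" "x + t *\<^sub>R v \<in> S" by (auto simp: tangent_cone_def)
    then have "t * inner (fst p) v \<le> 0" if "p \<in> I" "inner (fst p) x = snd p" for p
      using that by (auto simp: S inner_add_right)
    then show "v \<in> ?T" using t(1) by (auto simp: mult_le_0_iff)
  next
    fix v assume v: "v \<in> ?T"
    \<comment> \<open>Adding 1 keeps the denominator positive at \<open>v = 0\<close>; the factor 2
      yields a strict bound.\<close>
    define t where "t = \<delta> / (2 * (norm v + 1))"
    have t: "t > 0" using \<delta>(1) by (simp add: t_def add_nonneg_pos)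
    have "t * norm v \<le> t * (norm v + 1)" using t by simp
    also have "\<dots> = \<delta> / 2" by (simp add: t_def field_simps add_nonneg_eq_0_iff)
    also have "\<dots> < \<delta>" using \<delta>(1) by simp
    finally have "norm (t *\<^sub>R v) < \<delta>" using t by simp
    moreover have "t *\<^sub>R v \<in> ?T" using v t by (auto simp: mult_le_0_iff)
    ultimately have "x + t *\<^sub>R v \<in> S" by (intro step)
    then show "v \<in> tangent_cone S x" using t by (auto simp: tangent_cone_def)
  qed
  show "\<exists>\<delta>>0. \<forall>v\<in>tangent_cone S x. norm v < \<delta> \<longrightarrow> x + v \<in> S"
    unfolding T using \<delta>(1) step by blast
qed

text \<open>The projection is differentiated at \<open>z n\<close> as well as at \<open>z0\<close>,
  so the cone is attached to an arbitrary point; at \<open>z0\<close> it is the \<open>K\<close> of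
  the theorem.\<close>

definition critical_cone :: "'a::euclidean_space set \<Rightarrow> 'a \<Rightarrow> 'a set" where
  "critical_cone S z = tangent_cone S (closest_point S z) \<inter> {v. inner v (z - closest_point S z) = 0}"

lemma critical_cone:
  fixes S :: "'a::euclidean_space set"
  assumes "polyhedron S" "S \<noteq> {}"
  shows "closed (critical_cone S z)" "convex (critical_cone S z)" "0 \<in> critical_cone S z"
    "cone (critical_cone S z)"
proof -
  obtain I where I: "finite I" "S = {y. \<forall>p\<in>I. inner (fst p) y \<le> snd p}"
    using polyhedron_obtains_inequalities[OF assms(1)] .
  define x where "x = closest_point S z"
  have "x \<in> S"
    unfolding x_def by (rule closest_point_in_set[OF polyhedron_imp_closed[OF assms(1)] assms(2)])
  note T = tangent_cone_polyhedron(1)[OF I this]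
  have K: "critical_cone S z = (\<Inter>p\<in>{p\<in>I. inner (fst p) x = snd p}. {v. inner (fst p) v \<le> 0}) \<inter> {v. inner (z - x) v = 0}"
    unfolding critical_cone_def x_def[symmetric] T by (auto simp: inner_commute)
  show "closed (critical_cone S z)"
    unfolding K by (intro closed_Int closed_INT ballI closed_halfspace_le closed_hyperplane)
  show "convex (critical_cone S z)"
    unfolding K by (intro convex_Int convex_INT convex_halfspace_le convex_hyperplane)
  show "0 \<in> critical_cone S z" unfolding K by simp
  show "cone (critical_cone S z)"
    unfolding K cone_def by (auto simp: mult_le_0_iff)
qed

text \<open>Moreau's decomposition: the residual \<open>h - P h\<close> is orthogonal to
  \<open>P h\<close> and polar to the cone.\<close>

lemma closest_point_cone:
  fixes K :: "'a::euclidean_space set"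
  assumes K: "closed K" "convex K" "0 \<in> K" "cone K"
  defines "P \<equiv> closest_point K"
  shows "inner (h - P h) (P h) = 0" "u \<in> K \<Longrightarrow> inner (h - P h) u \<le> 0" "P h \<in> K" "P 0 = 0"
    "norm (P h) \<le> norm h" "norm (h - P h) \<le> norm h" "0 < t \<Longrightarrow> P (t *\<^sub>R h) = t *\<^sub>R P h"
proof -
  have ne: "K \<noteq> {}" using K(3) by blast
  show in_K: "P h \<in> K" for h unfolding P_def by (rule closest_point_in_set[OF K(1) ne])
  have dot: "inner (h - P h) (u - P h) \<le> 0" if "u \<in> K" for u h
    unfolding P_def by (rule closest_point_dot[OF K(2,1) that])
  \<comment> \<open>Testing the projection inequality with \<open>0\<close> and with
    \<open>2 * P h\<close>, both in the cone, gives the two signs.\<close>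
  show 0: "inner (h - P h) (P h) = 0" for h
    using dot[OF K(3), of h] dot[OF mem_cone[OF K(4) in_K[of h], of 2], of h]
    by (simp add: inner_diff_right scaleR_2)
  show le: "inner (h - P h) u \<le> 0" if "u \<in> K" for h u
    using dot[OF that, of h] 0[of h] by (simp add: inner_diff_right)
  show P0: "P 0 = 0" unfolding P_def by (rule closest_point_self[OF K(3)])
  show "norm (P h) \<le> norm h"
    using closest_point_lipschitz[OF K(2,1) ne, of h 0] P0 by (simp add: P_def)
  show "norm (h - P h) \<le> norm h"
    using closest_point_le[OF K(1,3), of h] by (simp add: P_def dist_norm)
  show "P (t *\<^sub>R h) = t *\<^sub>R P h" if "0 < t"
    unfolding P_def
  proof (rule closest_point_eqI[OF K(2,1)])
    show "t *\<^sub>R closest_point K h \<in> K" using mem_cone[OF K(4) in_K[of h], of t] that by (simp add: P_def)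
    fix s assume "s \<in> K"
    then have "inner (h - P h) (s - t *\<^sub>R P h) \<le> 0"
      using le[of s h] 0[of h] by (simp add: inner_diff_right)
    then have "t * inner (h - P h) (s - t *\<^sub>R P h) \<le> 0"
      using that by (simp add: mult_le_0_iff)
    then show "inner (t *\<^sub>R h - t *\<^sub>R closest_point K h) (s - t *\<^sub>R closest_point K h) \<le> 0"
      by (simp add: P_def flip: scaleR_diff_right)
  qed
qed

text \<open>With \<open>x = \<Pi>\<^sub>S(z)\<close>, the inequality characterizing the projection of \<open>z + h\<close> is checked at the finitely many vertices of \<open>S \<inter> cbox\<close>: at those with \<open>(z - x) \<bullet> (v - x) = 0\<close> it
  holds since \<open>v - x \<in> K\<close>, and at the others since \<open>h\<close> is small.\<close>
lemma closest_point_polyhedron_local: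
  fixes S :: "'a::euclidean_space set"
  assumes poly: "polyhedron S" and ne: "S \<noteq> {}"
  shows "\<exists>\<delta>>0. \<forall>h. norm h < \<delta> \<longrightarrow>
    closest_point S (z + h) = closest_point S z + closest_point (critical_cone S z) h"
proof -
  define x where "x = closest_point S z"
  define K where "K = critical_cone S z"
  have cl: "closed S" and cv: "convex S"
    using poly by (auto simp: polyhedron_imp_closed polyhedron_imp_convex)
  have xS: "x \<in> S" unfolding x_def by (rule closest_point_in_set[OF cl ne])
  have zx: "inner (z - x) (s - x) \<le> 0" if "s \<in> S" for s
    unfolding x_def by (rule closest_point_dot[OF cv cl that])
  note Kc = closest_point_cone[OF critical_cone[OF poly ne, where z=z], folded K_def]
  obtain I where I: "finite I" "S = {y. \<forall>p\<in>I. inner (fst p) y \<le> snd p}"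
    using polyhedron_obtains_inequalities[OF poly] .
  obtain \<delta>1 where \<delta>1: "\<delta>1 > 0" "\<And>v. v \<in> tangent_cone S x \<Longrightarrow> norm v < \<delta>1 \<Longrightarrow> x + v \<in> S"
    using tangent_cone_polyhedron(2)[OF I xS] by blast
  let ?B = "cbox (x - One) (x + One) :: 'a set"
  have "polytope (S \<inter> ?B)"
    unfolding polytope_eq_bounded_polyhedron
    by (simp add: poly polyhedron_Int bounded_Int polytope_imp_polyhedron polytope_interval)
  then obtain V where V: "finite V" "S \<inter> ?B = convex hull V" unfolding polytope_def by blast
  have VS: "v \<in> S" if "v \<in> V" for v using that V(2) hull_subset[of V convex] by blast
  \<comment> \<open>Uniform slack: over finitely many points the ratio of the gap
    \<open>- inner (z - x) (v - x)\<close> to \<open>norm (v - x)\<close> has a positive lower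
    bound, which limits the admissible size of \<open>h\<close>.\<close>
  have "\<exists>\<delta>>0. \<forall>v\<in>V. inner (z - x) (v - x) < 0 \<longrightarrow> \<delta> * norm (v - x) \<le> - inner (z - x) (v - x)"
    using V(1)
  proof induction
    case empty
    show ?case by (intro exI[of _ 1]) simp
  next
    case (insert v V)
    then obtain \<delta> where \<delta>: "\<delta> > 0" "\<And>v. v \<in> V \<Longrightarrow> inner (z - x) (v - x) < 0 \<Longrightarrow>
        \<delta> * norm (v - x) \<le> - inner (z - x) (v - x)" by blast
    show ?case
    proof (cases "inner (z - x) (v - x) < 0")
      case True
      then have n: "norm (v - x) > 0" by auto
      define \<epsilon> where "\<epsilon> = - inner (z - x) (v - x) / norm (v - x)"
      have "\<epsilon> > 0" unfolding \<epsilon>_def using True n by (intro divide_pos_pos) auto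
      moreover have "min \<delta> \<epsilon> * norm (v - x) \<le> - inner (z - x) (v - x)"
        using mult_right_mono[of "min \<delta> \<epsilon>" \<epsilon> "norm (v - x)"] n by (simp add: \<epsilon>_def)
      moreover have "min \<delta> \<epsilon> * norm (u - x) \<le> - inner (z - x) (u - x)"
        if "u \<in> V" "inner (z - x) (u - x) < 0" for u
        using \<delta>(2)[OF that] mult_right_mono[of "min \<delta> \<epsilon>" \<delta> "norm (u - x)"] by simp
      ultimately show ?thesis using \<delta>(1) by (intro exI[of _ "min \<delta> \<epsilon>"]) auto
    next
      case False
      then show ?thesis using \<delta> by (intro exI[of _ \<delta>]) auto
    qed
  qed
  then obtain \<delta>2 where \<delta>2: "\<delta>2 > 0" "\<And>v. v \<in> V \<Longrightarrow> inner (z - x) (v - x) < 0 \<Longrightarrow>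
        \<delta>2 * norm (v - x) \<le> - inner (z - x) (v - x)" by blast
  show ?thesis
  proof (intro exI[of _ "min \<delta>1 \<delta>2"] conjI allI impI)
    show "min \<delta>1 \<delta>2 > 0" using \<delta>1(1) \<delta>2(1) by simp
    fix h :: 'a assume h: "norm h < min \<delta>1 \<delta>2"
    define k where "k = closest_point K h"
    have kK: "k \<in> K" unfolding k_def by (rule Kc(3))
    then have kT: "k \<in> tangent_cone S x" and kz: "inner (z - x) k = 0"
      by (auto simp: K_def critical_cone_def x_def inner_commute)
    have "norm k \<le> norm h" unfolding k_def by (rule Kc(5))
    then have xk: "x + k \<in> S" using h by (intro \<delta>1(2)[OF kT]) simp
    have vert: "inner (z + h - (x + k)) (v - x) \<le> 0" if v: "v \<in> V" for v
    proof (cases "inner (z - x) (v - x) < 0")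
      case True
      have "inner (h - k) (v - x) \<le> norm (h - k) * norm (v - x)" by (rule norm_cauchy_schwarz)
      also have "\<dots> \<le> \<delta>2 * norm (v - x)"
        using Kc(6)[of h] h by (intro mult_right_mono) (auto simp: k_def)
      also have "\<dots> \<le> - inner (z - x) (v - x)" by (rule \<delta>2(2)[OF v True])
      finally show ?thesis by (simp add: inner_diff_left inner_add_left)
    next
      case False
      then have 0: "inner (z - x) (v - x) = 0" using zx[OF VS[OF v]] by simp
      have "v - x \<in> tangent_cone S x"
        using VS[OF v] by (auto simp: tangent_cone_def intro!: exI[of _ 1])
      then have "v - x \<in> K" using 0 by (simp add: K_def critical_cone_def x_def inner_commute)
      then have "inner (h - k) (v - x) \<le> 0" unfolding k_def by (rule Kc(2))
      then show ?thesis using 0 by (simp add: inner_diff_left inner_add_left)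
    qed
    have box: "inner (z + h - (x + k)) (s - x) \<le> 0" if "s \<in> S \<inter> ?B" for s
    proof -
      let ?H = "{y. inner (z + h - (x + k)) y \<le> inner (z + h - (x + k)) x}"
      have "V \<subseteq> ?H" using vert by (auto simp: inner_diff_right)
      then have "convex hull V \<subseteq> ?H" by (rule hull_minimal) (rule convex_halfspace_le)
      then show ?thesis using that V(2) by (auto simp: inner_diff_right)
    qed
    have "closest_point S (z + h) = x + k"
    proof (rule closest_point_eqI[OF cv cl xk])
      fix s assume s: "s \<in> S"
      \<comment> \<open>Scaling brings \<open>s\<close> into the box; the inequality is homogeneous
        in \<open>s - x\<close>, so it may be tested there.\<close>
      define t where "t = 1 / (1 + norm (s - x))"
      have t: "0 < t" "t \<le> 1" by (auto simp: t_def add_pos_nonneg divide_simps)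
      have tn: "t * norm (s - x) \<le> 1" by (auto simp: t_def divide_simps add_pos_nonneg)
      have "(1 - t) *\<^sub>R x + t *\<^sub>R s \<in> S"
        using cv xS s t by (intro convexD) auto
      then have S': "x + t *\<^sub>R (s - x) \<in> S" by (simp add: algebra_simps)
      have "\<bar>inner (t *\<^sub>R (s - x)) i\<bar> \<le> 1" if "i \<in> Basis" for i
        using Basis_le_norm[OF that, of "t *\<^sub>R (s - x)"] tn t(1) by simp
      then have "x + t *\<^sub>R (s - x) \<in> ?B"
        by (auto simp: mem_box inner_diff_left inner_add_left abs_le_iff; force)
      then have "inner (z + h - (x + k)) (t *\<^sub>R (s - x)) \<le> 0"
        using box[of "x + t *\<^sub>R (s - x)"] S' by simp
      then have "inner (z + h - (x + k)) (s - x) \<le> 0" using t(1) by (simp add: mult_le_0_iff)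
      \<comment> \<open>Moves the base point of the inequality from \<open>x\<close> to
        \<open>x + k\<close>: \<open>z - x\<close> is orthogonal to the critical cone, and
        \<open>h - k\<close> to \<open>k\<close>.\<close>
      moreover have "inner (z + h - (x + k)) k = 0"
        using kz Kc(1)[of h] by (simp add: k_def inner_diff_left inner_add_left)
      ultimately show "inner (z + h - (x + k)) (s - (x + k)) \<le> 0"
        by (simp add: inner_diff_right inner_add_right)
    qed
    then show "closest_point S (z + h) = closest_point S z + closest_point (critical_cone S z) h"
      by (simp add: x_def k_def K_def)
  qed
qed

text \<open>Stated for positively homogeneous \<open>G\<close>, to serve B-derivatives and Frechet
  derivatives alike: on the ray \<open>x + t v\<close> the remainder quotient is, up to the factor
  \<open>norm v\<close>, the error of the difference quotient.\<close>

lemma directional_derivative_limit: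
  fixes g :: "'a::real_normed_vector \<Rightarrow> 'b::real_normed_vector"
  assumes hom: "\<And>t v. t > 0 \<Longrightarrow> G (t *\<^sub>R v) = t *\<^sub>R G v"
    and lim: "((\<lambda>v. (g (x + v) - g x - G v) /\<^sub>R norm v) \<longlongrightarrow> 0) (at 0)"
  shows "((\<lambda>t. (g (x + t *\<^sub>R v) - g x) /\<^sub>R t) \<longlongrightarrow> G v) (at_right 0)"
proof (cases "v = 0")
  case True
  have "G 0 = 0" using hom[of 2 0] by (simp add: scaleR_2)
  then show ?thesis using True by simp
next
  case False
  have "filterlim (\<lambda>t. t *\<^sub>R v) (at 0) (at_right 0)"
    unfolding filterlim_at
  proof
    show "\<forall>\<^sub>F t in at_right 0. t *\<^sub>R v \<in> UNIV \<and> t *\<^sub>R v \<noteq> 0"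
      using False by (auto simp: eventually_at_filter)
    have "((\<lambda>t. t *\<^sub>R v) \<longlongrightarrow> 0 *\<^sub>R v) (at_right 0)" by (intro tendsto_intros)
    then show "((\<lambda>t. t *\<^sub>R v) \<longlongrightarrow> 0) (at_right 0)" by simp
  qed
  from filterlim_compose[OF lim this]
  have "((\<lambda>t. norm v *\<^sub>R ((g (x + t *\<^sub>R v) - g x - G (t *\<^sub>R v)) /\<^sub>R norm (t *\<^sub>R v)) + G v)
      \<longlongrightarrow> norm v *\<^sub>R 0 + G v) (at_right 0)"
    by (intro tendsto_intros)
  then have "((\<lambda>t. norm v *\<^sub>R ((g (x + t *\<^sub>R v) - g x - G (t *\<^sub>R v)) /\<^sub>R norm (t *\<^sub>R v)) + G v)
      \<longlongrightarrow> G v) (at_right 0)" by simp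
  then show ?thesis
  proof (rule Lim_transform_eventually)
    show "\<forall>\<^sub>F t in at_right 0. norm v *\<^sub>R ((g (x + t *\<^sub>R v) - g x - G (t *\<^sub>R v)) /\<^sub>R norm (t *\<^sub>R v)) + G v
        = (g (x + t *\<^sub>R v) - g x) /\<^sub>R t"
      unfolding eventually_at_filter
    proof (intro always_eventually allI impI)
      fix t :: real assume "t \<in> {0<..}"
      then have t: "t > 0" by simp
      have "norm v *\<^sub>R ((g (x + t *\<^sub>R v) - g x - G (t *\<^sub>R v)) /\<^sub>R norm (t *\<^sub>R v))
          = (norm v * inverse (t * norm v)) *\<^sub>R (g (x + t *\<^sub>R v) - g x - t *\<^sub>R G v)"
        using t by (simp add: hom)
      also have "norm v * inverse (t * norm v) = inverse t" using False by (simp add: field_simps)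
      finally show "norm v *\<^sub>R ((g (x + t *\<^sub>R v) - g x - G (t *\<^sub>R v)) /\<^sub>R norm (t *\<^sub>R v)) + G v
        = (g (x + t *\<^sub>R v) - g x) /\<^sub>R t"
        using t by (simp add: scaleR_diff_right)
    qed
  qed
qed

lemma has_B_derivative_directional:
  fixes g :: "'a::real_normed_vector \<Rightarrow> 'b::real_normed_vector"
  assumes "has_B_derivative g G x"
  shows "((\<lambda>t. (g (x + t *\<^sub>R v) - g x) /\<^sub>R t) \<longlongrightarrow> G v) (at_right 0)"
  by (rule directional_derivative_limit) (use assms in \<open>auto simp: has_B_derivative_def\<close>)

lemma has_derivative_directional:
  fixes g :: "'a::real_normed_vector \<Rightarrow> 'b::real_normed_vector"
  assumes "(g has_derivative G) (at x)"
  shows "((\<lambda>t. (g (x + t *\<^sub>R v) - g x) /\<^sub>R t) \<longlongrightarrow> G v) (at_right 0)"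
proof (rule directional_derivative_limit)
  interpret G: bounded_linear G using assms by (rule has_derivative_bounded_linear)
  show "G (t *\<^sub>R v) = t *\<^sub>R G v" for t v by (rule G.scaleR)
  have "((\<lambda>h. norm (g (x + h) - g x - G h) / norm h) \<longlongrightarrow> 0) (at 0)"
    using assms by (simp add: has_derivative_at)
  then show "((\<lambda>v. (g (x + v) - g x - G v) /\<^sub>R norm v) \<longlongrightarrow> 0) (at 0)"
    by (subst tendsto_norm_zero_iff[symmetric]) (simp add: divide_inverse_commute)
qed

lemma has_B_derivative_unique:
  fixes g :: "'a::real_normed_vector \<Rightarrow> 'b::real_normed_vector"
  assumes "has_B_derivative g G x" "has_B_derivative g G' x"
  shows "G = G'"
proof
  fix v
  show "G v = G' v"
    by (rule tendsto_unique[OF _ has_B_derivative_directional[OF assms(1)] has_B_derivative_directional[OF assms(2)]]) simp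
qed

lemma B_deriv_eq:
  fixes g :: "'a::real_normed_vector \<Rightarrow> 'b::real_normed_vector"
  assumes "has_B_derivative g G x"
  shows "B_deriv g x = G"
  unfolding B_deriv_def using assms has_B_derivative_unique by blast

text \<open>Near \<open>z\<close> the projection formula is exact, so the remainder is not merely
  small but zero.\<close>

lemma has_B_derivative_closest_point:
  fixes S :: "'a::euclidean_space set"
  assumes poly: "polyhedron S" and ne: "S \<noteq> {}"
  shows "has_B_derivative (closest_point S) (closest_point (critical_cone S z)) z"
  unfolding has_B_derivative_def
proof (intro conjI allI impI)
  have "1-lipschitz_on UNIV (closest_point S)"
    using closest_point_lipschitz[of S] poly ne
    by (auto simp: lipschitz_on_def polyhedron_imp_closed polyhedron_imp_convex)
  then show "\<exists>V B. open V \<and> z \<in> V \<and> B-lipschitz_on V (closest_point S)" by blast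
  show "closest_point (critical_cone S z) (t *\<^sub>R v) = t *\<^sub>R closest_point (critical_cone S z) v"
    if "t > 0" for t v
    by (rule closest_point_cone(7)[OF critical_cone[OF poly ne] that])
  obtain \<delta> where \<delta>: "\<delta> > 0" "\<And>h. norm h < \<delta> \<Longrightarrow>
    closest_point S (z + h) = closest_point S z + closest_point (critical_cone S z) h"
    using closest_point_polyhedron_local[OF poly ne] by blast
  have "\<forall>\<^sub>F v in at 0. (closest_point S (z + v) - closest_point S z - closest_point (critical_cone S z) v) /\<^sub>R norm v = 0"
    unfolding eventually_at by (intro exI[of _ \<delta>]) (auto simp: \<delta>)
  then show "((\<lambda>v. (closest_point S (z + v) - closest_point S z - closest_point (critical_cone S z) v) /\<^sub>R norm v) \<longlongrightarrow> 0) (at 0)"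
    by (rule tendsto_eventually)
qed

text \<open>Along the segment from \<open>z\<close> to a nearby \<open>z0\<close> the projection is affine, by homogeneity of the
  cone projection centred at \<open>z0\<close>.\<close>
lemma closest_point_critical_cone_towards:
  fixes S :: "'a::euclidean_space set"
  assumes poly: "polyhedron S" and ne: "S \<noteq> {}"
    and \<delta>: "\<And>h. norm h < \<delta> \<Longrightarrow>
      closest_point S (z0 + h) = closest_point S z0 + closest_point (critical_cone S z0) h"
    and z: "norm (z - z0) < \<delta>"
  shows "closest_point (critical_cone S z) (z0 - z) = closest_point S z0 - closest_point S z"
proof -
  let ?P = "closest_point S"
  have dir: "((\<lambda>t. (?P (z + t *\<^sub>R (z0 - z)) - ?P z) /\<^sub>R t) \<longlongrightarrow> closest_point (critical_cone S z) (z0 - z)) (at_right 0)"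
    by (rule has_B_derivative_directional[OF has_B_derivative_closest_point[OF poly ne]])
  have "(?P (z + t *\<^sub>R (z0 - z)) - ?P z) /\<^sub>R t = ?P z0 - ?P z" if t: "0 < t" "t < 1" for t
  proof -
    let ?k = "closest_point (critical_cone S z0) (z - z0)"
    \<comment> \<open>The local formula at \<open>z\<close> holds within a radius that depends on
      \<open>z\<close> and may be shorter than the segment. Seen from \<open>z0\<close>, the
      displacement is only scaled by \<open>1 - t\<close>, which is positive for
      \<open>t < 1\<close>.\<close>
    have "z + t *\<^sub>R (z0 - z) = z0 + (1 - t) *\<^sub>R (z - z0)" by (simp add: algebra_simps)
    moreover have "norm ((1 - t) *\<^sub>R (z - z0)) < \<delta>"
      using t z mult_right_mono[of "1 - t" 1 "norm (z - z0)"] by simp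
    ultimately have "?P (z + t *\<^sub>R (z0 - z)) = ?P z0 + (1 - t) *\<^sub>R ?k"
      using \<delta>[of "(1 - t) *\<^sub>R (z - z0)"] closest_point_cone(7)[OF critical_cone[OF poly ne, where z=z0], of "1 - t" "z - z0"] t
      by simp
    moreover have "?P z = ?P z0 + ?k" using \<delta>[OF z] by simp
    ultimately have "?P (z + t *\<^sub>R (z0 - z)) - ?P z = t *\<^sub>R (?P z0 - ?P z)"
      by (simp add: algebra_simps)
    then show ?thesis using t by simp
  qed
  then have "\<forall>\<^sub>F t in at_right 0. (?P (z + t *\<^sub>R (z0 - z)) - ?P z) /\<^sub>R t = ?P z0 - ?P z"
    unfolding eventually_at_right_field by (intro exI[of _ 1]) auto
  from tendsto_unique[OF _ dir tendsto_eventually[OF this]] show ?thesis by simp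
qed

text \<open>Near \<open>z\<close> the projection moves exactly by the cone projection of
  \<open>h\<close>, so the remainder of the normal map is the remainder of \<open>g\<close> at that
  increment, whose norm is at most \<open>norm h\<close>.\<close>

lemma has_B_derivative_normal_map:
  fixes S :: "'a::euclidean_space set"
  assumes poly: "polyhedron S" and ne: "S \<noteq> {}"
    and D: "open D" "closest_point S z \<in> D" and lip: "B-lipschitz_on D g"
    and J: "(g has_derivative J) (at (closest_point S z))"
  shows "has_B_derivative (normal_map S g)
    (\<lambda>h. J (closest_point (critical_cone S z) h) + h - closest_point (critical_cone S z) h) z"
  unfolding has_B_derivative_def
proof (intro conjI allI impI)
  let ?P = "closest_point S" and ?Q = "closest_point (critical_cone S z)"
  interpret J: bounded_linear J using J by (rule has_derivative_bounded_linear)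
  have P_lip: "1-lipschitz_on UNIV ?P"
    using closest_point_lipschitz[of S] poly ne
    by (auto simp: lipschitz_on_def polyhedron_imp_closed polyhedron_imp_convex)
  have contP: "continuous_on UNIV ?P" by (rule lipschitz_on_continuous_on[OF P_lip])
  have "open (?P -` D)" by (rule open_vimage[OF D(1) contP])
  moreover have "(B + 1 + 1)-lipschitz_on (?P -` D) (normal_map S g)"
  proof -
    have P: "1-lipschitz_on (?P -` D) ?P" by (rule lipschitz_on_subset[OF P_lip]) simp
    have "(B * 1)-lipschitz_on (?P -` D) (\<lambda>z. g (?P z))"
      by (rule lipschitz_on_compose2[OF P lipschitz_on_subset[OF lip]]) auto
    moreover have "1-lipschitz_on (?P -` D) (\<lambda>z. z)" by (simp add: lipschitz_on_def)
    ultimately show ?thesis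
      unfolding normal_map_def[abs_def] using P by (intro lipschitz_on_diff lipschitz_on_add) auto
  qed
  ultimately show "\<exists>V B. open V \<and> z \<in> V \<and> B-lipschitz_on V (normal_map S g)"
    using D(2) by (intro exI[of _ "?P -` D"]) auto
  show "J (?Q (t *\<^sub>R v)) + t *\<^sub>R v - ?Q (t *\<^sub>R v) = t *\<^sub>R (J (?Q v) + v - ?Q v)" if "t > 0" for t v
    using closest_point_cone(7)[OF critical_cone[OF poly ne, where z=z] that, of v]
    by (simp add: J.scaleR algebra_simps)
  obtain \<delta> where \<delta>: "\<delta> > 0" "\<And>h. norm h < \<delta> \<Longrightarrow> ?P (z + h) = ?P z + ?Q h"
    using closest_point_polyhedron_local[OF poly ne] by blast
  have Qn: "norm (?Q h) \<le> norm h" for h by (rule closest_point_cone(5)[OF critical_cone[OF poly ne]])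
  show "((\<lambda>v. (normal_map S g (z + v) - normal_map S g z - (J (?Q v) + v - ?Q v)) /\<^sub>R norm v) \<longlongrightarrow> 0) (at 0)"
  proof (rule tendstoI)
    fix e :: real assume e: "e > 0"
    obtain d where d: "d > 0" "\<And>y. norm (y - ?P z) < d \<Longrightarrow> norm (g y - g (?P z) - J (y - ?P z)) \<le> e / 2 * norm (y - ?P z)"
      using J half_gt_zero[OF e] unfolding has_derivative_at_alt by blast
    have "dist ((normal_map S g (z + v) - normal_map S g z - (J (?Q v) + v - ?Q v)) /\<^sub>R norm v) 0 < e"
      if v: "v \<noteq> 0" "norm v < min d \<delta>" for v
    proof -
      have eq: "normal_map S g (z + v) - normal_map S g z - (J (?Q v) + v - ?Q v)
          = g (?P z + ?Q v) - g (?P z) - J (?Q v)"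
        using \<delta>(2)[of v] v by (simp add: normal_map_def)
      have "norm (g (?P z + ?Q v) - g (?P z) - J (?Q v)) \<le> e / 2 * norm (?Q v)"
        using d(2)[of "?P z + ?Q v"] Qn[of v] v by simp
      also have "\<dots> \<le> e / 2 * norm v" using Qn[of v] e by simp
      finally have "norm (g (?P z + ?Q v) - g (?P z) - J (?Q v)) / norm v \<le> e / 2"
        using v(1) by (simp add: divide_simps)
      moreover have "dist ((g (?P z + ?Q v) - g (?P z) - J (?Q v)) /\<^sub>R norm v) 0
          = norm (g (?P z + ?Q v) - g (?P z) - J (?Q v)) / norm v"
        by (simp add: divide_inverse_commute)
      ultimately show ?thesis unfolding eq using e by linarith
    qed
    then show "\<forall>\<^sub>F v in at 0. dist ((normal_map S g (z + v) - normal_map S g z - (J (?Q v) + v - ?Q v)) /\<^sub>R norm v) 0 < e"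
      unfolding eventually_at using d(1) \<delta>(1) by (intro exI[of _ "min d \<delta>"]) auto
  qed
qed

text \<open>The least norm on the unit sphere is attained and positive, because injectivity and
  \<open>A 0 = 0\<close> exclude further zeros; homogeneity spreads the bound. It replaces a bounded
  inverse, as \<open>L_K\<close> is not linear in general.\<close>

lemma positively_homogeneous_coercive:
  fixes A :: "'a::euclidean_space \<Rightarrow> 'b::real_normed_vector"
  assumes cont: "continuous_on UNIV A" and inj: "inj A"
    and hom: "\<And>t h. t > 0 \<Longrightarrow> A (t *\<^sub>R h) = t *\<^sub>R A h"
  shows "\<exists>c>0. \<forall>h. c * norm h \<le> norm (A h)"
proof -
  have A0: "A 0 = 0" using hom[of 2 0] by (simp add: scaleR_2)
  let ?S = "sphere 0 1 :: 'a set"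
  have "?S \<noteq> {}" by simp
  moreover have "continuous_on ?S (\<lambda>h. norm (A h))"
    by (intro continuous_on_norm continuous_on_subset[OF cont]) simp
  ultimately obtain u where u: "u \<in> ?S" "\<forall>h\<in>?S. norm (A u) \<le> norm (A h)"
    using continuous_attains_inf[OF compact_sphere] by blast
  have "A u \<noteq> 0" using inj A0 u(1) by (auto dest: injD[of A u 0])
  moreover have "norm (A u) * norm h \<le> norm (A h)" for h
  proof (cases "h = 0")
    case False
    have "norm (A u) \<le> norm (A ((1 / norm h) *\<^sub>R h))" using False by (intro u(2)[rule_format]) simp
    also have "\<dots> = norm (A h) / norm h" using False by (subst hom) auto
    finally show ?thesis using False by (simp add: field_simps)
  qed (simp add: A0)
  ultimately show ?thesis by (intro exI[of _ "norm (A u)"]) auto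
qed

text \<open>Mean value inequality on the segment for \<open>g\<close> minus its linearization at
  \<open>y\<close>. The constant is \<open>B\<close> where Taylor's formula would give
  \<open>B / 2\<close>.\<close>

lemma quadratic_remainder_bound:
  fixes g :: "'a::euclidean_space \<Rightarrow> 'b::real_normed_vector"
  assumes T: "convex T" and J: "\<And>u. u \<in> T \<Longrightarrow> (g has_derivative J u) (at u)"
    and lip: "\<And>u v h. u \<in> T \<Longrightarrow> v \<in> T \<Longrightarrow> norm (J u h - J v h) \<le> B * norm (u - v) * norm h"
    and B: "0 \<le> B" and y: "y \<in> T" "y' \<in> T"
  shows "norm (g y' - g y - J y (y' - y)) \<le> B * (norm (y' - y))\<^sup>2"
proof -
  have seg: "closed_segment y y' \<subseteq> T" by (rule closed_segment_subset[OF y T])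
  have "norm (g y' - g y - J y (y' - y)) \<le> norm (y' - y) * (B * norm (y' - y))"
  proof (rule differentiable_bound_linearization[where S = "closed_segment y y'" and f' = J and ?x0.0 = y])
    show "y + t *\<^sub>R (y' - y) \<in> closed_segment y y'" if "t \<in> {0..1}" for t
      using that by (auto simp: closed_segment_def algebra_simps intro!: exI[of _ t])
    show "(g has_derivative J u) (at u within closed_segment y y')" if "u \<in> closed_segment y y'" for u
      by (rule has_derivative_at_withinI[OF J]) (use that seg in auto)
    show "onorm (J u - J y) \<le> B * norm (y' - y)" if u: "u \<in> closed_segment y y'" for u
      unfolding fun_diff_def
    proof (rule onorm_le)
      fix h
      have "norm (J u h - J y h) \<le> B * norm (u - y) * norm h"
        using u seg y by (intro lip) auto
      also have "\<dots> \<le> B * norm (y' - y) * norm h"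
        using segment_bound(1)[OF u] B by (intro mult_right_mono mult_left_mono) (auto simp: norm_minus_commute)
      finally show "norm (J u h - J y h) \<le> B * norm (y' - y) * norm h" .
    qed
  qed auto
  then show ?thesis by (simp add: power2_eq_square mult_ac)
qed

text \<open>Deterministic core, applied to one sample path. With \<open>y = z n - z0\<close> and
  \<open>G = g n x0 - v0\<close>, a Taylor bound of order \<open>norm y ^ 2\<close> for the left
  side is combined with \<open>norm y \<le> 2 / c * norm G\<close> from coercivity; one factor
  \<open>norm y\<close> is kept, since it tends to 0.\<close>

lemma normal_map_error_bound:
  fixes S :: "'a::euclidean_space set" and g :: "nat \<Rightarrow> 'a \<Rightarrow> 'a"
  assumes poly: "polyhedron S" and ne: "S \<noteq> {}"
    and D: "open D" "x0 \<in> D" and x0: "x0 = closest_point S z0" and z0: "z0 = x0 - v0"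
    and z: "z \<longlonglongrightarrow> z0" and sol: "\<forall>\<^sub>F n in sequentially. normal_map S (g n) (z n) = 0"
    and lip: "\<And>n. (b n)-lipschitz_on D (g n)"
    and J: "\<And>n y. y \<in> D \<Longrightarrow> (g n has_derivative J n y) (at y)"
    and J_lip: "\<And>n y y' h. y \<in> D \<Longrightarrow> y' \<in> D \<Longrightarrow> norm (J n y h - J n y' h) \<le> b n * norm (y - y') * norm h"
    and b: "Bseq b"
    and e: "\<And>n h. norm (J n x0 h - L h) \<le> e n * norm h" "e \<longlonglongrightarrow> 0"
    and c: "c > 0" "\<And>h. c * norm h \<le>
      norm (L (closest_point (critical_cone S z0) h) + h - closest_point (critical_cone S z0) h)"
  shows "\<exists>\<kappa>\<ge>0. \<forall>\<^sub>F n in sequentially.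
    norm (B_deriv (normal_map S (g n)) (z n) (z0 - z n) - (g n x0 - v0)) \<le> \<kappa> * norm (z n - z0) * norm (g n x0 - v0)"
proof -
  let ?Q = "closest_point (critical_cone S z0)"
  define x where "x n = closest_point S (z n)" for n
  obtain r where r: "r > 0" "ball x0 r \<subseteq> D" using D open_contains_ball by blast
  obtain \<delta> where \<delta>: "\<delta> > 0" "\<And>h. norm h < \<delta> \<Longrightarrow>
      closest_point S (z0 + h) = closest_point S z0 + ?Q h"
    using closest_point_polyhedron_local[OF poly ne] by blast
  have Qn: "norm (?Q h) \<le> norm h" for h by (rule closest_point_cone(5)[OF critical_cone[OF poly ne]])
  obtain B where B: "B > 0" "\<And>n. norm (b n) \<le> B" using b by (auto simp: Bseq_def)
  have taylor: "norm (g n y' - g n y - J n y (y' - y)) \<le> B * (norm (y' - y))\<^sup>2"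
    if y: "y \<in> ball x0 r" "y' \<in> ball x0 r" for n y y'
  proof (rule quadratic_remainder_bound[OF convex_ball _ _ _ y])
    show "(g n has_derivative J n u) (at u)" if "u \<in> ball x0 r" for u
      using that r(2) by (intro J) auto
    show "norm (J n u h - J n v h) \<le> B * norm (u - v) * norm h" if "u \<in> ball x0 r" "v \<in> ball x0 r" for u v h
    proof -
      have "norm (J n u h - J n v h) \<le> b n * norm (u - v) * norm h"
        using that r(2) by (intro J_lip) auto
      also have "\<dots> \<le> B * norm (u - v) * norm h"
        using B(2)[of n] by (intro mult_right_mono) auto
      finally show ?thesis .
    qed
  qed (use B in simp)
  have y0: "(\<lambda>n. norm (z n - z0)) \<longlonglongrightarrow> 0" using z by (simp add: LIM_zero_iff tendsto_norm_zero_iff)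
  have "(\<lambda>n. B * norm (z n - z0) + e n) \<longlonglongrightarrow> B * 0 + 0" by (intro tendsto_intros y0 e)
  \<comment> \<open>Below \<open>c / 2\<close> the error terms can be absorbed into the coercivity
    bound \<open>c * norm y\<close>.\<close>
  then have ev1: "\<forall>\<^sub>F n in sequentially. B * norm (z n - z0) + e n < c / 2"
    by (rule order_tendstoD) (use c in simp)
  have ev2: "\<forall>\<^sub>F n in sequentially. norm (z n - z0) < min \<delta> r"
    by (rule order_tendstoD[OF y0]) (use \<delta>(1) r(1) in simp)
  have "\<forall>\<^sub>F n in sequentially.
    norm (B_deriv (normal_map S (g n)) (z n) (z0 - z n) - (g n x0 - v0))
      \<le> 2 * B / c * norm (z n - z0) * norm (g n x0 - v0)"
    using ev1 ev2 sol
  proof eventually_elim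
    case (elim n)
    define y where "y = z n - z0"
    define k where "k = ?Q y"
    define G where "G = g n x0 - v0"
    have yn: "norm y < \<delta>" "norm y < r" and sol_n: "g n (x n) + z n - x n = 0"
      using elim by (auto simp: y_def x_def normal_map_def)
    have xk: "x n = x0 + k" using \<delta>(2)[OF yn(1)] by (simp add: x_def k_def y_def x0)
    have kn: "norm k \<le> norm y" unfolding k_def by (rule Qn)
    have inb: "x n \<in> ball x0 r" "x0 \<in> ball x0 r" using kn yn r(1) by (auto simp: xk dist_norm)
    have xD: "x n \<in> D" using inb r by blast
    have "closest_point (critical_cone S (z n)) (z0 - z n) = x0 - x n"
      using closest_point_critical_cone_towards[OF poly ne \<delta>(2)] yn by (simp add: x0 x_def y_def)
    moreover have "B_deriv (normal_map S (g n)) (z n)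
      = (\<lambda>h. J n (x n) (closest_point (critical_cone S (z n)) h) + h - closest_point (critical_cone S (z n)) h)"
      unfolding x_def
      by (rule B_deriv_eq[OF has_B_derivative_normal_map[OF poly ne D(1) _ lip J]]) (use xD in \<open>auto simp: x_def\<close>)
    ultimately have w: "B_deriv (normal_map S (g n)) (z n) (z0 - z n) = J n (x n) (x0 - x n) + (z0 - z n) - (x0 - x n)"
      by simp
    \<comment> \<open>Inserts the equations \<open>g n (x n) + z n - x n = 0\<close> and
      \<open>z0 = x0 - v0\<close>; the affine parts then agree with those of the B-derivative, and
      only a Taylor remainder survives.\<close>
    have G: "G = g n x0 - g n (x n) + (z0 - z n) - (x0 - x n)"
      using sol_n by (simp add: G_def z0 algebra_simps)
    have "norm (B_deriv (normal_map S (g n)) (z n) (z0 - z n) - G) = norm (g n x0 - g n (x n) - J n (x n) (x0 - x n))"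
      unfolding w G by (subst norm_minus_commute) (simp add: algebra_simps)
    also have "\<dots> \<le> B * (norm (x0 - x n))\<^sup>2" by (rule taylor[OF inb])
    also have "\<dots> \<le> B * (norm y)\<^sup>2" using kn B by (simp add: xk power_mono)
    finally have 1: "norm (B_deriv (normal_map S (g n)) (z n) (z0 - z n) - G) \<le> B * (norm y)\<^sup>2" .
    \<comment> \<open>The coercive map at \<open>y\<close>, expressed by \<open>G\<close>, the
      Taylor remainder at \<open>x0\<close> and the error of the Jacobian.\<close>
    have "L k + y - k = - G - (g n (x n) - g n x0 - J n x0 (x n - x0)) - (J n x0 k - L k)"
      unfolding G by (simp add: xk y_def algebra_simps)
    then have "norm (L k + y - k) \<le> norm G + norm (g n (x n) - g n x0 - J n x0 (x n - x0)) + norm (J n x0 k - L k)"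
      by (metis norm_triangle_ineq4 norm_minus_cancel add_right_mono order_trans)
    also have "\<dots> \<le> norm G + B * (norm y)\<^sup>2 + e n * norm y"
    proof (intro add_mono order_refl)
      have "norm (g n (x n) - g n x0 - J n x0 (x n - x0)) \<le> B * (norm (x n - x0))\<^sup>2"
        by (rule taylor) (use inb in auto)
      also have "\<dots> \<le> B * (norm y)\<^sup>2" using kn B by (simp add: xk power_mono)
      finally show "norm (g n (x n) - g n x0 - J n x0 (x n - x0)) \<le> B * (norm y)\<^sup>2" .
      show "norm (J n x0 k - L k) \<le> e n * norm y"
      proof (cases "e n \<ge> 0")
        case True
        then show ?thesis using e(1)[of n k] kn by (meson mult_left_mono order_trans)
      next
        \<comment> \<open>A negative \<open>e n\<close> forces \<open>y = 0\<close> through the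
          bound at \<open>h = y\<close>.\<close>
        case False
        then have "\<not> norm (J n x0 y - L y) \<le> e n * norm y" if "y \<noteq> 0"
          using that by (smt (verit) mult_neg_pos norm_ge_zero zero_less_norm_iff)
        then have "y = 0" using e(1)[of n y] by auto
        then show ?thesis using e(1)[of n k] kn by simp
      qed
    qed
    also have "\<dots> = norm G + (B * norm y + e n) * norm y" by (simp add: power2_eq_square algebra_simps)
    also have "\<dots> \<le> norm G + c / 2 * norm y"
      using elim(1) by (intro add_left_mono mult_right_mono) (auto simp: y_def)
    finally have "c * norm y \<le> norm G + c / 2 * norm y" using c(2)[of y] by (simp add: k_def)
    then have "norm y \<le> 2 / c * norm G" using c(1) by (simp add: field_simps)
    then have "B * norm y * norm y \<le> B * norm y * (2 / c * norm G)" using B by (intro mult_left_mono) auto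
    with 1 show ?case by (simp add: power2_eq_square y_def G_def mult_ac)
  qed
  then show ?thesis using B(1) c(1) by (intro exI[of _ "2 * B / c"]) auto
qed

section \<open>The strong law of large numbers and weak convergence\<close>

text \<open>The maximum of \<open>0\<close> and the partial sums of \<open>x\<close> with at most
  \<open>n\<close> terms. Recursion through the shifted sequence provides the identity on which
  Garsia's argument rests.\<close>

primrec max_partial_sum :: "nat \<Rightarrow> (nat \<Rightarrow> real) \<Rightarrow> real" where
  "max_partial_sum 0 x = 0"
| "max_partial_sum (Suc n) x = max 0 (x 0 + max_partial_sum n (\<lambda>i. x (Suc i)))"

lemma max_partial_sum_nonneg: "0 \<le> max_partial_sum n x"
  by (cases n) auto

lemma max_partial_sum_mono: "max_partial_sum n x \<le> max_partial_sum (Suc n) x"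
proof (induction n arbitrary: x)
  case 0
  show ?case by simp
next
  case (Suc n)
  have "max_partial_sum (Suc n) x = max 0 (x 0 + max_partial_sum n (\<lambda>i. x (Suc i)))" by simp
  also have "\<dots> \<le> max 0 (x 0 + max_partial_sum (Suc n) (\<lambda>i. x (Suc i)))"
    by (intro max.mono order_refl add_left_mono Suc.IH)
  also have "\<dots> = max_partial_sum (Suc (Suc n)) x" by simp
  finally show ?case .
qed

lemma sum_le_max_partial_sum: "(\<Sum>i<n. x i) \<le> max_partial_sum n x"
proof (induction n arbitrary: x)
  case (Suc n)
  have "(\<Sum>i<Suc n. x i) = x 0 + (\<Sum>i<n. x (Suc i))" by (rule sum.lessThan_Suc_shift)
  also have "\<dots> \<le> x 0 + max_partial_sum n (\<lambda>i. x (Suc i))" by (intro add_left_mono Suc.IH)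
  finally show ?case by simp
qed simp

lemma measurable_max_partial_sum[measurable (raw)]:
  assumes "\<And>i. (\<lambda>\<omega>. X i \<omega>) \<in> borel_measurable M"
  shows "(\<lambda>\<omega>. max_partial_sum n (\<lambda>i. X i \<omega>)) \<in> borel_measurable M"
  using assms by (induction n arbitrary: X) auto

lemma max_partial_sum_le_abs: "max_partial_sum n x \<le> (\<Sum>i<n. \<bar>x i\<bar>)"
proof (induction n arbitrary: x)
  case (Suc n)
  have "max_partial_sum (Suc n) x \<le> \<bar>x 0\<bar> + max_partial_sum n (\<lambda>i. x (Suc i))"
    using max_partial_sum_nonneg[of n "\<lambda>i. x (Suc i)"] by simp
  also have "\<dots> \<le> \<bar>x 0\<bar> + (\<Sum>i<n. \<bar>x (Suc i)\<bar>)" by (intro add_left_mono Suc.IH)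
  also have "\<dots> = (\<Sum>i<Suc n. \<bar>x i\<bar>)" by (rule sum.lessThan_Suc_shift[symmetric])
  finally show ?case .
qed simp

text \<open>Serves the shift of a sequence and the passage from samples indexed by
  \<open>{1..}\<close> to indices starting at 0.\<close>

lemma (in prob_space) indep_vars_reindex_UNIV:
  assumes indep: "indep_vars M' X I" and f: "inj f" "range f \<subseteq> I"
  shows "indep_vars (\<lambda>i. M' (f i)) (\<lambda>i. X (f i)) UNIV"
  unfolding indep_vars_def2
proof (intro conjI ballI)
  let ?F = "\<lambda>i. {X i -` A \<inter> space M | A. A \<in> sets (M' i)}"
  have X: "\<And>i. i \<in> I \<Longrightarrow> random_variable (M' i) (X i)" and F: "indep_sets ?F I"
    using indep unfolding indep_vars_def2 by auto
  show "random_variable (M' (f i)) (X (f i))" for i using f(2) by (intro X) auto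
  show "indep_sets (\<lambda>i. ?F (f i)) UNIV"
  proof (rule indep_setsI)
    have "f i \<in> I" for i using f(2) by auto
    then show "?F (f i) \<subseteq> events" for i using F unfolding indep_sets_def by blast
    fix A J assume J: "J \<noteq> {}" "J \<subseteq> UNIV" "finite J" and A: "\<forall>j\<in>J. A j \<in> ?F (f j)"
    have fI: "f i \<in> I" for i using f(2) by auto
    have "prob (\<Inter>j\<in>f ` J. A (inv f j)) = (\<Prod>j\<in>f ` J. prob (A (inv f j)))"
      by (rule indep_setsD[OF F]) (use J A fI in \<open>auto simp: inv_f_f[OF f(1)]\<close>)
    then show "prob (\<Inter>j\<in>J. A j) = (\<Prod>j\<in>J. prob (A j))"
      by (simp add: inv_f_f[OF f(1)] prod.reindex inj_on_subset[OF f(1)])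
  qed
qed

text \<open>Garsia's argument: on \<open>M\<^sub>n > 0\<close> one has \<open>M\<^sub>n = X\<^sub>0 + M'\<^sub>n\<^sub>-\<^sub>1\<close>, where \<open>M'\<close> is built from
  the shifted sequence and has the same law as \<open>M\<close>.\<close>
lemma (in prob_space) maximal_inequality:
  fixes X :: "nat \<Rightarrow> 'a \<Rightarrow> real"
  assumes indep: "indep_vars (\<lambda>_. borel) X UNIV"
    and ident: "\<And>i. distr M borel (X i) = distr M borel (X 0)"
    and int: "\<And>i. integrable M (X i)"
  shows "0 \<le> expectation (\<lambda>\<omega>. X 0 \<omega> * indicator {\<omega>. 0 < max_partial_sum n (\<lambda>i. X i \<omega>)} \<omega>)"
proof -
  have [measurable]: "X i \<in> borel_measurable M" for i using int by simp
  let ?m = "\<lambda>\<omega>. max_partial_sum n (\<lambda>i. X i \<omega>)" and ?m' = "\<lambda>\<omega>. max_partial_sum n (\<lambda>i. X (Suc i) \<omega>)"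
  have int_m: "integrable M (\<lambda>\<omega>. max_partial_sum n (\<lambda>i. Y i \<omega>))" if Y: "\<And>i. integrable M (Y i)" for Y :: "nat \<Rightarrow> 'a \<Rightarrow> real"
  proof (rule Bochner_Integration.integrable_bound[of _ "\<lambda>\<omega>. \<Sum>i<n. \<bar>Y i \<omega>\<bar>"])
    show "integrable M (\<lambda>\<omega>. \<Sum>i<n. \<bar>Y i \<omega>\<bar>)" using Y by simp
    show "(\<lambda>\<omega>. max_partial_sum n (\<lambda>i. Y i \<omega>)) \<in> borel_measurable M"
      using Y by (intro measurable_max_partial_sum) auto
    show "AE \<omega> in M. norm (max_partial_sum n (\<lambda>i. Y i \<omega>)) \<le> norm (\<Sum>i<n. \<bar>Y i \<omega>\<bar>)"
      by (rule AE_I2) (simp add: max_partial_sum_nonneg max_partial_sum_le_abs sum_nonneg)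
  qed
  let ?P = "\<lambda>Y. distr M (PiM UNIV (\<lambda>_. borel)) (\<lambda>\<omega>. \<lambda>i\<in>UNIV. Y i \<omega>) :: (nat \<Rightarrow> real) measure"
  have indep': "indep_vars (\<lambda>_. borel) (\<lambda>i. X (Suc i)) UNIV"
    by (rule indep_vars_reindex_UNIV[OF indep]) auto
  \<comment> \<open>Independence makes each joint law a product of its marginals, and the marginals
    agree, so the sequence and its shift have the same law.\<close>
  have "?P X = PiM UNIV (\<lambda>i. distr M borel (X i))"
    using indep by (subst (asm) indep_vars_iff_distr_eq_PiM) auto
  also have "\<dots> = PiM UNIV (\<lambda>i. distr M borel (X (Suc i)))"
    by (intro PiM_cong refl) (metis ident)
  also have "\<dots> = ?P (\<lambda>i. X (Suc i))"
    using indep' by (subst (asm) indep_vars_iff_distr_eq_PiM) auto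
  finally have same: "?P X = ?P (\<lambda>i. X (Suc i))" .
  have [measurable]: "max_partial_sum n \<in> borel_measurable (PiM UNIV (\<lambda>_. borel))"
    by (rule measurable_max_partial_sum[of "\<lambda>i x. x i", simplified]) simp
  have restr: "max_partial_sum n (\<lambda>i\<in>UNIV. Y i) = max_partial_sum n Y" for Y by (simp add: restrict_def)
  have "expectation ?m = integral\<^sup>L (?P X) (max_partial_sum n)"
    by (subst integral_distr) (auto simp: restr)
  also have "\<dots> = expectation ?m'"
    unfolding same by (subst integral_distr) (auto simp: restr)
  finally have E_eq: "expectation ?m = expectation ?m'" .
  have le: "?m \<omega> - ?m' \<omega> \<le> X 0 \<omega> * indicator {\<omega>. 0 < ?m \<omega>} \<omega>" for \<omega>
  proof (cases "0 < ?m \<omega>")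
    case True
    then obtain k where k: "n = Suc k" by (cases n) auto
    have "?m \<omega> = X 0 \<omega> + max_partial_sum k (\<lambda>i. X (Suc i) \<omega>)" using True by (simp add: k max_def split: if_splits)
    also have "\<dots> \<le> X 0 \<omega> + ?m' \<omega>" unfolding k by (intro add_left_mono max_partial_sum_mono)
    finally show ?thesis using True by simp
  next
    case False
    then show ?thesis using max_partial_sum_nonneg[of n "\<lambda>i. X (Suc i) \<omega>"] by simp
  qed
  have "0 = expectation (\<lambda>\<omega>. ?m \<omega> - ?m' \<omega>)"
    using E_eq by (simp add: int_m int)
  also have "\<dots> \<le> expectation (\<lambda>\<omega>. X 0 \<omega> * indicator {\<omega>. 0 < ?m \<omega>} \<omega>)"
  proof (rule integral_mono)
    show "integrable M (\<lambda>\<omega>. ?m \<omega> - ?m' \<omega>)" by (intro Bochner_Integration.integrable_diff int_m int)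
    show "integrable M (\<lambda>\<omega>. X 0 \<omega> * indicator {\<omega>. 0 < ?m \<omega>} \<omega>)"
      by (rule Bochner_Integration.integrable_bound[OF int[of 0]]) (auto simp: indicator_def)
  qed (rule le)
  finally show ?thesis .
qed

text \<open>Dropping the first \<open>n\<close> terms changes every later partial sum by the same
  constant, so unboundedness is a tail property.\<close>

lemma bdd_above_partial_sums_shift:
  fixes x :: "nat \<Rightarrow> real"
  shows "bdd_above (range (\<lambda>m. \<Sum>i<m. x (n + i))) \<longleftrightarrow> bdd_above (range (\<lambda>m. \<Sum>i<m. x i))"
proof -
  have split: "(\<Sum>i<n + m. x i) = (\<Sum>i<n. x i) + (\<Sum>i<m. x (n + i))" for m
    by (induction m) auto
  show ?thesis
  proof
    assume "bdd_above (range (\<lambda>m. \<Sum>i<m. x (n + i)))"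
    then obtain K where K: "\<And>m. (\<Sum>i<m. x (n + i)) \<le> K" by (auto simp: bdd_above_def)
    have "(\<Sum>i<m. x i) \<le> max (Max ((\<lambda>m. \<Sum>i<m. x i) ` {..n})) ((\<Sum>i<n. x i) + K)" for m
    proof (cases "m \<le> n")
      case True
      then show ?thesis by (intro max.coboundedI1 Max_ge) auto
    next
      case False
      then have "(\<Sum>i<m. x i) = (\<Sum>i<n. x i) + (\<Sum>i<m - n. x (n + i))" using split[of "m - n"] by simp
      then show ?thesis using K[of "m - n"] by (intro max.coboundedI2) simp
    qed
    then show "bdd_above (range (\<lambda>m. \<Sum>i<m. x i))" unfolding bdd_above_def by blast
  next
    assume "bdd_above (range (\<lambda>m. \<Sum>i<m. x i))"
    then obtain K where K: "\<And>m. (\<Sum>i<m. x i) \<le> K" by (auto simp: bdd_above_def)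
    have "(\<Sum>i<m. x (n + i)) \<le> K - (\<Sum>i<n. x i)" for m
      using K[of "n + m"] split[of m] by simp
    then show "bdd_above (range (\<lambda>m. \<Sum>i<m. x (n + i)))" unfolding bdd_above_def by blast
  qed
qed

text \<open>Unboundedness is a tail event. If it had probability 1, the events in the maximal
  inequality would increase to almost the whole space, and the limit would give a nonnegative
  mean.\<close>

lemma (in prob_space) AE_bdd_above_partial_sums:
  fixes X :: "nat \<Rightarrow> 'a \<Rightarrow> real"
  assumes indep: "indep_vars (\<lambda>_. borel) X UNIV"
    and ident: "\<And>i. distr M borel (X i) = distr M borel (X 0)"
    and int: "\<And>i. integrable M (X i)" and neg: "expectation (X 0) < 0"
  shows "AE \<omega> in M. bdd_above (range (\<lambda>m. \<Sum>i<m. X i \<omega>))"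
proof -
  have [measurable]: "X i \<in> borel_measurable M" for i using int by simp
  define A where "A = {\<omega>\<in>space M. \<not> bdd_above (range (\<lambda>m. \<Sum>i<m. X i \<omega>))}"
  define \<G> where "\<G> i = sigma_sets (space M) {X i -` B \<inter> space M | B. B \<in> sets borel}" for i
  have \<G>: "sigma_algebra (space M) (\<G> i)" for i
    unfolding \<G>_def by (rule sigma_algebra_sigma_sets) auto
  have ind: "indep_sets \<G> UNIV"
    using indep unfolding indep_vars_def \<G>_def by auto
  have "A \<in> sigma_sets (space M) (\<Union>i\<in>{n..}. \<G> i)" for n
  proof -
    let ?N = "sigma (space M) (\<Union>i\<in>{n..}. \<G> i)"
    have sub: "(\<Union>i\<in>{n..}. \<G> i) \<subseteq> Pow (space M)"
      using ind sets.space_closed by (auto simp: indep_sets_def)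
    have [measurable]: "X (n + i) \<in> borel_measurable ?N" for i
    proof (rule measurableI)
      fix B :: "real set" assume B: "B \<in> sets borel"
      have "X (n + i) -` B \<inter> space M \<in> \<G> (n + i)"
        unfolding \<G>_def using B by (intro sigma_sets.Basic) auto
      then show "X (n + i) -` B \<inter> space ?N \<in> sets ?N"
        unfolding space_measure_of[OF sub] sets_measure_of[OF sub] by (intro sigma_sets.Basic) auto
    qed simp
    \<comment> \<open>Natural bounds and sums starting at index \<open>n\<close> describe the event
      by countably many conditions on the variables from \<open>n\<close> on.\<close>
    have "A = {\<omega>\<in>space ?N. \<forall>K::nat. \<exists>m. real K < (\<Sum>i<m. X (n + i) \<omega>)}"
    proof -
      have "\<not> bdd_above (range (\<lambda>m. \<Sum>i<m. X i \<omega>)) \<longleftrightarrow> (\<forall>K::nat. \<exists>m. real K < (\<Sum>i<m. X (n + i) \<omega>))" for \<omega>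
      proof -
        have "bdd_above (range (\<lambda>m. \<Sum>i<m. X i \<omega>)) \<longleftrightarrow> (\<exists>K. \<forall>m. (\<Sum>i<m. X (n + i) \<omega>) \<le> K)"
          using bdd_above_partial_sums_shift[of "\<lambda>i. X i \<omega>" n] by (auto simp: bdd_above_def)
        also have "\<dots> \<longleftrightarrow> (\<exists>K::nat. \<forall>m. (\<Sum>i<m. X (n + i) \<omega>) \<le> real K)"
        proof
          assume "\<exists>K. \<forall>m. (\<Sum>i<m. X (n + i) \<omega>) \<le> K"
          then obtain K where K: "\<forall>m. (\<Sum>i<m. X (n + i) \<omega>) \<le> K" ..
          obtain k :: nat where k: "K \<le> real k" using real_arch_simple by blast
          have "(\<Sum>i<m. X (n + i) \<omega>) \<le> real k" for m using order_trans[OF K[rule_format] k] .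
          then show "\<exists>K::nat. \<forall>m. (\<Sum>i<m. X (n + i) \<omega>) \<le> real K" by (intro exI[of _ k] allI)
        next
          assume "\<exists>K::nat. \<forall>m. (\<Sum>i<m. X (n + i) \<omega>) \<le> real K"
          then obtain k :: nat where "\<forall>m. (\<Sum>i<m. X (n + i) \<omega>) \<le> real k" ..
          then show "\<exists>K. \<forall>m. (\<Sum>i<m. X (n + i) \<omega>) \<le> K" by (rule exI[of _ "real k"])
        qed
        finally show ?thesis by (simp add: not_le)
      qed
      then show ?thesis unfolding A_def space_measure_of[OF sub] by simp
    qed
    also have "\<dots> \<in> sets ?N" by measurable
    finally show ?thesis unfolding sets_measure_of[OF sub] .
  qed
  then have "A \<in> tail_events \<G>" by (auto simp: tail_events_def)
  then have "prob A = 0 \<or> prob A = 1" by (rule kolmogorov_0_1_law[OF \<G> ind])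
  moreover have A_ev: "A \<in> events"
  proof -
    have "\<G> i \<subseteq> events" for i
      using ind by (auto simp: indep_sets_def)
    then show ?thesis using tail_events_sets \<open>A \<in> tail_events \<G>\<close> by blast
  qed
  moreover have "prob A \<noteq> 1"
  proof
    assume "prob A = 1"
    then have A1: "AE \<omega> in M. \<omega> \<in> A" using A_ev prob_eq_1 by blast
    let ?m = "\<lambda>n \<omega>. max_partial_sum n (\<lambda>i. X i \<omega>)"
    let ?f = "\<lambda>n \<omega>. X 0 \<omega> * indicator {\<omega>. 0 < ?m n \<omega>} \<omega>"
    have "(\<lambda>n. expectation (?f n)) \<longlonglongrightarrow> expectation (X 0)"
    proof (rule integral_dominated_convergence[where w = "\<lambda>\<omega>. \<bar>X 0 \<omega>\<bar>"])
      show "integrable M (\<lambda>\<omega>. \<bar>X 0 \<omega>\<bar>)" using int by simp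
      show "AE \<omega> in M. (\<lambda>n. ?f n \<omega>) \<longlonglongrightarrow> X 0 \<omega>"
        using A1
      proof eventually_elim
        case (elim \<omega>)
        then have "\<not> (\<forall>m. (\<Sum>i<m. X i \<omega>) \<le> 0)" by (auto simp: A_def bdd_above_def)
        then obtain m where m: "0 < (\<Sum>i<m. X i \<omega>)" by (auto simp: not_le)
        then have "0 < ?m m \<omega>" using sum_le_max_partial_sum[of "\<lambda>i. X i \<omega>" m] by linarith
        moreover have "incseq (\<lambda>n. ?m n \<omega>)"
          by (rule incseq_SucI) (rule max_partial_sum_mono)
        ultimately have "?f n \<omega> = X 0 \<omega>" if "n \<ge> m" for n
          using that incseqD[of "\<lambda>n. ?m n \<omega>" m n] by simp
        then have "\<forall>\<^sub>F n in sequentially. ?f n \<omega> = X 0 \<omega>" by (auto simp: eventually_sequentially)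
        then show ?case by (rule tendsto_eventually)
      qed
    qed (auto simp: indicator_def)
    then have "0 \<le> expectation (X 0)"
      by (rule tendsto_lowerbound) (auto intro!: always_eventually maximal_inequality indep ident int)
    then show False using neg by simp
  qed
  ultimately have "prob A = 0" by blast
  then have "AE \<omega> in M. \<omega> \<notin> A"
    using A_ev by (simp add: AE_iff_measurable[OF _ refl] emeasure_eq_measure A_def)
  with AE_space show ?thesis by eventually_elim (simp add: A_def)
qed

text \<open>Subtracting a constant slightly above the mean makes the mean negative, so the sums stay
  bounded above and the averages have limit superior at most that constant; the choices
  \<open>1 / real (Suc k)\<close> keep the exceptional sets countable in number.\<close>

lemma (in prob_space) strong_law_of_large_numbers_upper:
  fixes X :: "nat \<Rightarrow> 'a \<Rightarrow> real"
  assumes indep: "indep_vars (\<lambda>_. borel) X UNIV"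
    and ident: "\<And>i. distr M borel (X i) = distr M borel (X 0)"
    and int: "integrable M (X 0)"
  shows "AE \<omega> in M. \<forall>e>0. \<forall>\<^sub>F n in sequentially. (\<Sum>i<n. X i \<omega>) / real n < expectation (X 0) + e"
proof -
  have rv[measurable]: "X i \<in> borel_measurable M" for i using indep by (simp add: indep_vars_def)
  have int_i: "integrable M (X i)" for i
  proof -
    have "integrable (distr M borel (X i)) (\<lambda>x. x)"
      unfolding ident[of i] using int by (simp add: integrable_distr_eq)
    then show ?thesis by (simp add: integrable_distr_eq)
  qed
  define c where "c k = expectation (X 0) + 1 / real (Suc k)" for k
  have "AE \<omega> in M. bdd_above (range (\<lambda>m. \<Sum>i<m. X i \<omega> - c k))" for k
  proof (rule AE_bdd_above_partial_sums)
    show "indep_vars (\<lambda>_. borel) (\<lambda>i \<omega>. X i \<omega> - c k) UNIV"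
      by (rule indep_vars_compose2[OF indep]) auto
    have "distr M borel (\<lambda>\<omega>. X i \<omega> - c k) = distr (distr M borel (X i)) borel (\<lambda>x. x - c k)" for i
      by (subst distr_distr) (auto simp: comp_def)
    then show "distr M borel (\<lambda>\<omega>. X i \<omega> - c k) = distr M borel (\<lambda>\<omega>. X 0 \<omega> - c k)" for i
      using ident[of i] by simp
    show "integrable M (\<lambda>\<omega>. X i \<omega> - c k)" for i using int_i by simp
    show "expectation (\<lambda>\<omega>. X 0 \<omega> - c k) < 0" using int by (simp add: prob_space c_def)
  qed
  then have "AE \<omega> in M. \<forall>k. bdd_above (range (\<lambda>m. \<Sum>i<m. X i \<omega> - c k))"
    by (simp add: AE_all_countable)
  then show ?thesis
  proof eventually_elim
    case (elim \<omega>)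
    show ?case
    proof safe
      fix e :: real assume "e > 0"
      then obtain k where k: "1 / real (Suc k) < e / 2" using nat_approx_posE[of "e / 2"] by auto
      obtain K where K: "\<And>m. (\<Sum>i<m. X i \<omega> - c k) \<le> K" using elim by (auto simp: bdd_above_def)
      have "(\<lambda>n. K / real n) \<longlonglongrightarrow> 0" by (rule lim_const_over_n)
      then have "\<forall>\<^sub>F n in sequentially. K / real n < e / 2"
        by (rule order_tendstoD) (use \<open>e > 0\<close> in simp)
      then show "\<forall>\<^sub>F n in sequentially. (\<Sum>i<n. X i \<omega>) / real n < expectation (X 0) + e"
        using eventually_gt_at_top[of 0]
      proof eventually_elim
        case (elim n)
        have "(\<Sum>i<n. X i \<omega>) \<le> K + real n * c k" using K[of n] by (simp add: sum_subtractf)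
        then have "(\<Sum>i<n. X i \<omega>) / real n \<le> K / real n + c k"
          using elim(2) by (simp add: field_simps)
        then show ?case using elim(1) k unfolding c_def by linarith
      qed
    qed
  qed
qed

text \<open>The one-sided bound for \<open>X\<close> and for \<open>- X\<close>. A first moment is
  all that is available for products of components of \<open>F\<close> and for the squared
  modulus.\<close>

theorem (in prob_space) strong_law_of_large_numbers:
  fixes X :: "nat \<Rightarrow> 'a \<Rightarrow> real"
  assumes indep: "indep_vars (\<lambda>_. borel) X UNIV"
    and ident: "\<And>i. distr M borel (X i) = distr M borel (X 0)"
    and int: "integrable M (X 0)"
  shows "AE \<omega> in M. (\<lambda>n. (\<Sum>i<n. X i \<omega>) / real n) \<longlonglongrightarrow> expectation (X 0)"
proof -
  have rv[measurable]: "X i \<in> borel_measurable M" for i using indep by (simp add: indep_vars_def)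
  have "AE \<omega> in M. \<forall>e>0. \<forall>\<^sub>F n in sequentially. (\<Sum>i<n. - X i \<omega>) / real n < expectation (\<lambda>\<omega>. - X 0 \<omega>) + e"
  proof (rule strong_law_of_large_numbers_upper)
    show "indep_vars (\<lambda>_. borel) (\<lambda>i \<omega>. - X i \<omega>) UNIV"
      by (rule indep_vars_compose2[OF indep]) auto
    have "distr M borel (\<lambda>\<omega>. - X i \<omega>) = distr (distr M borel (X i)) borel uminus" for i
      by (subst distr_distr) (auto simp: comp_def)
    then show "distr M borel (\<lambda>\<omega>. - X i \<omega>) = distr M borel (\<lambda>\<omega>. - X 0 \<omega>)" for i
      using ident[of i] by simp
  qed (use int in simp)
  moreover note strong_law_of_large_numbers_upper[OF indep ident int]
  ultimately show ?thesis
  proof eventually_elim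
    case (elim \<omega>)
    show ?case
    proof (rule tendstoI)
      fix e :: real assume e: "e > 0"
      show "\<forall>\<^sub>F n in sequentially. dist ((\<Sum>i<n. X i \<omega>) / real n) (expectation (X 0)) < e"
        using elim(1)[rule_format, OF e] elim(2)[rule_format, OF e]
        by eventually_elim (auto simp: dist_real_def sum_negf abs_less_iff)
    qed
  qed
qed

lemma isCont_cts_step:
  assumes "a < b"
  shows "isCont (cts_step a b) x"
  using continuous_on_interior[OF uniformly_continuous_imp_continuous[OF cts_step_uniformly_continuous[OF assms]]]
  by simp

lemma cts_step_bounds:
  assumes "a < b"
  shows "0 \<le> cts_step a b x" "cts_step a b x \<le> 1"
  using assms by (auto simp: cts_step_def divide_simps)

lemma cts_step_measurable: "a < b \<Longrightarrow> cts_step a b \<in> borel_measurable borel"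
  by (intro borel_measurable_continuous_onI continuous_at_imp_continuous_on ballI isCont_cts_step)

lemma cts_step_lipschitz:
  assumes "a < b"
  shows "\<bar>cts_step a b x - cts_step a b y\<bar> \<le> \<bar>x - y\<bar> / (b - a)"
proof -
  have c: "cts_step a b u = max 0 (min 1 ((b - u) / (b - a)))" for u
    using assms by (auto simp: cts_step_def max_def min_def divide_simps)
  have "\<bar>max 0 (min 1 u) - max 0 (min 1 v)\<bar> \<le> \<bar>u - v\<bar>" for u v :: real by (auto simp: max_def min_def)
  then have "\<bar>cts_step a b x - cts_step a b y\<bar> \<le> \<bar>(b - x) / (b - a) - (b - y) / (b - a)\<bar>"
    unfolding c by blast
  also have "\<dots> = \<bar>x - y\<bar> / (b - a)"
    using assms by (simp add: abs_divide flip: diff_divide_distrib)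
  finally show ?thesis .
qed

text \<open>For nonnegative \<open>x\<close>, a test function \<open>cts_step a b\<close> is a
  continuous function of \<open>u = exp (- x)\<close> in \<open>{0..1}\<close>. Polynomials
  approximate it uniformly, and the integral of a polynomial in \<open>exp (- x)\<close> is a
  combination of Laplace transforms at natural numbers.\<close>

lemma weak_conv_m_laplaceI:
  fixes \<mu> :: "nat \<Rightarrow> real measure" and \<nu> :: "real measure"
  assumes \<mu>: "\<And>n. real_distribution (\<mu> n)" "\<And>n. AE x in \<mu> n. 0 \<le> x"
    and \<nu>: "real_distribution \<nu>" "AE x in \<nu>. 0 \<le> x"
    and conv: "\<And>k::nat. (\<lambda>n. LINT x|\<mu> n. exp (- real k * x)) \<longlonglongrightarrow> (LINT x|\<nu>. exp (- real k * x))"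
  shows "weak_conv_m \<mu> \<nu>"
proof (rule integral_cts_step_conv_imp_weak_conv[OF \<mu>(1) \<nu>(1)])
  fix a b :: real assume ab: "a < b"
  \<comment> \<open>This is \<open>x = - ln u\<close> truncated at \<open>b\<close>: beyond
    \<open>b\<close> the step is 0, so the truncation is harmless, and it keeps \<open>h\<close>
    continuous at \<open>u = 0\<close>.\<close>
  define h where "h u = cts_step a b (- ln (max u (exp (- b))))" for u
  have cont_h: "continuous_on {0..1} h"
  proof (rule continuous_at_imp_continuous_on, rule)
    fix u :: real
    have "isCont (\<lambda>u. - ln (max u (exp (- b)))) u"
      by (intro continuous_intros) (auto simp: max_def)
    then show "isCont h u"
      unfolding h_def by (rule isCont_o2[OF _ isCont_cts_step[OF ab]])
  qed
  have h_exp: "h (exp (- x)) = cts_step a b x" for x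
  proof (cases "x \<le> b")
    case True
    then show ?thesis by (simp add: h_def max_def)
  next
    case False
    then have "h (exp (- x)) = cts_step a b b" by (simp add: h_def max_def)
    then show ?thesis using False ab by (simp add: cts_step_def)
  qed
  show "(\<lambda>n. integral\<^sup>L (\<mu> n) (cts_step a b)) \<longlonglongrightarrow> integral\<^sup>L \<nu> (cts_step a b)"
  proof (rule tendstoI)
    fix e :: real assume e: "e > 0"
    obtain g where g: "real_polynomial_function g" "\<And>u. u \<in> {0..1} \<Longrightarrow> \<bar>h u - g u\<bar> < e / 3"
      using Stone_Weierstrass_real_polynomial_function[OF compact_Icc cont_h, of "e / 3"] e by auto
    obtain c N where c: "g = (\<lambda>u. \<Sum>i\<le>N. c i * u ^ i)"
      using g(1) unfolding real_polynomial_function_iff_sum by auto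
    have approx: "integrable \<kappa> (\<lambda>x. g (exp (- x)))"
      "(LINT x|\<kappa>. g (exp (- x))) = (\<Sum>i\<le>N. c i * (LINT x|\<kappa>. exp (- real i * x)))"
      "\<bar>integral\<^sup>L \<kappa> (cts_step a b) - (LINT x|\<kappa>. g (exp (- x)))\<bar> \<le> e / 3"
      if \<kappa>: "real_distribution \<kappa>" "AE x in \<kappa>. 0 \<le> x" for \<kappa>
    proof -
      interpret real_distribution \<kappa> by fact
      have ie: "integrable \<kappa> (\<lambda>x. exp (- real i * x))" for i
      proof (rule integrable_const_bound[where B = 1])
        show "AE x in \<kappa>. norm (exp (- real i * x)) \<le> 1"
          using \<kappa>(2) by eventually_elim simp
      qed simp
      have geq: "g (exp (- x)) = (\<Sum>i\<le>N. c i * exp (- real i * x))" for x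
        unfolding c by (intro sum.cong refl) (simp add: exp_of_nat_mult[symmetric])
      show ig: "integrable \<kappa> (\<lambda>x. g (exp (- x)))" unfolding geq using ie by simp
      show "(LINT x|\<kappa>. g (exp (- x))) = (\<Sum>i\<le>N. c i * (LINT x|\<kappa>. exp (- real i * x)))"
        unfolding geq using ie by simp
      have ic: "integrable \<kappa> (cts_step a b)" by (rule integrable_cts_step[OF ab])
      have "\<bar>integral\<^sup>L \<kappa> (cts_step a b) - (LINT x|\<kappa>. g (exp (- x)))\<bar>
          = \<bar>LINT x|\<kappa>. cts_step a b x - g (exp (- x))\<bar>"
        using ic ig by simp
      also have "\<dots> \<le> (LINT x|\<kappa>. \<bar>cts_step a b x - g (exp (- x))\<bar>)"
        by (rule integral_abs_bound)
      also have "\<dots> \<le> (LINT x|\<kappa>. e / 3)"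
      proof (rule integral_mono_AE)
        show "integrable \<kappa> (\<lambda>x. \<bar>cts_step a b x - g (exp (- x))\<bar>)"
          using ic ig by (intro integrable_abs Bochner_Integration.integrable_diff)
        show "AE x in \<kappa>. \<bar>cts_step a b x - g (exp (- x))\<bar> \<le> e / 3"
          using \<kappa>(2)
        proof eventually_elim
          case (elim x)
          then show ?case using g(2)[of "exp (- x)"] by (simp add: h_exp)
        qed
      qed simp
      also have "\<dots> = e / 3" using prob_space by simp
      finally show "\<bar>integral\<^sup>L \<kappa> (cts_step a b) - (LINT x|\<kappa>. g (exp (- x)))\<bar> \<le> e / 3" .
    qed
    have "(\<lambda>n. LINT x|\<mu> n. g (exp (- x))) \<longlonglongrightarrow> (LINT x|\<nu>. g (exp (- x)))"
      unfolding approx(2)[OF \<mu>] approx(2)[OF \<nu>] by (intro tendsto_intros conv)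
    then have "\<forall>\<^sub>F n in sequentially. dist (LINT x|\<mu> n. g (exp (- x))) (LINT x|\<nu>. g (exp (- x))) < e / 3"
      by (rule tendstoD) (use e in simp)
    then show "\<forall>\<^sub>F n in sequentially. dist (integral\<^sup>L (\<mu> n) (cts_step a b)) (integral\<^sup>L \<nu> (cts_step a b)) < e"
    proof eventually_elim
      case (elim n)
      then show ?case using approx(3)[OF \<mu>, of n] approx(3)[OF \<nu>] unfolding dist_real_def by linarith
    qed
  qed
qed

text \<open>Slutsky's argument: off an event of small probability the Lipschitz test function
  changes little, and on it by at most 1.\<close>

lemma (in prob_space) weak_conv_m_perturb:
  fixes X Y :: "nat \<Rightarrow> 'a \<Rightarrow> real"
  assumes [measurable]: "\<And>n. X n \<in> borel_measurable M" "\<And>n. Y n \<in> borel_measurable M"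
    and \<nu>: "real_distribution \<nu>"
    and diff: "\<And>\<delta>. \<delta> > 0 \<Longrightarrow> (\<lambda>n. prob {\<omega>\<in>space M. \<delta> < \<bar>X n \<omega> - Y n \<omega>\<bar>}) \<longlonglongrightarrow> 0"
    and conv: "weak_conv_m (\<lambda>n. distr M borel (Y n)) \<nu>"
  shows "weak_conv_m (\<lambda>n. distr M borel (X n)) \<nu>"
proof (rule integral_cts_step_conv_imp_weak_conv[OF real_distribution_distr \<nu>])
  fix a b :: real assume ab: "a < b"
  note [measurable] = cts_step_measurable[OF ab]
  let ?h = "cts_step a b"
  have eq: "integral\<^sup>L (distr M borel (Z n)) ?h = expectation (\<lambda>\<omega>. ?h (Z n \<omega>))"
    if [measurable]: "\<And>n. Z n \<in> borel_measurable M" for Z :: "nat \<Rightarrow> 'a \<Rightarrow> real" and n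
    by (rule integral_distr) auto
  have int: "integrable M (\<lambda>\<omega>. ?h (Z \<omega>))" if [measurable]: "Z \<in> borel_measurable M" for Z
    using cts_step_bounds[OF ab] by (intro integrable_const_bound[where B = 1]) auto
  have "(\<lambda>n. expectation (\<lambda>\<omega>. ?h (X n \<omega>)) - expectation (\<lambda>\<omega>. ?h (Y n \<omega>))) \<longlonglongrightarrow> 0"
  proof (rule tendstoI)
    fix e :: real assume e: "e > 0"
    \<comment> \<open>The test function has Lipschitz constant \<open>1 / (b - a)\<close>, so a
      deviation up to \<delta> costs at most \<open>e / 2\<close>.\<close>
    define \<delta> where "\<delta> = e / 2 * (b - a)"
    have \<delta>: "\<delta> > 0" using e ab by (simp add: \<delta>_def)
    have "\<forall>\<^sub>F n in sequentially. prob {\<omega>\<in>space M. \<delta> < \<bar>X n \<omega> - Y n \<omega>\<bar>} < e / 2"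
      by (rule order_tendstoD[OF diff[OF \<delta>]]) (use e in simp)
    then show "\<forall>\<^sub>F n in sequentially. dist (expectation (\<lambda>\<omega>. ?h (X n \<omega>)) - expectation (\<lambda>\<omega>. ?h (Y n \<omega>))) 0 < e"
    proof eventually_elim
      case (elim n)
      let ?B = "{\<omega>\<in>space M. \<delta> < \<bar>X n \<omega> - Y n \<omega>\<bar>}"
      have "\<bar>expectation (\<lambda>\<omega>. ?h (X n \<omega>)) - expectation (\<lambda>\<omega>. ?h (Y n \<omega>))\<bar>
          = \<bar>expectation (\<lambda>\<omega>. ?h (X n \<omega>) - ?h (Y n \<omega>))\<bar>"
        by (simp add: int)
      also have "\<dots> \<le> expectation (\<lambda>\<omega>. \<bar>?h (X n \<omega>) - ?h (Y n \<omega>)\<bar>)" by (rule integral_abs_bound)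
      also have "\<dots> \<le> expectation (\<lambda>\<omega>. e / 2 + indicator ?B \<omega>)"
      proof (rule integral_mono)
        show "integrable M (\<lambda>\<omega>. \<bar>?h (X n \<omega>) - ?h (Y n \<omega>)\<bar>)" by (simp add: int)
        show "integrable M (\<lambda>\<omega>. e / 2 + indicator ?B \<omega>)"
          by (intro Bochner_Integration.integrable_add integrable_const integrable_real_indicator)
            (auto simp: less_top[symmetric])
        fix \<omega> assume "\<omega> \<in> space M"
        show "\<bar>?h (X n \<omega>) - ?h (Y n \<omega>)\<bar> \<le> e / 2 + indicator ?B \<omega>"
        proof (cases "\<omega> \<in> ?B")
          case True
          then show ?thesis
            using cts_step_bounds[OF ab, of "X n \<omega>"] cts_step_bounds[OF ab, of "Y n \<omega>"] e by simp
        next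
          case False
          then have "\<bar>X n \<omega> - Y n \<omega>\<bar> / (b - a) \<le> \<delta> / (b - a)"
            using \<open>\<omega> \<in> space M\<close> ab by (intro divide_right_mono) auto
          also have "\<dots> = e / 2" unfolding \<delta>_def using ab by (intro nonzero_mult_div_cancel_right) simp
          finally have "\<bar>?h (X n \<omega>) - ?h (Y n \<omega>)\<bar> \<le> e / 2"
            using cts_step_lipschitz[OF ab, of "X n \<omega>" "Y n \<omega>"] by linarith
          then show ?thesis using False by simp
        qed
      qed
      also have "\<dots> = e / 2 + prob ?B"
        by (subst Bochner_Integration.integral_add) (auto simp: prob_space less_top[symmetric] intro!: integrable_real_indicator)
      finally show ?case using elim by (simp add: dist_real_def)
    qed
  qed
  moreover have "(\<lambda>n. expectation (\<lambda>\<omega>. ?h (Y n \<omega>))) \<longlonglongrightarrow> integral\<^sup>L \<nu> ?h"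
  proof -
    have "(\<lambda>n. integral\<^sup>L (distr M borel (Y n)) ?h) \<longlonglongrightarrow> integral\<^sup>L \<nu> ?h"
    proof (rule weak_conv_imp_integral_bdd_continuous_conv[OF real_distribution_distr \<nu> conv])
      show "norm (?h x) \<le> 1" for x using cts_step_bounds[OF ab, of x] by simp
    qed (auto intro: isCont_cts_step[OF ab])
    then show ?thesis by (simp add: eq)
  qed
  ultimately have "(\<lambda>n. expectation (\<lambda>\<omega>. ?h (X n \<omega>))) \<longlonglongrightarrow> integral\<^sup>L \<nu> ?h"
    by (rule Lim_transform[rotated])
  then show "(\<lambda>n. integral\<^sup>L (distr M borel (X n)) ?h) \<longlonglongrightarrow> integral\<^sup>L \<nu> ?h"
    by (simp add: eq)
qed auto

lemma (in prob_space) AE_tendsto_0_imp_prob: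
  fixes X :: "nat \<Rightarrow> 'a \<Rightarrow> real"
  assumes [measurable]: "\<And>n. X n \<in> borel_measurable M"
    and lim: "AE \<omega> in M. (\<lambda>n. X n \<omega>) \<longlonglongrightarrow> 0" and \<delta>: "\<delta> > 0"
  shows "(\<lambda>n. prob {\<omega>\<in>space M. \<delta> < \<bar>X n \<omega>\<bar>}) \<longlonglongrightarrow> 0"
proof -
  let ?B = "\<lambda>n. {\<omega>\<in>space M. \<delta> < \<bar>X n \<omega>\<bar>}"
  have "(\<lambda>n. expectation (indicator (?B n) :: _ \<Rightarrow> real)) \<longlonglongrightarrow> expectation (\<lambda>_. 0)"
  proof (rule integral_dominated_convergence[where w = "\<lambda>_. 1"])
    show "AE \<omega> in M. (\<lambda>n. indicator (?B n) \<omega> :: real) \<longlonglongrightarrow> 0"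
      using lim
    proof eventually_elim
      case (elim \<omega>)
      have "\<forall>\<^sub>F n in sequentially. norm (X n \<omega>) < \<delta>"
        using order_tendstoD(2)[OF tendsto_norm_zero[OF elim] \<delta>] .
      then have "\<forall>\<^sub>F n in sequentially. indicator (?B n) \<omega> = (0::real)"
        by eventually_elim (simp add: indicator_def)
      then show ?case by (rule tendsto_eventually)
    qed
  qed (auto simp: indicator_def)
  then show ?thesis by simp
qed

text \<open>\<open>X n\<close> itself need not tend to 0 almost surely. The factor
  \<open>1 + V n\<close> is bounded in mean, so Markov's inequality keeps it below a large constant
  with high probability, where smallness of the ratio passes to \<open>X n\<close>.\<close>

lemma (in prob_space) AE_tendsto_0_ratio_imp_prob:
  fixes X V :: "nat \<Rightarrow> 'a \<Rightarrow> real"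
  assumes [measurable]: "\<And>n. X n \<in> borel_measurable M"
    and V: "\<And>n. integrable M (V n)" "\<And>n \<omega>. 0 \<le> V n \<omega>" "\<And>n. expectation (V n) \<le> v"
    and lim: "AE \<omega> in M. (\<lambda>n. X n \<omega> / (1 + V n \<omega>)) \<longlonglongrightarrow> 0" and \<delta>: "\<delta> > 0"
  shows "(\<lambda>n. prob {\<omega>\<in>space M. \<delta> < \<bar>X n \<omega>\<bar>}) \<longlonglongrightarrow> 0"
proof (rule LIMSEQ_I)
  fix e :: real assume e: "e > 0"
  have [measurable]: "V n \<in> borel_measurable M" for n using V(1) by simp
  have v: "0 \<le> v" using V(3)[of 0] Bochner_Integration.integral_nonneg[of M "V 0"] V(2) by fastforce
  \<comment> \<open>Chosen so that Markov's bound for the event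
    \<open>1 + V n \<ge> 1 / \<eta>\<close> is \<open>e / 2\<close>.\<close>
  define \<eta> where "\<eta> = e / (2 * (1 + v))"
  have \<eta>: "\<eta> > 0" "\<eta> * (1 + v) = e / 2" using e v by (auto simp: \<eta>_def field_simps)
  have "(\<lambda>n. prob {\<omega>\<in>space M. \<delta> * \<eta> < \<bar>X n \<omega> / (1 + V n \<omega>)\<bar>}) \<longlonglongrightarrow> 0"
    by (rule AE_tendsto_0_imp_prob[OF _ lim]) (use \<delta> \<eta> in auto)
  then have "\<forall>\<^sub>F n in sequentially. prob {\<omega>\<in>space M. \<delta> * \<eta> < \<bar>X n \<omega> / (1 + V n \<omega>)\<bar>} < e / 2"
    by (rule order_tendstoD) (use e in simp)
  then have "\<forall>\<^sub>F n in sequentially. prob {\<omega>\<in>space M. \<delta> < \<bar>X n \<omega>\<bar>} < e"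
  proof eventually_elim
    case (elim n)
    let ?A = "{\<omega>\<in>space M. \<delta> * \<eta> < \<bar>X n \<omega> / (1 + V n \<omega>)\<bar>}" and ?B = "{\<omega>\<in>space M. 1 + V n \<omega> \<ge> 1 / \<eta>}"
    have sub: "{\<omega>\<in>space M. \<delta> < \<bar>X n \<omega>\<bar>} \<subseteq> ?A \<union> ?B"
    proof
      fix \<omega> assume w: "\<omega> \<in> {\<omega>\<in>space M. \<delta> < \<bar>X n \<omega>\<bar>}"
      show "\<omega> \<in> ?A \<union> ?B"
      proof (cases "1 + V n \<omega> \<ge> 1 / \<eta>")
        case False
        have p: "0 < 1 + V n \<omega>" using V(2)[of n \<omega>] by linarith
        have "(1 + V n \<omega>) * \<eta> < 1" using False \<eta>(1) by (simp add: not_le pos_less_divide_eq)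
        then have "\<delta> * ((1 + V n \<omega>) * \<eta>) < \<delta> * 1" using \<delta> by (intro mult_strict_left_mono) auto
        then have "\<delta> * \<eta> * (1 + V n \<omega>) < \<bar>X n \<omega>\<bar>" using w by (simp add: mult_ac)
        then have "\<delta> * \<eta> < \<bar>X n \<omega>\<bar> / (1 + V n \<omega>)" using p by (simp add: pos_less_divide_eq)
        then show ?thesis using w p by (simp add: abs_divide)
      qed (use w in simp)
    qed
    have "prob {\<omega>\<in>space M. \<delta> < \<bar>X n \<omega>\<bar>} \<le> prob (?A \<union> ?B)"
      by (rule finite_measure_mono[OF sub]) measurable
    also have "\<dots> \<le> prob ?A + prob ?B" by (rule measure_Un_le) auto
    also have "prob ?B \<le> expectation (\<lambda>\<omega>. 1 + V n \<omega>) / (1 / \<eta>)"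
    proof (rule integral_Markov_inequality_measure[where A = "space M"])
      show "integrable M (\<lambda>\<omega>. 1 + V n \<omega>)" using V(1) by simp
      show "AE \<omega> in M. 0 \<le> 1 + V n \<omega>" using V(2)[of n] by (intro AE_I2) (simp add: add_nonneg_nonneg)
    qed (use \<eta>(1) in auto)
    also have "expectation (\<lambda>\<omega>. 1 + V n \<omega>) = 1 + expectation (V n)"
      using V(1) by (simp add: prob_space)
    also have "(1 + expectation (V n)) / (1 / \<eta>) = \<eta> * (1 + expectation (V n))" by simp
    also have "\<dots> \<le> \<eta> * (1 + v)" using V(3)[of n] \<eta>(1) by (intro mult_left_mono) auto
    also have "\<dots> = e / 2" by (rule \<eta>(2))
    finally show ?case using elim by simp
  qed
  then show "\<exists>n0. \<forall>n\<ge>n0. norm (prob {\<omega>\<in>space M. \<delta> < \<bar>X n \<omega>\<bar>} - 0) < e"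
    by (simp add: eventually_sequentially)
qed

section \<open>Sums of squares and the chi-square distribution\<close>

lemma real_distribution_chi_square: "real_distribution (chi_square k)"
proof -
  interpret N: real_distribution std_normal_distribution by (rule real_dist_normal_dist)
  interpret P: prob_space "\<Pi>\<^sub>M i\<in>{..<k}. std_normal_distribution"
    by (rule prob_space_PiM) (rule N.prob_space_axioms)
  show ?thesis unfolding chi_square_def by (rule P.real_distribution_distr) measurable
qed

lemma AE_chi_square_nonneg: "AE x in chi_square k. 0 \<le> x"
  unfolding chi_square_def by (subst AE_distr_iff) (auto simp: sum_nonneg)

text \<open>With the other coordinates fixed, the last one is confined to at most two points, a null
  set for the normal law; for \<open>k = 0\<close> the law is a point mass. Hence the limiting
  distribution function is continuous at the critical value.\<close>

lemma measure_chi_square_singleton: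
  assumes "1 \<le> k"
  shows "measure (chi_square k) {c} = 0"
proof -
  interpret N: real_distribution std_normal_distribution by (rule real_dist_normal_dist)
  interpret P: product_sigma_finite "\<lambda>_::nat. std_normal_distribution"
    unfolding product_sigma_finite_def by (intro allI N.sigma_finite_measure_axioms)
  obtain m where k: "k = Suc m" using assms by (cases k) auto
  have atom: "AE x in std_normal_distribution. x\<^sup>2 \<noteq> d" for d :: real
  proof -
    have "AE x in lborel. x \<noteq> sqrt d \<and> x \<noteq> - sqrt d"
      using AE_lborel_singleton[of "sqrt d"] AE_lborel_singleton[of "- sqrt d"] by eventually_elim simp
    then have "AE x in lborel. x\<^sup>2 \<noteq> d"
    proof eventually_elim
      case (elim x)
      then show ?case by (metis abs_if minus_minus real_sqrt_abs)
    qed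
    then show ?thesis by (subst AE_density) auto
  qed
  have ins: "{..<k} = insert m {..<m}" by (auto simp: k)
  let ?A = "\<lambda>x :: nat \<Rightarrow> real. indicator {c} (\<Sum>i<k. (x i)\<^sup>2) :: ennreal"
  have "emeasure (chi_square k) {c} = (\<integral>\<^sup>+y. indicator {c} y \<partial>chi_square k)"
    by (subst nn_integral_indicator) (auto simp: chi_square_def)
  also have "\<dots> = (\<integral>\<^sup>+x. ?A x \<partial>(\<Pi>\<^sub>M i\<in>{..<k}. std_normal_distribution))"
    unfolding chi_square_def by (subst nn_integral_distr) auto
  also have "\<dots> = (\<integral>\<^sup>+x. ?A x \<partial>(\<Pi>\<^sub>M i\<in>insert m {..<m}. std_normal_distribution))"
    by (simp only: ins)
  also have "\<dots> = (\<integral>\<^sup>+x. (\<integral>\<^sup>+y. ?A (x(m := y)) \<partial>std_normal_distribution) \<partial>(\<Pi>\<^sub>M i\<in>{..<m}. std_normal_distribution))"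
  proof (rule P.product_nn_integral_insert)
    have "?A \<in> borel_measurable (\<Pi>\<^sub>M i\<in>{..<k}. std_normal_distribution)" by measurable
    then show "?A \<in> borel_measurable (\<Pi>\<^sub>M i\<in>insert m {..<m}. std_normal_distribution)" by (simp only: ins)
  qed auto
  also have "\<dots> = (\<integral>\<^sup>+x. 0 \<partial>(\<Pi>\<^sub>M i\<in>{..<m}. std_normal_distribution))"
  proof (rule nn_integral_cong)
    fix x :: "nat \<Rightarrow> real"
    have "(\<integral>\<^sup>+y. ?A (x(m := y)) \<partial>std_normal_distribution) = (\<integral>\<^sup>+y. 0 \<partial>std_normal_distribution)"
    proof (rule nn_integral_cong_AE)
      show "AE y in std_normal_distribution. ?A (x(m := y)) = 0"
        using atom[of "c - (\<Sum>i<m. (x i)\<^sup>2)"]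
      proof eventually_elim
        case (elim y)
        have "(\<Sum>i<m. ((x(m := y)) i)\<^sup>2) = (\<Sum>i<m. (x i)\<^sup>2)" by (intro sum.cong) auto
        then show ?case using elim by (simp add: k indicator_def)
      qed
    qed
    then show "(\<integral>\<^sup>+y. ?A (x(m := y)) \<partial>std_normal_distribution) = 0" by simp
  qed
  finally show ?thesis by (simp add: measure_def)
qed

text \<open>For \<open>z\<^sub>k = a\<^sub>k \<bullet> S\<^sub>n / sqrt n\<close>, averaging the integrand over the sample gives the characteristic
  function of \<open>(\<Sum>\<^sub>k \<eta>\<^sub>k a\<^sub>k) \<bullet> S\<^sub>n / sqrt n\<close>, whose limit the one-dimensional central limit theorem provides.\<close>
lemma exp_sum_squares_eq_gaussian_integral:
  fixes z :: "nat \<Rightarrow> real"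
  assumes t: "0 \<le> t"
  shows "complex_of_real (exp (- t * (\<Sum>k<l. (z k)\<^sup>2)))
    = (CLINT \<eta>|(\<Pi>\<^sub>M i\<in>{..<l}. std_normal_distribution). iexp (sqrt (2 * t) * (\<Sum>k<l. \<eta> k * z k)))"
proof -
  interpret N: real_distribution std_normal_distribution by (rule real_dist_normal_dist)
  interpret P: product_sigma_finite "\<lambda>_::nat. std_normal_distribution"
    unfolding product_sigma_finite_def by (intro allI N.sigma_finite_measure_axioms)
  \<comment> \<open>Scaled so that the characteristic function of the standard normal law at
    \<open>?s * z k\<close> equals \<open>exp (- t * (z k)^2)\<close>.\<close>
  let ?s = "sqrt (2 * t)"
  have "iexp (?s * (\<Sum>k<l. \<eta> k * z k)) = (\<Prod>k<l. iexp (?s * z k * \<eta> k))" for \<eta> :: "nat \<Rightarrow> real"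
  proof -
    have "\<i> * complex_of_real (?s * (\<Sum>k<l. \<eta> k * z k)) = (\<Sum>k<l. \<i> * complex_of_real (?s * z k * \<eta> k))"
      by (simp add: sum_distrib_left mult_ac)
    then show ?thesis by (simp only: exp_sum finite_lessThan)
  qed
  then have "(CLINT \<eta>|(\<Pi>\<^sub>M i\<in>{..<l}. std_normal_distribution). iexp (?s * (\<Sum>k<l. \<eta> k * z k)))
      = (CLINT \<eta>|(\<Pi>\<^sub>M i\<in>{..<l}. std_normal_distribution). (\<Prod>k<l. iexp (?s * z k * \<eta> k)))"
    by (simp only:)
  also have "\<dots> = (\<Prod>k<l. (CLINT y|std_normal_distribution. iexp (?s * z k * y)))"
    by (rule P.product_integral_prod) (auto intro!: N.integrable_const_bound[where B = 1])
  also have "\<dots> = (\<Prod>k<l. char std_normal_distribution (?s * z k))"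
    by (simp add: char_def)
  also have "\<dots> = (\<Prod>k<l. complex_of_real (exp (- t * (z k)\<^sup>2)))"
    using t by (simp add: char_std_normal_distribution power_mult_distrib)
  also have "\<dots> = complex_of_real (exp (- t * (\<Sum>k<l. (z k)\<^sup>2)))"
    by (simp add: sum_distrib_left exp_sum flip: of_real_prod sum_negf)
  finally show ?thesis ..
qed

lemma integrable_inner_mult:
  fixes Y :: "'a \<Rightarrow> 'b::euclidean_space"
  assumes [measurable]: "Y \<in> borel_measurable M" and sq: "integrable M (\<lambda>\<omega>. (norm (Y \<omega>))\<^sup>2)"
  shows "integrable M (\<lambda>\<omega>. inner u (Y \<omega>) * inner v (Y \<omega>))"
proof (rule Bochner_Integration.integrable_bound)
  show "integrable M (\<lambda>\<omega>. norm u * norm v * (norm (Y \<omega>))\<^sup>2)" using sq by simp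
  show "AE \<omega> in M. norm (inner u (Y \<omega>) * inner v (Y \<omega>)) \<le> norm (norm u * norm v * (norm (Y \<omega>))\<^sup>2)"
  proof (rule AE_I2)
    fix \<omega>
    have "\<bar>inner u (Y \<omega>)\<bar> * \<bar>inner v (Y \<omega>)\<bar> \<le> (norm u * norm (Y \<omega>)) * (norm v * norm (Y \<omega>))"
      by (intro mult_mono Cauchy_Schwarz_ineq2) auto
    then show "norm (inner u (Y \<omega>) * inner v (Y \<omega>)) \<le> norm (norm u * norm v * (norm (Y \<omega>))\<^sup>2)"
      by (simp add: abs_mult power2_eq_square mult_ac)
  qed
qed measurable

lemma identically_distributed_transfer:
  fixes h :: "'c \<Rightarrow> 'b::{banach, second_countable_topology}"
  assumes eq: "distr M N X = distr M N Z"
    and X: "X \<in> measurable M N" and Z: "Z \<in> measurable M N" and h: "h \<in> borel_measurable N"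
  shows "integrable M (\<lambda>\<omega>. h (X \<omega>)) \<longleftrightarrow> integrable M (\<lambda>\<omega>. h (Z \<omega>))"
    and "(LINT \<omega>|M. h (X \<omega>)) = (LINT \<omega>|M. h (Z \<omega>))"
  unfolding integrable_distr_eq[OF X h, symmetric] integrable_distr_eq[OF Z h, symmetric]
    integral_distr[OF X h, symmetric] integral_distr[OF Z h, symmetric] eq by (rule refl)+

lemma (in prob_space) clt_char:
  fixes Y :: "nat \<Rightarrow> 'a \<Rightarrow> 'b::euclidean_space"
  assumes indep: "indep_vars (\<lambda>_. borel) Y UNIV"
    and ident: "\<And>i. distr M borel (Y i) = distr M borel (Y 0)"
    and sq: "integrable M (\<lambda>\<omega>. (inner u (Y 0 \<omega>))\<^sup>2)"
    and mean: "expectation (\<lambda>\<omega>. inner u (Y 0 \<omega>)) = 0"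
    and \<sigma>: "expectation (\<lambda>\<omega>. (inner u (Y 0 \<omega>))\<^sup>2) = \<sigma>\<^sup>2" "\<sigma> > 0"
  shows "(\<lambda>n. CLINT \<omega>|M. iexp (s * (inner u (\<Sum>i<n. Y i \<omega>) / sqrt (real n))))
    \<longlonglongrightarrow> complex_of_real (exp (- (s\<^sup>2 * \<sigma>\<^sup>2) / 2))"
proof -
  have [measurable]: "Y i \<in> borel_measurable M" for i using indep by (simp add: indep_vars_def)
  let ?X = "\<lambda>i \<omega>. inner u (Y i \<omega>)"
  have transfer: "expectation (\<lambda>\<omega>. g (?X i \<omega>)) = expectation (\<lambda>\<omega>. g (?X 0 \<omega>))"
    "integrable M (\<lambda>\<omega>. g (?X i \<omega>)) \<longleftrightarrow> integrable M (\<lambda>\<omega>. g (?X 0 \<omega>))"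
    if [measurable]: "g \<in> borel_measurable borel" for g :: "real \<Rightarrow> real" and i
    by (rule identically_distributed_transfer[OF ident[of i], where h = "\<lambda>y. g (inner u y)"]; measurable)+
  have "weak_conv_m (\<lambda>n. distr M borel (\<lambda>\<omega>. (\<Sum>i<n. ?X i \<omega>) / sqrt (real n * \<sigma>\<^sup>2))) std_normal_distribution"
  proof (rule central_limit_theorem_zero_mean[where \<mu> = "distr M borel (?X 0)"])
    show "indep_vars (\<lambda>i. borel) ?X UNIV" by (rule indep_vars_compose2[OF indep]) auto
    show "expectation (?X i) = 0" for i using transfer(1)[of "\<lambda>x. x" i] mean by simp
    show "0 < \<sigma>" by (rule \<sigma>(2))
    show "integrable M (\<lambda>\<omega>. (?X i \<omega>)\<^sup>2)" for i using transfer(2)[of "\<lambda>x. x\<^sup>2" i] sq by simp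
    show "variance (?X i) = \<sigma>\<^sup>2" for i
      using transfer(1)[of "\<lambda>x. x\<^sup>2" i] transfer(1)[of "\<lambda>x. x" i] mean \<sigma>(1) by simp
    have "distr M borel (?X i) = distr (distr M borel (Y i)) borel (inner u)" for i
      by (subst distr_distr) (auto simp: comp_def)
    then show "distr M borel (?X i) = distr M borel (?X 0)" for i by (simp only: ident[of i])
  qed
  \<comment> \<open>The argument \<open>s * \<sigma>\<close> undoes the division by \<sigma> in the
    standardized sum.\<close>
  from levy_continuity1[OF _ real_dist_normal_dist this, of "s * \<sigma>"]
  have "(\<lambda>n. char (distr M borel (\<lambda>\<omega>. (\<Sum>i<n. ?X i \<omega>) / sqrt (real n * \<sigma>\<^sup>2))) (s * \<sigma>))
    \<longlonglongrightarrow> complex_of_real (exp (- (s * \<sigma>)\<^sup>2 / 2))"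
    by (simp add: char_std_normal_distribution real_distribution_distr)
  moreover have "char (distr M borel (\<lambda>\<omega>. (\<Sum>i<n. ?X i \<omega>) / sqrt (real n * \<sigma>\<^sup>2))) (s * \<sigma>)
      = (CLINT \<omega>|M. iexp (s * (inner u (\<Sum>i<n. Y i \<omega>) / sqrt (real n))))" for n
  proof -
    have "s * \<sigma> * (x / sqrt (real n * \<sigma>\<^sup>2)) = s * (x / sqrt (real n))" for x :: real
      using \<sigma>(2) by (simp add: real_sqrt_mult)
    then show ?thesis
      unfolding char_def by (subst integral_distr) (auto simp: inner_sum_right)
  qed
  ultimately show ?thesis by (simp add: power_mult_distrib)
qed

text \<open>After exchanging the two averages, the inner one is a characteristic function in the
  direction \<open>u = (\<Sum>k<l. \<eta> k *\<^sub>R a k)\<close>. By \<open>orth\<close> its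
  variance is the sum of the squares of the \<open>\<eta> k\<close>, so in the limit the outer
  average becomes the Laplace transform of \<open>chi_square l\<close>.\<close>

theorem (in prob_space) clt_sum_of_squares:
  fixes Y :: "nat \<Rightarrow> 'a \<Rightarrow> 'b::euclidean_space" and a :: "nat \<Rightarrow> 'b"
  assumes indep: "indep_vars (\<lambda>_. borel) Y UNIV"
    and ident: "\<And>i. distr M borel (Y i) = distr M borel (Y 0)"
    and sq: "integrable M (\<lambda>\<omega>. (norm (Y 0 \<omega>))\<^sup>2)"
    and mean: "\<And>u. expectation (\<lambda>\<omega>. inner u (Y 0 \<omega>)) = 0"
    and orth: "\<And>j k. j < l \<Longrightarrow> k < l \<Longrightarrow>
      expectation (\<lambda>\<omega>. inner (a j) (Y 0 \<omega>) * inner (a k) (Y 0 \<omega>)) = (if j = k then 1 else 0)"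
  shows "weak_conv_m (\<lambda>n. distr M borel (\<lambda>\<omega>. \<Sum>k<l. (inner (a k) (\<Sum>i<n. Y i \<omega>) / sqrt (real n))\<^sup>2)) (chi_square l)"
proof -
  have [measurable]: "Y i \<in> borel_measurable M" for i using indep by (simp add: indep_vars_def)
  let ?z = "\<lambda>n \<omega> k. inner (a k) (\<Sum>i<n. Y i \<omega>) / sqrt (real n)"
  interpret N: real_distribution std_normal_distribution by (rule real_dist_normal_dist)
  let ?G = "\<Pi>\<^sub>M i\<in>{..<l}. std_normal_distribution"
  interpret G: prob_space ?G by (rule prob_space_PiM) (rule N.prob_space_axioms)
  interpret MG: pair_prob_space M ?G ..
  have int2: "integrable M (\<lambda>\<omega>. inner u (Y 0 \<omega>) * inner v (Y 0 \<omega>))" for u v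
    by (rule integrable_inner_mult[OF _ sq]) measurable
  show ?thesis
  proof (rule weak_conv_m_laplaceI)
    show "real_distribution (distr M borel (\<lambda>\<omega>. \<Sum>k<l. (?z n \<omega> k)\<^sup>2))" for n
      by (rule real_distribution_distr) measurable
    show "AE x in distr M borel (\<lambda>\<omega>. \<Sum>k<l. (?z n \<omega> k)\<^sup>2). 0 \<le> x" for n
      by (subst AE_distr_iff) (auto simp: sum_nonneg)
    show "real_distribution (chi_square l)" by (rule real_distribution_chi_square)
    show "AE x in chi_square l. 0 \<le> x" by (rule AE_chi_square_nonneg)
    fix K :: nat
    define t where "t = real K"
    have t: "0 \<le> t" by (simp add: t_def)
    let ?s = "sqrt (2 * t)"
    let ?I = "\<lambda>n \<eta>. CLINT \<omega>|M. iexp (?s * (\<Sum>k<l. \<eta> k * ?z n \<omega> k))"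
    have lhs: "complex_of_real (LINT x|distr M borel (\<lambda>\<omega>. \<Sum>k<l. (?z n \<omega> k)\<^sup>2). exp (- t * x)) = (CLINT \<eta>|?G. ?I n \<eta>)" for n
    proof -
      have "complex_of_real (LINT x|distr M borel (\<lambda>\<omega>. \<Sum>k<l. (?z n \<omega> k)\<^sup>2). exp (- t * x))
          = complex_of_real (LINT \<omega>|M. exp (- t * (\<Sum>k<l. (?z n \<omega> k)\<^sup>2)))"
        by (subst integral_distr) auto
      also have "\<dots> = (CLINT \<omega>|M. complex_of_real (exp (- t * (\<Sum>k<l. (?z n \<omega> k)\<^sup>2))))"
        by (rule integral_complex_of_real[symmetric])
      also have "\<dots> = (CLINT \<omega>|M. (CLINT \<eta>|?G. iexp (?s * (\<Sum>k<l. \<eta> k * ?z n \<omega> k))))"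
        by (simp only: exp_sum_squares_eq_gaussian_integral[OF t])
      also have "\<dots> = (CLINT \<eta>|?G. ?I n \<eta>)"
        by (rule MG.Fubini_integral[symmetric], rule MG.integrable_const_bound[where B = 1]) auto
      finally show ?thesis .
    qed
    have rhs: "complex_of_real (LINT x|chi_square l. exp (- t * x)) = (CLINT \<eta>|?G. complex_of_real (exp (- t * (\<Sum>k<l. (\<eta> k)\<^sup>2))))"
    proof -
      have "(LINT x|chi_square l. exp (- t * x)) = (LINT \<eta>|?G. exp (- t * (\<Sum>k<l. (\<eta> k)\<^sup>2)))"
        unfolding chi_square_def by (subst integral_distr) auto
      then show ?thesis by (simp only: integral_complex_of_real)
    qed
    have lim: "(\<lambda>n. ?I n \<eta>) \<longlonglongrightarrow> complex_of_real (exp (- t * (\<Sum>k<l. (\<eta> k)\<^sup>2)))" for \<eta> :: "nat \<Rightarrow> real"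
    proof (cases "(\<Sum>k<l. (\<eta> k)\<^sup>2) = 0")
      \<comment> \<open>The degenerate direction is set apart because the central limit theorem
        requires positive variance; here both sides are 1.\<close>
      case True
      then have "\<eta> k = 0" if "k < l" for k
        using that by (subst (asm) sum_nonneg_eq_0_iff) auto
      then show ?thesis using True by (simp add: prob_space)
    next
      case False
      define \<sigma> where "\<sigma> = sqrt (\<Sum>k<l. (\<eta> k)\<^sup>2)"
      have \<sigma>: "\<sigma>\<^sup>2 = (\<Sum>k<l. (\<eta> k)\<^sup>2)" unfolding \<sigma>_def by (rule real_sqrt_pow2) (simp add: sum_nonneg)
      have \<sigma>0: "\<sigma> > 0" using False by (simp add: \<sigma>_def less_le sum_nonneg)
      define u where "u = (\<Sum>k<l. \<eta> k *\<^sub>R a k)"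
      have uy: "inner u y = (\<Sum>k<l. \<eta> k * inner (a k) y)" for y by (simp add: u_def inner_sum_left)
      have "expectation (\<lambda>\<omega>. (inner u (Y 0 \<omega>))\<^sup>2)
          = expectation (\<lambda>\<omega>. \<Sum>j<l. \<Sum>k<l. \<eta> j * \<eta> k * (inner (a j) (Y 0 \<omega>) * inner (a k) (Y 0 \<omega>)))"
        by (intro Bochner_Integration.integral_cong refl) (simp add: uy power2_eq_square sum_product mult_ac)
      also have "\<dots> = (\<Sum>j<l. \<Sum>k<l. \<eta> j * \<eta> k * expectation (\<lambda>\<omega>. inner (a j) (Y 0 \<omega>) * inner (a k) (Y 0 \<omega>)))"
        by (simp add: int2)
      also have "\<dots> = (\<Sum>j<l. \<Sum>k<l. if j = k then \<eta> j * \<eta> k else 0)"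
        by (intro sum.cong refl) (simp add: orth)
      also have "\<dots> = \<sigma>\<^sup>2" unfolding \<sigma> by (simp add: power2_eq_square)
      finally have var: "expectation (\<lambda>\<omega>. (inner u (Y 0 \<omega>))\<^sup>2) = \<sigma>\<^sup>2" .
      have "(\<lambda>n. CLINT \<omega>|M. iexp (?s * (inner u (\<Sum>i<n. Y i \<omega>) / sqrt (real n))))
        \<longlonglongrightarrow> complex_of_real (exp (- (?s\<^sup>2 * \<sigma>\<^sup>2) / 2))"
        by (rule clt_char[OF indep ident _ mean var \<sigma>0]) (use int2[of u u] in \<open>simp add: power2_eq_square\<close>)
      moreover have "inner u (\<Sum>i<n. Y i \<omega>) / sqrt (real n) = (\<Sum>k<l. \<eta> k * ?z n \<omega> k)" for n \<omega>
        by (simp add: uy sum_divide_distrib)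
      moreover have "- (?s\<^sup>2 * \<sigma>\<^sup>2) / 2 = - t * (\<Sum>k<l. (\<eta> k)\<^sup>2)" using t by (simp add: \<sigma>)
      ultimately show ?thesis by (simp only:)
    qed
    have "(\<lambda>n. CLINT \<eta>|?G. ?I n \<eta>) \<longlonglongrightarrow> (CLINT \<eta>|?G. complex_of_real (exp (- t * (\<Sum>k<l. (\<eta> k)\<^sup>2))))"
    proof (rule integral_dominated_convergence[where w = "\<lambda>_. 1"])
      show "(\<lambda>\<eta>. ?I n \<eta>) \<in> borel_measurable ?G" for n by measurable
      show "AE \<eta> in ?G. norm (?I n \<eta>) \<le> 1" for n
      proof (rule AE_I2)
        fix \<eta>
        have "norm (?I n \<eta>) \<le> (LINT \<omega>|M. norm (iexp (?s * (\<Sum>k<l. \<eta> k * ?z n \<omega> k))))"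
          by (rule integral_norm_bound)
        then show "norm (?I n \<eta>) \<le> 1" by (simp add: prob_space)
      qed
    qed (use lim in \<open>auto intro: AE_I2\<close>)
    then have "(\<lambda>n. complex_of_real (LINT x|distr M borel (\<lambda>\<omega>. \<Sum>k<l. (?z n \<omega> k)\<^sup>2). exp (- t * x)))
      \<longlonglongrightarrow> complex_of_real (LINT x|chi_square l. exp (- t * x))"
      by (simp only: lhs rhs)
    then show "(\<lambda>n. LINT x|distr M borel (\<lambda>\<omega>. \<Sum>k<l. (?z n \<omega> k)\<^sup>2). exp (- real K * x))
      \<longlonglongrightarrow> (LINT x|chi_square l. exp (- real K * x))"
      unfolding tendsto_of_real_iff t_def .
  qed
qed

section \<open>Quadratic forms, Lipschitz moduli and sample covariances\<close>

text \<open>The norm of a matrix is the Euclidean norm of its entries, so Cauchy-Schwarz in each row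
  suffices.\<close>

lemma norm_matrix_vector_mult_le:
  fixes A :: "real^'n^'m"
  shows "norm (A *v x) \<le> norm A * norm x"
proof -
  have "norm (A *v x) \<le> L2_set (\<lambda>i. norm (A $ i) * norm x) UNIV"
    unfolding norm_vec_def[of "A *v x"]
  proof (rule L2_set_mono)
    fix i
    have "(A *v x) $ i = inner (A $ i) x" by (simp add: matrix_vector_mult_def inner_vec_def)
    then show "norm ((A *v x) $ i) \<le> norm (A $ i) * norm x"
      using Cauchy_Schwarz_ineq2[of "A $ i" x] by simp
  qed simp
  also have "\<dots> = norm A * norm x"
    unfolding norm_vec_def[of A] by (simp add: L2_set_left_distrib)
  finally show ?thesis .
qed

text \<open>The form in eigencoordinates; it yields the chi-square sum, the vanishing on the kernel
  and the measurability of the quadratic forms.\<close>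

lemma inner_spectral_matrix:
  fixes V :: "real^'n^'n"
  shows "inner x (spectral_matrix V d *v y) = (\<Sum>k\<in>UNIV. d k * inner (V $ k) x * inner (V $ k) y)"
proof -
  have "inner x (spectral_matrix V d *v y)
      = (\<Sum>i\<in>UNIV. \<Sum>j\<in>UNIV. \<Sum>k\<in>UNIV. x $ i * (V $ k $ i * d k * V $ k $ j) * y $ j)"
    by (simp add: inner_vec_def matrix_vector_mult_def spectral_matrix_def sum_distrib_left sum_distrib_right mult.assoc)
  also have "\<dots> = (\<Sum>i\<in>UNIV. \<Sum>k\<in>UNIV. \<Sum>j\<in>UNIV. x $ i * (V $ k $ i * d k * V $ k $ j) * y $ j)"
    by (intro sum.cong refl sum.swap)
  also have "\<dots> = (\<Sum>k\<in>UNIV. \<Sum>i\<in>UNIV. \<Sum>j\<in>UNIV. x $ i * (V $ k $ i * d k * V $ k $ j) * y $ j)"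
    by (rule sum.swap)
  also have "\<dots> = (\<Sum>k\<in>UNIV. d k * inner (V $ k) x * inner (V $ k) y)"
  proof (rule sum.cong[OF refl])
    fix k
    have "d k * inner (V $ k) x * inner (V $ k) y = d k * ((\<Sum>i\<in>UNIV. V $ k $ i * x $ i) * (\<Sum>j\<in>UNIV. V $ k $ j * y $ j))"
      by (simp add: inner_vec_def mult.assoc)
    also have "\<dots> = (\<Sum>i\<in>UNIV. \<Sum>j\<in>UNIV. x $ i * (V $ k $ i * d k * V $ k $ j) * y $ j)"
      unfolding sum_product unfolding sum_distrib_left by (intro sum.cong refl) (simp add: mult_ac)
    finally show "(\<Sum>i\<in>UNIV. \<Sum>j\<in>UNIV. x $ i * (V $ k $ i * d k * V $ k $ j) * y $ j) = d k * inner (V $ k) x * inner (V $ k) y" ..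
  qed
  finally show ?thesis .
qed

text \<open>The error is measured relative to \<open>1 + n \<bar>g\<bar>\<^sup>2\<close>, whose expectation is bounded in the application.\<close>
lemma quadratic_form_perturbation:
  fixes w g :: "nat \<Rightarrow> real^'n" and A :: "nat \<Rightarrow> real^'n^'n"
  assumes A: "A \<longlonglongrightarrow> B" and \<eta>: "\<eta> \<longlonglongrightarrow> 0" "\<And>n. 0 \<le> \<eta> n"
    and wg: "\<forall>\<^sub>F n in sequentially. norm (w n - g n) \<le> \<eta> n * norm (g n)"
  shows "(\<lambda>n. (real n * inner (w n) (A n *v w n) - real n * inner (g n) (B *v g n)) / (1 + real n * (norm (g n))\<^sup>2)) \<longlonglongrightarrow> 0"
proof (rule Lim_null_comparison)
  \<comment> \<open>The three differences in the splitting below contribute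
    \<open>\<eta> n * (1 + \<eta> n)\<close>, \<open>\<eta> n\<close> and
    \<open>norm (A n - B)\<close>, the first two multiplied by \<open>norm (A n)\<close>.\<close>
  let ?b = "\<lambda>n. norm (A n) * \<eta> n * (2 + \<eta> n) + norm (A n - B)"
  have "(\<lambda>n. norm (A n - B)) \<longlonglongrightarrow> 0" using A by (simp add: LIM_zero tendsto_norm_zero)
  then have "?b \<longlonglongrightarrow> norm B * 0 * (2 + 0) + 0" by (intro tendsto_intros A \<eta>)
  then show "?b \<longlonglongrightarrow> 0" by simp
  show "\<forall>\<^sub>F n in sequentially. norm ((real n * inner (w n) (A n *v w n) - real n * inner (g n) (B *v g n)) / (1 + real n * (norm (g n))\<^sup>2)) \<le> ?b n"
    using wg
  proof eventually_elim
    case (elim n)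
    let ?G = "norm (g n)"
    have bound: "\<bar>inner x (M *v y)\<bar> \<le> norm M * norm x * norm y" for x y and M :: "real^'n^'n"
    proof -
      have "\<bar>inner x (M *v y)\<bar> \<le> norm x * norm (M *v y)" by (rule Cauchy_Schwarz_ineq2)
      also have "\<dots> \<le> norm x * (norm M * norm y)" by (intro mult_left_mono norm_matrix_vector_mult_le) auto
      finally show ?thesis by (simp add: mult_ac)
    qed
    have w: "norm (w n) \<le> (1 + \<eta> n) * ?G"
      using norm_triangle_ineq[of "w n - g n" "g n"] elim by (simp add: algebra_simps)
    have "inner (w n) (A n *v w n) - inner (g n) (B *v g n)
        = inner (w n - g n) (A n *v w n) + inner (g n) (A n *v (w n - g n)) + inner (g n) ((A n - B) *v g n)"
      by (simp add: inner_diff_left inner_diff_right matrix_vector_mult_diff_distrib matrix_vector_mult_diff_rdistrib)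
    then have "\<bar>inner (w n) (A n *v w n) - inner (g n) (B *v g n)\<bar>
        \<le> \<bar>inner (w n - g n) (A n *v w n)\<bar> + \<bar>inner (g n) (A n *v (w n - g n))\<bar> + \<bar>inner (g n) ((A n - B) *v g n)\<bar>"
      by linarith
    also have "\<dots> \<le> norm (A n) * (\<eta> n * ?G) * ((1 + \<eta> n) * ?G) + norm (A n) * ?G * (\<eta> n * ?G) + norm (A n - B) * ?G * ?G"
    proof (intro add_mono)
      show "\<bar>inner (w n - g n) (A n *v w n)\<bar> \<le> norm (A n) * (\<eta> n * ?G) * ((1 + \<eta> n) * ?G)"
        using elim w \<eta>(2)[of n] by (intro order_trans[OF bound] mult_mono mult_left_mono) auto
      show "\<bar>inner (g n) (A n *v (w n - g n))\<bar> \<le> norm (A n) * ?G * (\<eta> n * ?G)"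
        using elim by (intro order_trans[OF bound] mult_left_mono) auto
    qed (rule bound)
    also have "\<dots> = ?b n * ?G\<^sup>2" by (simp add: power2_eq_square algebra_simps)
    finally have "real n * \<bar>inner (w n) (A n *v w n) - inner (g n) (B *v g n)\<bar> \<le> real n * (?b n * ?G\<^sup>2)"
      by (intro mult_left_mono) auto
    also have "\<dots> = ?b n * (real n * ?G\<^sup>2)" by simp
    also have "\<dots> \<le> ?b n * (1 + real n * ?G\<^sup>2)" using \<eta>(2)[of n] by (intro mult_left_mono) auto
    finally have "real n * \<bar>inner (w n) (A n *v w n) - inner (g n) (B *v g n)\<bar> \<le> ?b n * (1 + real n * ?G\<^sup>2)" .
    moreover have "real n * inner (w n) (A n *v w n) - real n * inner (g n) (B *v g n) = real n * (inner (w n) (A n *v w n) - inner (g n) (B *v g n))"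
      by (simp add: algebra_simps)
    moreover have pos: "0 < 1 + real n * ?G\<^sup>2" by (simp add: add_pos_nonneg)
    ultimately show ?case by (simp add: abs_mult pos_divide_le_eq)
  qed
qed

text \<open>In a complete space values may be altered freely on a null set. This transfers
  measurability to quantities such as B-derivatives from expressions that are visibly measurable and
  agree with them almost everywhere.\<close>

lemma (in complete_measure) measurable_AE_eq:
  assumes f: "f \<in> measurable M N" and eq: "AE x in M. f x = g x" and g: "\<And>x. x \<in> space M \<Longrightarrow> g x \<in> space N"
  shows "g \<in> measurable M N"
proof (rule measurableI)
  fix A assume A: "A \<in> sets N"
  obtain E where E: "{x\<in>space M. f x \<noteq> g x} \<subseteq> E" "E \<in> null_sets M"
    using eq by (auto elim!: AE_E intro: null_setsI)
  have "(g -` A \<inter> space M) \<inter> E \<in> sets M" by (rule complete[OF _ E(2)]) auto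
  moreover have "g -` A \<inter> space M = (f -` A \<inter> space M - E) \<union> ((g -` A \<inter> space M) \<inter> E)"
    using E(1) by auto
  moreover have "f -` A \<inter> space M \<in> sets M" by (rule measurable_sets[OF f A])
  moreover have "E \<in> sets M" using E(2) by auto
  ultimately show "g -` A \<inter> space M \<in> sets M" by (metis sets.Diff sets.Un)
qed (rule g)

text \<open>The constant \<open>C\<close> of hypothesis (c) depends on \<omega> and cannot be
  evaluated at sample points. The largest difference quotient is a function of the value of \<xi>;
  taken over a countable dense set it is measurable, it is dominated by the absolute value of
  \<open>C\<close>, and continuity extends the bound to all of \<open>D\<close>.\<close>

lemma measurable_lipschitz_modulus:
  fixes P :: "'a::euclidean_space \<Rightarrow> 'e \<Rightarrow> 'b::{real_normed_vector, second_countable_topology}"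
  assumes P: "\<And>y. y \<in> D \<Longrightarrow> P y \<in> borel_measurable N" and \<xi>[measurable]: "\<xi> \<in> measurable M N"
    and lip: "AE \<omega> in M. \<forall>y\<in>D. \<forall>y'\<in>D. norm (P y (\<xi> \<omega>) - P y' (\<xi> \<omega>)) \<le> C \<omega> * norm (y - y')"
  obtains c where "c \<in> borel_measurable N" "\<forall>e. 0 \<le> c e" "AE \<omega> in M. c (\<xi> \<omega>) \<le> \<bar>C \<omega>\<bar>"
    "AE e in distr M N \<xi>. continuous_on D (\<lambda>y. P y e) \<longrightarrow>
      (\<forall>y\<in>D. \<forall>y'\<in>D. norm (P y e - P y' e) \<le> c e * norm (y - y'))"
proof -
  obtain T where T: "countable T" "T \<subseteq> D" "D \<subseteq> closure T" by (rule separable[of D])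
  \<comment> \<open>On the diagonal the quotient is 0 by division by zero, so equal points need no
    exclusion. Values in \<open>ennreal\<close> make the supremum exist in any case.\<close>
  define q where "q p e = ennreal (norm (P (fst p) e - P (snd p) e) / norm (fst p - snd p))" for p e
  define c0 where "c0 e = (SUP p\<in>T \<times> T. q p e)" for e
  \<comment> \<open>\<open>enn2real\<close> sends \<infinity> to 0, which matters only on the null
    set where \<open>c0\<close> is infinite.\<close>
  define c where "c e = enn2real (c0 e)" for e
  have cnt: "countable (T \<times> T)" using T(1) by simp
  have [measurable]: "c0 \<in> borel_measurable N"
    unfolding c0_def
  proof (rule borel_measurable_SUP[OF cnt])
    fix p assume "p \<in> T \<times> T"
    then have "fst p \<in> D" "snd p \<in> D" using T(2) by auto
    note [measurable] = P[OF this(1)] P[OF this(2)]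
    show "q p \<in> borel_measurable N" unfolding q_def by measurable
  qed
  have c0_le: "AE \<omega> in M. c0 (\<xi> \<omega>) \<le> ennreal \<bar>C \<omega>\<bar>"
    using lip
  proof eventually_elim
    case (elim \<omega>)
    show ?case unfolding c0_def
    proof (rule SUP_least)
      fix p assume p: "p \<in> T \<times> T"
      have "norm (P (fst p) (\<xi> \<omega>) - P (snd p) (\<xi> \<omega>)) \<le> C \<omega> * norm (fst p - snd p)"
        using p T(2) by (intro elim[rule_format]) auto
      also have "\<dots> \<le> \<bar>C \<omega>\<bar> * norm (fst p - snd p)" by (intro mult_right_mono) auto
      finally have "norm (P (fst p) (\<xi> \<omega>) - P (snd p) (\<xi> \<omega>)) / norm (fst p - snd p) \<le> \<bar>C \<omega>\<bar>"
        by (cases "fst p = snd p") (auto simp: divide_simps)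
      then show "q p (\<xi> \<omega>) \<le> ennreal \<bar>C \<omega>\<bar>" unfolding q_def by (rule ennreal_leI)
    qed
  qed
  have fin: "AE e in distr M N \<xi>. c0 e < \<infinity>"
  proof (subst AE_distr_iff)
    show "AE \<omega> in M. c0 (\<xi> \<omega>) < \<infinity>"
      using c0_le by eventually_elim (auto simp: less_top[symmetric] top_unique)
  qed measurable
  show ?thesis
  proof (rule that)
    show "c \<in> borel_measurable N" unfolding c_def by measurable
    show "\<forall>e. 0 \<le> c e" by (simp add: c_def)
    show "AE \<omega> in M. c (\<xi> \<omega>) \<le> \<bar>C \<omega>\<bar>"
      using c0_le
    proof eventually_elim
      case (elim \<omega>)
      then have "enn2real (c0 (\<xi> \<omega>)) \<le> enn2real (ennreal \<bar>C \<omega>\<bar>)" by (intro enn2real_mono) auto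
      then show ?case by (simp add: c_def)
    qed
    show "AE e in distr M N \<xi>. continuous_on D (\<lambda>y. P y e) \<longrightarrow>
      (\<forall>y\<in>D. \<forall>y'\<in>D. norm (P y e - P y' e) \<le> c e * norm (y - y'))"
      using fin
    proof (eventually_elim, intro impI ballI)
      fix e y y' assume fin: "c0 e < \<infinity>" and cont: "continuous_on D (\<lambda>y. P y e)" and y: "y \<in> D" "y' \<in> D"
      have onT: "norm (P t e - P t' e) \<le> c e * norm (t - t')" if t: "t \<in> T" "t' \<in> T" for t t'
      proof (cases "t = t'")
        case False
        have "q (t, t') e \<le> c0 e" unfolding c0_def using t by (intro SUP_upper) auto
        then have "enn2real (q (t, t') e) \<le> c e" unfolding c_def using fin by (intro enn2real_mono) auto
        then have "norm (P t e - P t' e) / norm (t - t') \<le> c e" by (simp add: q_def)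
        then show ?thesis using False by (simp add: pos_divide_le_eq)
      qed simp
      obtain s where s: "\<And>n. s n \<in> T" "s \<longlonglongrightarrow> y" using y(1) T(3) closure_sequential[of y T] by auto
      obtain s' where s': "\<And>n. s' n \<in> T" "s' \<longlonglongrightarrow> y'" using y(2) T(3) closure_sequential[of y' T] by auto
      have 1: "(\<lambda>n. P (s n) e) \<longlonglongrightarrow> P y e" "(\<lambda>n. P (s' n) e) \<longlonglongrightarrow> P y' e"
        using T(2) s s' y by (auto intro!: continuous_on_tendsto_compose[OF cont] always_eventually)
      show "norm (P y e - P y' e) \<le> c e * norm (y - y')"
      proof (rule LIMSEQ_le)
        show "(\<lambda>n. norm (P (s n) e - P (s' n) e)) \<longlonglongrightarrow> norm (P y e - P y' e)" by (intro tendsto_intros 1)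
        show "(\<lambda>n. c e * norm (s n - s' n)) \<longlonglongrightarrow> c e * norm (y - y')" by (intro tendsto_intros s s')
      qed (use onT s(1) s'(1) in auto)
    qed
  qed
qed

lemma (in prob_space) strong_law_euclidean:
  fixes X :: "nat \<Rightarrow> 'a \<Rightarrow> 'c" and h :: "'c \<Rightarrow> 'b::euclidean_space"
  assumes indep: "indep_vars (\<lambda>_. N) X UNIV"
    and ident: "\<And>i. distr M N (X i) = distr M N Z" and Z[measurable]: "Z \<in> measurable M N"
    and h[measurable]: "h \<in> borel_measurable N" and int: "integrable M (\<lambda>\<omega>. h (Z \<omega>))"
  shows "AE \<omega> in M. (\<lambda>n. (\<Sum>i<n. h (X i \<omega>)) /\<^sub>R real n) \<longlonglongrightarrow> expectation (\<lambda>\<omega>. h (Z \<omega>))"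
proof -
  have [measurable]: "X i \<in> measurable M N" for i using indep by (simp add: indep_vars_def)
  have "AE \<omega> in M. (\<lambda>n. (\<Sum>i<n. inner (h (X i \<omega>)) b) / real n) \<longlonglongrightarrow> inner (expectation (\<lambda>\<omega>. h (Z \<omega>))) b" for b
  proof -
    have d: "distr M borel (\<lambda>\<omega>. inner (h (Y \<omega>)) b) = distr (distr M N Y) borel (\<lambda>e. inner (h e) b)"
      if [measurable]: "Y \<in> measurable M N" for Y
      by (subst distr_distr) (auto simp: comp_def)
    have i: "integrable M (\<lambda>\<omega>. inner (h (X 0 \<omega>)) b) \<longleftrightarrow> integrable M (\<lambda>\<omega>. inner (h (Z \<omega>)) b)"
      "expectation (\<lambda>\<omega>. inner (h (X 0 \<omega>)) b) = expectation (\<lambda>\<omega>. inner (h (Z \<omega>)) b)"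
      by (rule identically_distributed_transfer[OF ident[of 0], where h = "\<lambda>e. inner (h e) b"]; measurable)+
    have "AE \<omega> in M. (\<lambda>n. (\<Sum>i<n. inner (h (X i \<omega>)) b) / real n) \<longlonglongrightarrow> expectation (\<lambda>\<omega>. inner (h (X 0 \<omega>)) b)"
    proof (rule strong_law_of_large_numbers)
      show "indep_vars (\<lambda>_. borel) (\<lambda>i \<omega>. inner (h (X i \<omega>)) b) UNIV"
        by (rule indep_vars_compose2[OF indep]) auto
      show "distr M borel (\<lambda>\<omega>. inner (h (X i \<omega>)) b) = distr M borel (\<lambda>\<omega>. inner (h (X 0 \<omega>)) b)" for i
        by (simp add: d ident)
      show "integrable M (\<lambda>\<omega>. inner (h (X 0 \<omega>)) b)" using int by (simp add: i)
    qed
    then show ?thesis using int by (simp add: i)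
  qed
  then have "AE \<omega> in M. \<forall>b\<in>Basis. (\<lambda>n. (\<Sum>i<n. inner (h (X i \<omega>)) b) / real n) \<longlonglongrightarrow> inner (expectation (\<lambda>\<omega>. h (Z \<omega>))) b"
    by (intro AE_finite_allI) auto
  then show ?thesis
  proof eventually_elim
    case (elim \<omega>)
    then show ?case
      by (subst tendsto_componentwise_iff) (simp add: inner_sum_left divide_inverse_commute)
  qed
qed

text \<open>Cross terms vanish; independence is applied to real coordinates, over which the inner
  product is expanded.\<close>

lemma (in prob_space) second_moment_sum_indep:
  fixes Y :: "nat \<Rightarrow> 'a \<Rightarrow> 'b::euclidean_space"
  assumes indep: "indep_vars (\<lambda>_. borel) Y UNIV"
    and sq: "\<And>i. integrable M (\<lambda>\<omega>. (norm (Y i \<omega>))\<^sup>2)" and v: "\<And>i. expectation (\<lambda>\<omega>. (norm (Y i \<omega>))\<^sup>2) = v"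
    and mean: "\<And>i u. integrable M (\<lambda>\<omega>. inner (Y i \<omega>) u)" "\<And>i u. expectation (\<lambda>\<omega>. inner (Y i \<omega>) u) = 0"
  shows "integrable M (\<lambda>\<omega>. (norm (\<Sum>i<n. Y i \<omega>))\<^sup>2)" "expectation (\<lambda>\<omega>. (norm (\<Sum>i<n. Y i \<omega>))\<^sup>2) = real n * v"
proof -
  have [measurable]: "Y i \<in> borel_measurable M" for i using indep by (simp add: indep_vars_def)
  have cross: "integrable M (\<lambda>\<omega>. inner (Y i \<omega>) (Y j \<omega>))"
    "expectation (\<lambda>\<omega>. inner (Y i \<omega>) (Y j \<omega>)) = (if i = j then v else 0)" for i j
  proof -
    have "integrable M (\<lambda>\<omega>. inner (Y i \<omega>) (Y j \<omega>)) \<and> expectation (\<lambda>\<omega>. inner (Y i \<omega>) (Y j \<omega>)) = (if i = j then v else 0)"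
    proof (cases "i = j")
      case True
      then show ?thesis using sq v by (simp add: power2_norm_eq_inner)
    next
      case False
      have b: "integrable M (\<lambda>\<omega>. inner (Y i \<omega>) b * inner (Y j \<omega>) b) \<and> expectation (\<lambda>\<omega>. inner (Y i \<omega>) b * inner (Y j \<omega>) b) = 0" for b
      proof -
        have ind: "indep_vars (\<lambda>_. borel) (\<lambda>i \<omega>. inner (Y i \<omega>) b) {i, j}"
          by (rule indep_vars_subset[OF indep_vars_compose2[OF indep]]) auto
        show ?thesis
          using indep_vars_integrable[OF _ ind] indep_vars_lebesgue_integral[OF _ ind] False mean by simp
      qed
      have "inner (Y i \<omega>) (Y j \<omega>) = (\<Sum>b\<in>Basis. inner (Y i \<omega>) b * inner (Y j \<omega>) b)" for \<omega>
        by (rule euclidean_inner)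
      then show ?thesis using b False by simp
    qed
    then show "integrable M (\<lambda>\<omega>. inner (Y i \<omega>) (Y j \<omega>))"
      "expectation (\<lambda>\<omega>. inner (Y i \<omega>) (Y j \<omega>)) = (if i = j then v else 0)" by auto
  qed
  have eq: "(norm (\<Sum>i<n. Y i \<omega>))\<^sup>2 = (\<Sum>i<n. \<Sum>j<n. inner (Y i \<omega>) (Y j \<omega>))" for \<omega>
    by (simp add: power2_norm_eq_inner inner_sum_left inner_sum_right) (rule sum.swap)
  show "integrable M (\<lambda>\<omega>. (norm (\<Sum>i<n. Y i \<omega>))\<^sup>2)" unfolding eq by (simp add: cross)
  show "expectation (\<lambda>\<omega>. (norm (\<Sum>i<n. Y i \<omega>))\<^sup>2) = real n * v" unfolding eq by (simp add: cross)
qed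

lemma has_derivative_quadraticI:
  fixes f :: "'a::euclidean_space \<Rightarrow> 'b::real_normed_vector"
  assumes f': "bounded_linear f'" and r: "r > 0"
    and bound: "\<And>y. y \<in> ball x r \<Longrightarrow> norm (f y - f x - f' (y - x)) \<le> B * (norm (y - x))\<^sup>2"
  shows "(f has_derivative f') (at x)"
  unfolding has_derivative_at_alt
proof (intro conjI allI impI f')
  fix e :: real assume e: "e > 0"
  define d where "d = min r (e / (\<bar>B\<bar> + 1))"
  have d: "d > 0" using r e by (simp add: d_def)
  show "\<exists>d>0. \<forall>y. norm (y - x) < d \<longrightarrow> norm (f y - f x - f' (y - x)) \<le> e * norm (y - x)"
  proof (intro exI[of _ d] conjI allI impI d)
    fix y assume y: "norm (y - x) < d"
    have "norm (f y - f x - f' (y - x)) \<le> B * (norm (y - x))\<^sup>2"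
      using y by (intro bound) (simp add: d_def dist_norm norm_minus_commute)
    also have "\<dots> \<le> (\<bar>B\<bar> + 1) * (norm (y - x))\<^sup>2" by (intro mult_right_mono) auto
    also have "\<dots> = ((\<bar>B\<bar> + 1) * norm (y - x)) * norm (y - x)" by (simp add: power2_eq_square)
    also have "\<dots> \<le> e * norm (y - x)"
    proof (rule mult_right_mono)
      have "norm (y - x) \<le> e / (\<bar>B\<bar> + 1)" using y by (simp add: d_def)
      then show "(\<bar>B\<bar> + 1) * norm (y - x) \<le> e" by (simp add: pos_le_divide_eq mult.commute)
    qed simp
    finally show "norm (f y - f x - f' (y - x)) \<le> e * norm (y - x)" .
  qed
qed

lemma borel_measurable_vecI:
  fixes f :: "'w \<Rightarrow> 'b::euclidean_space^'n"
  assumes "\<And>i. (\<lambda>\<omega>. f \<omega> $ i) \<in> borel_measurable M"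
  shows "f \<in> borel_measurable M"
  unfolding borel_measurable_euclidean_space[where f = f]
proof
  fix b :: "'b^'n" assume "b \<in> Basis"
  then obtain i u where b: "b = axis i u" by (auto simp: Basis_vec_def)
  have "(\<lambda>\<omega>. inner (f \<omega> $ i) u) \<in> borel_measurable M"
    using assms by measurable
  then show "(\<lambda>\<omega>. inner (f \<omega>) b) \<in> borel_measurable M" by (simp add: b inner_axis)
qed

lemma borel_measurable_vec_nth[measurable (raw)]:
  fixes f :: "'w \<Rightarrow> 'b::euclidean_space^'n"
  assumes "f \<in> borel_measurable M"
  shows "(\<lambda>\<omega>. f \<omega> $ i) \<in> borel_measurable M"
  by (rule measurable_compose[OF assms borel_measurable_continuous_onI])
    (rule linear_continuous_on[OF bounded_linear_vec_nth])

lemma sample_mean_bound: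
  fixes Y Y' :: "nat \<Rightarrow> 'a::real_normed_vector"
  assumes "\<And>i. 1 \<le> i \<Longrightarrow> norm (Y i - Y' i) \<le> \<gamma> i"
  shows "norm (sample_mean n Y - sample_mean n Y') \<le> sample_mean n \<gamma>"
proof -
  have "sample_mean n Y - sample_mean n Y' = (1 / real n) *\<^sub>R (\<Sum>i=1..n. Y i - Y' i)"
    by (simp add: sample_mean_def sum_subtractf scaleR_diff_right)
  then have "norm (sample_mean n Y - sample_mean n Y') = (1 / real n) * norm (\<Sum>i=1..n. Y i - Y' i)"
    by simp
  also have "\<dots> \<le> (1 / real n) * (\<Sum>i=1..n. \<gamma> i)"
    by (intro mult_left_mono sum_norm_le assms) auto
  finally show ?thesis by (simp add: sample_mean_def)
qed

lemma sample_mean_mono: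
  fixes \<gamma> \<gamma>' :: "nat \<Rightarrow> real"
  assumes "\<And>i. 1 \<le> i \<Longrightarrow> \<gamma> i \<le> \<gamma>' i"
  shows "sample_mean n \<gamma> \<le> sample_mean n \<gamma>'"
  unfolding sample_mean_def by (auto intro!: divide_right_mono sum_mono assms)

text \<open>In the application the rows \<open>F (x n \<omega>) (\<xi>s i \<omega>)\<close> change
  with \<open>n\<close>, so the strong law does not apply to them directly. Lipschitz continuity
  compares each row with one fixed sequence \<open>Y0\<close>, at a cost governed by
  \<open>d n\<close> times averages that stay bounded.\<close>

lemma sample_covariance_tendsto:
  fixes Y :: "nat \<Rightarrow> nat \<Rightarrow> real^'q" and Y0 :: "nat \<Rightarrow> real^'q"
  assumes m: "(\<lambda>n. sample_mean n Y0) \<longlonglongrightarrow> m"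
    and s: "\<And>j k. (\<lambda>n. sample_mean n (\<lambda>i. Y0 i $ j * Y0 i $ k)) \<longlonglongrightarrow> s j k"
    and near: "\<And>n i. 1 \<le> i \<Longrightarrow> norm (Y n i - Y0 i) \<le> d n * \<gamma> i"
    and d: "d \<longlonglongrightarrow> 0" "\<And>n. 0 \<le> d n"
    and \<gamma>: "Bseq (\<lambda>n. sample_mean n (\<lambda>i. (\<gamma> i)\<^sup>2))" and N: "Bseq (\<lambda>n. sample_mean n (\<lambda>i. (norm (Y0 i))\<^sup>2))"
  shows "(\<lambda>n. sample_covariance n (Y n)) \<longlonglongrightarrow> (\<chi> j k. s j k - m $ j * m $ k)"
proof -
  obtain B where B: "\<And>n. norm (sample_mean n (\<lambda>i. (\<gamma> i)\<^sup>2)) \<le> B" using \<gamma> unfolding Bseq_def by blast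
  obtain B' where B': "\<And>n. norm (sample_mean n (\<lambda>i. (norm (Y0 i))\<^sup>2)) \<le> B'" using N unfolding Bseq_def by blast
  have lin: "sample_mean n (\<lambda>i. a * g i + b * h i) = a * sample_mean n g + b * sample_mean n h"
    for n a b and g h :: "nat \<Rightarrow> real"
    by (simp add: sample_mean_def sum.distrib sum_distrib_left[symmetric] add_divide_distrib)
  \<comment> \<open>Equality except for \<open>n = 0\<close>, where the mean is 0 by division by
    zero.\<close>
  have const: "sample_mean n (\<lambda>_. 1::real) \<le> 1" for n by (simp add: sample_mean_def)
  have mean: "(\<lambda>n. sample_mean n (Y n)) \<longlonglongrightarrow> m"
  proof (rule Lim_transform[OF m], rule Lim_null_comparison)
    show "\<forall>\<^sub>F n in sequentially. norm (sample_mean n (Y n) - sample_mean n Y0) \<le> d n * (1 + B)"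
    proof (rule always_eventually, rule)
      fix n
      have "norm (sample_mean n (Y n) - sample_mean n Y0) \<le> sample_mean n (\<lambda>i. d n * \<gamma> i)"
        by (rule sample_mean_bound) (rule near)
      also have "\<dots> \<le> sample_mean n (\<lambda>i. d n * 1 + d n * (\<gamma> i)\<^sup>2)"
      proof (rule sample_mean_mono)
        fix i
        \<comment> \<open>\<open>\<gamma> i\<close> is traded for \<open>1 + (\<gamma> i)^2\<close>,
          because the averages of the squares are the ones known to be bounded.\<close>
        have "2 * \<gamma> i \<le> (\<gamma> i)\<^sup>2 + 1" using sum_squares_bound[of "\<gamma> i" 1] by simp
        then have "\<gamma> i \<le> 1 + (\<gamma> i)\<^sup>2" using zero_le_power2[of "\<gamma> i"] by linarith
        then have "d n * \<gamma> i \<le> d n * (1 + (\<gamma> i)\<^sup>2)" by (intro mult_left_mono d)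
        then show "d n * \<gamma> i \<le> d n * 1 + d n * (\<gamma> i)\<^sup>2" by (simp add: distrib_left)
      qed
      also have "\<dots> = d n * sample_mean n (\<lambda>_. 1) + d n * sample_mean n (\<lambda>i. (\<gamma> i)\<^sup>2)" by (rule lin)
      also have "\<dots> \<le> d n * 1 + d n * B"
        using const[of n] B[of n] d(2)[of n] by (intro add_mono mult_left_mono) auto
      finally show "norm (sample_mean n (Y n) - sample_mean n Y0) \<le> d n * (1 + B)" by (simp add: distrib_left)
    qed
    show "(\<lambda>n. d n * (1 + B)) \<longlonglongrightarrow> 0" by (rule tendsto_mult_left_zero[OF d(1)])
  qed
  have prod: "(\<lambda>n. sample_mean n (\<lambda>i. Y n i $ j * Y n i $ k)) \<longlonglongrightarrow> s j k" for j k
  proof (rule Lim_transform[OF s], rule Lim_null_comparison)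
    show "\<forall>\<^sub>F n in sequentially. norm (sample_mean n (\<lambda>i. Y n i $ j * Y n i $ k) - sample_mean n (\<lambda>i. Y0 i $ j * Y0 i $ k))
        \<le> (d n + (d n)\<^sup>2) * B + d n * B'"
    proof (rule always_eventually, rule)
      fix n
      have "norm (sample_mean n (\<lambda>i. Y n i $ j * Y n i $ k) - sample_mean n (\<lambda>i. Y0 i $ j * Y0 i $ k))
          \<le> sample_mean n (\<lambda>i. (d n + (d n)\<^sup>2) * (\<gamma> i)\<^sup>2 + d n * (norm (Y0 i))\<^sup>2)"
      proof (rule sample_mean_bound)
        fix i :: nat assume i: "1 \<le> i"
        let ?a = "d n * \<gamma> i" and ?b = "norm (Y0 i)"
        have a: "\<bar>Y n i $ j - Y0 i $ j\<bar> \<le> ?a" for j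
          using component_le_norm_cart[of "Y n i - Y0 i" j] near[OF i, of n] by simp
        have b: "\<bar>Y0 i $ j\<bar> \<le> ?b" for j by (rule component_le_norm_cart)
        have a0: "0 \<le> ?a" using near[OF i, of n] norm_ge_zero order_trans by blast
        have "Y n i $ j * Y n i $ k - Y0 i $ j * Y0 i $ k
            = (Y n i $ j - Y0 i $ j) * (Y n i $ k - Y0 i $ k) + (Y n i $ j - Y0 i $ j) * Y0 i $ k + Y0 i $ j * (Y n i $ k - Y0 i $ k)"
          by (simp add: algebra_simps)
        then have "norm (Y n i $ j * Y n i $ k - Y0 i $ j * Y0 i $ k)
            \<le> \<bar>Y n i $ j - Y0 i $ j\<bar> * \<bar>Y n i $ k - Y0 i $ k\<bar> + \<bar>Y n i $ j - Y0 i $ j\<bar> * \<bar>Y0 i $ k\<bar> + \<bar>Y0 i $ j\<bar> * \<bar>Y n i $ k - Y0 i $ k\<bar>"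
          by (simp add: abs_mult[symmetric] add_mono) 
        also have "\<dots> \<le> ?a * ?a + ?a * ?b + ?b * ?a"
          using a0 by (intro add_mono mult_mono a b) auto
        also have "\<dots> = (d n)\<^sup>2 * (\<gamma> i)\<^sup>2 + d n * (2 * \<gamma> i * ?b)" by (simp add: power2_eq_square algebra_simps)
        also have "\<dots> \<le> (d n)\<^sup>2 * (\<gamma> i)\<^sup>2 + d n * ((\<gamma> i)\<^sup>2 + ?b\<^sup>2)"
          by (intro add_left_mono mult_left_mono d sum_squares_bound)
        finally show "norm (Y n i $ j * Y n i $ k - Y0 i $ j * Y0 i $ k) \<le> (d n + (d n)\<^sup>2) * (\<gamma> i)\<^sup>2 + d n * ?b\<^sup>2"
          by (simp add: algebra_simps)
      qed
      also have "\<dots> = (d n + (d n)\<^sup>2) * sample_mean n (\<lambda>i. (\<gamma> i)\<^sup>2) + d n * sample_mean n (\<lambda>i. (norm (Y0 i))\<^sup>2)"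
        by (rule lin)
      also have "\<dots> \<le> (d n + (d n)\<^sup>2) * B + d n * B'"
        using B[of n] B'[of n] d(2)[of n] by (intro add_mono mult_left_mono) auto
      finally show "norm (sample_mean n (\<lambda>i. Y n i $ j * Y n i $ k) - sample_mean n (\<lambda>i. Y0 i $ j * Y0 i $ k))
        \<le> (d n + (d n)\<^sup>2) * B + d n * B'" .
    qed
    have "(\<lambda>n. (d n + (d n)\<^sup>2) * B + d n * B') \<longlonglongrightarrow> (0 + 0\<^sup>2) * B + 0 * B'" by (intro tendsto_intros d)
    then show "(\<lambda>n. (d n + (d n)\<^sup>2) * B + d n * B') \<longlonglongrightarrow> 0" by simp
  qed
  \<comment> \<open>Corrects the normalization \<open>1 / (n - 1)\<close> of the sample covariance
    against \<open>1 / n\<close>.\<close>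
  have ratio: "(\<lambda>n. real n / (real n - 1)) \<longlonglongrightarrow> 1"
  proof (rule Lim_transform_eventually)
    have "(\<lambda>n. inverse (1 - 1 / real n)) \<longlonglongrightarrow> inverse (1 - 0)"
      by (intro tendsto_intros lim_const_over_n) simp
    then show "(\<lambda>n. inverse (1 - 1 / real n)) \<longlonglongrightarrow> 1" by simp
    show "\<forall>\<^sub>F n in sequentially. inverse (1 - 1 / real n) = real n / (real n - 1)"
      using eventually_gt_at_top[of 1] by eventually_elim (auto simp: field_simps)
  qed
  have cov: "sample_covariance n Z $ j $ k
      = real n / (real n - 1) * (sample_mean n (\<lambda>i. Z i $ j * Z i $ k) - sample_mean n Z $ j * sample_mean n Z $ k)"
    if n: "n \<ge> 1" for n j k and Z :: "nat \<Rightarrow> real^'q"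
  proof -
    have nz: "real n \<noteq> 0" using n by simp
    let ?m = "sample_mean n Z"
    have sj: "(\<Sum>i=1..n. Z i $ j) = real n * ?m $ j" for j
      using nz by (simp add: sample_mean_def)
    have "(\<Sum>i=1..n. (Z i $ j - ?m $ j) * (Z i $ k - ?m $ k))
        = (\<Sum>i=1..n. Z i $ j * Z i $ k) - (\<Sum>i=1..n. Z i $ j) * ?m $ k - ?m $ j * (\<Sum>i=1..n. Z i $ k) + real n * (?m $ j * ?m $ k)"
      by (simp add: algebra_simps sum.distrib sum_subtractf sum_distrib_left sum_distrib_right)
    also have "\<dots> = (\<Sum>i=1..n. Z i $ j * Z i $ k) - real n * (?m $ j * ?m $ k)"
      unfolding sj by (simp add: algebra_simps)
    also have "\<dots> = real n * (sample_mean n (\<lambda>i. Z i $ j * Z i $ k) - ?m $ j * ?m $ k)"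
      using nz by (simp add: sample_mean_def[of n "\<lambda>i. Z i $ j * Z i $ k"] algebra_simps)
    finally show ?thesis by (simp add: sample_covariance_def)
  qed
  show ?thesis
  proof (intro vec_tendstoI)
    fix j k
    have "(\<lambda>n. real n / (real n - 1) * (sample_mean n (\<lambda>i. Y n i $ j * Y n i $ k) - sample_mean n (Y n) $ j * sample_mean n (Y n) $ k))
        \<longlonglongrightarrow> 1 * (s j k - m $ j * m $ k)"
      by (intro tendsto_intros ratio prod mean)
    moreover have "\<forall>\<^sub>F n in sequentially. real n / (real n - 1) * (sample_mean n (\<lambda>i. Y n i $ j * Y n i $ k) - sample_mean n (Y n) $ j * sample_mean n (Y n) $ k)
        = sample_covariance n (Y n) $ j $ k"
      using eventually_ge_at_top[of 1] by eventually_elim (simp add: cov)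
    ultimately have "(\<lambda>n. sample_covariance n (Y n) $ j $ k) \<longlonglongrightarrow> 1 * (s j k - m $ j * m $ k)"
      by (rule Lim_transform_eventually)
    then show "(\<lambda>n. sample_covariance n (Y n) $ j $ k) \<longlonglongrightarrow> (\<chi> j k. s j k - m $ j * m $ k) $ j $ k" by simp
  qed
qed

section \<open>Sampling a smooth random function\<close>

lemma filterlim_inverse_Suc_at_right: "filterlim (\<lambda>k. 1 / real (Suc k)) (at_right 0) sequentially"
  unfolding filterlim_at
proof
  show "\<forall>\<^sub>F k in sequentially. 1 / real (Suc k) \<in> {0<..} \<and> 1 / real (Suc k) \<noteq> 0" by simp
  show "(\<lambda>k. 1 / real (Suc k)) \<longlonglongrightarrow> 0" by (rule LIMSEQ_Suc[OF lim_1_over_n])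
qed

lemma bounded_linear_matrix_vector_mult_left:
  "bounded_linear (\<lambda>A :: real^'n^'m. A *v h)"
proof (rule bounded_linear_intro)
  show "norm (A *v h) \<le> norm A * norm h" for A :: "real^'n^'m" by (rule norm_matrix_vector_mult_le)
qed (simp_all add: matrix_vector_mult_add_rdistrib scaleR_matrix_vector_assoc)

lemma bounded_linear_sample_mean:
  assumes "bounded_linear T"
  shows "T (sample_mean n Y) = sample_mean n (\<lambda>i. T (Y i))"
proof -
  interpret bounded_linear T by fact
  show ?thesis by (simp add: sample_mean_def scaleR sum)
qed

lemma sample_mean_eq: "sample_mean n Y = (\<Sum>i<n. Y (Suc i)) /\<^sub>R real n"
  by (simp add: sample_mean_def sum.atLeast1_atMost_eq inverse_eq_divide)

text \<open>Smoothness in (b) is stated for almost every value of \<xi>, since such a statement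
  passes to each \<open>\<xi>s i\<close> through the common law even when the set of good values is
  not known to be measurable.\<close>

locale smooth_sampling = prob_space M for M :: "'w measure" +
  fixes \<xi> :: "'w \<Rightarrow> real^'d" and \<xi>s :: "nat \<Rightarrow> 'w \<Rightarrow> real^'d" and \<Xi> :: "(real^'d) set"
    and D :: "(real^'q) set" and F :: "real^'q \<Rightarrow> real^'d \<Rightarrow> real^'q" and C :: "'w \<Rightarrow> real"
  assumes xi: "\<xi> \<in> borel_measurable M" "closed \<Xi>" "AE \<omega> in M. \<xi> \<omega> \<in> \<Xi>"
    and D: "open D"
    and F_meas: "(\<lambda>(y, e). F y e) \<in> borel_measurable (restrict_space borel (D \<times> \<Xi>))"
    and F_int: "\<And>y. y \<in> D \<Longrightarrow> integrable M (\<lambda>\<omega>. F y (\<xi> \<omega>))"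
    and iid: "indep_vars (\<lambda>_. borel) \<xi>s {1..}"
      "\<And>i. i \<ge> 1 \<Longrightarrow> distr M borel (\<xi>s i) = distr M borel \<xi>"
    and a: "\<And>y. y \<in> D \<Longrightarrow> (\<integral>\<^sup>+\<omega>. ennreal ((norm (F y (\<xi> \<omega>)))\<^sup>2) \<partial>M) < \<infinity>"
    and b: "AE e in distr M borel \<xi>. C1_on D (\<lambda>y. F y e)"
      "\<And>y. y \<in> D \<Longrightarrow>
         (\<integral>\<^sup>+\<omega>. ennreal ((norm (jacobian (\<lambda>u. F u (\<xi> \<omega>)) (at y)))\<^sup>2) \<partial>M) < \<infinity>"
    and c: "C \<in> borel_measurable M" "integrable M (\<lambda>\<omega>. (C \<omega>)\<^sup>2)"
      "AE \<omega> in M. \<forall>y\<in>D. \<forall>y'\<in>D.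
         norm (F y (\<xi> \<omega>) - F y' (\<xi> \<omega>)) +
         norm (jacobian (\<lambda>u. F u (\<xi> \<omega>)) (at y) - jacobian (\<lambda>u. F u (\<xi> \<omega>)) (at y'))
         \<le> C \<omega> * norm (y - y')"
begin

text \<open>\<open>F\<close> is measurable on \<open>D \<times> \<Xi>\<close> only; \<open>Ft\<close> is its extension by zero, and \<open>Jt\<close> is a measurable
  function that agrees with the Jacobian where the latter exists.\<close>

definition Ft :: "real^'q \<Rightarrow> real^'d \<Rightarrow> real^'q" where
  "Ft y e = indicator (D \<times> \<Xi>) (y, e) *\<^sub>R F y e"

definition J :: "real^'q \<Rightarrow> real^'d \<Rightarrow> real^'q^'q" where
  "J y e = jacobian (\<lambda>u. F u e) (at y)"

definition Jt :: "real^'q \<Rightarrow> real^'d \<Rightarrow> real^'q^'q" where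
  "Jt y e = (\<chi> i j. lim (\<lambda>k. real (Suc k) * (Ft (y + (1 / real (Suc k)) *\<^sub>R axis j 1) e - Ft y e) $ i))"

text \<open>A property of the value \<open>e\<close> alone, so that it holds almost surely at all
  sample points at once.\<close>

definition regular_point :: "(real^'d \<Rightarrow> real) \<Rightarrow> real^'d \<Rightarrow> bool" where
  "regular_point c e \<longleftrightarrow> e \<in> \<Xi> \<and> (\<forall>y\<in>D. (\<lambda>u. F u e) differentiable (at y)) \<and>
    (\<forall>y\<in>D. \<forall>y'\<in>D. norm (F y e - F y' e) \<le> c e * norm (y - y') \<and> norm (J y e - J y' e) \<le> c e * norm (y - y'))"

lemma Ft_eq: "y \<in> D \<Longrightarrow> e \<in> \<Xi> \<Longrightarrow> Ft y e = F y e"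
  by (simp add: Ft_def)

text \<open>Measurability in both arguments jointly, as \<open>F\<close> is evaluated at random
  points such as \<open>x n \<omega>\<close>.\<close>

lemma Ft_measurable[measurable (raw)]:
  assumes "f \<in> borel_measurable N" "g \<in> borel_measurable N"
  shows "(\<lambda>\<omega>. Ft (f \<omega>) (g \<omega>)) \<in> borel_measurable N"
proof -
  have "D \<times> \<Xi> \<in> sets (borel \<Otimes>\<^sub>M borel)"
    by (intro pair_measureI borel_open borel_closed D xi)
  then have "D \<times> \<Xi> \<in> sets borel" by (simp only: borel_prod)
  then have "(\<lambda>p. indicator (D \<times> \<Xi>) p *\<^sub>R (case p of (y, e) \<Rightarrow> F y e)) \<in> borel_measurable borel"
    using F_meas by (subst (asm) borel_measurable_restrict_space_iff) auto
  from measurable_compose[OF borel_measurable_Pair[OF assms] this]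
  show ?thesis by (simp add: Ft_def)
qed

lemma Jt_measurable[measurable]: "Jt y \<in> borel_measurable borel"
  by (intro borel_measurable_vecI) (unfold Jt_def vec_lambda_beta, measurable)

text \<open>Columns of the Jacobian are limits of difference quotients along the axes; for large
  \<open>k\<close> openness of \<open>D\<close> keeps the shifted points where \<open>Ft\<close> and
  \<open>F\<close> agree.\<close>

lemma Jt_eq:
  assumes y: "y \<in> D" and e: "e \<in> \<Xi>" and diff: "(\<lambda>u. F u e) differentiable (at y)"
  shows "Jt y e = J y e"
  unfolding vec_eq_iff
proof (intro allI)
  fix i j
  let ?t = "\<lambda>k. 1 / real (Suc k)"
  have der: "((\<lambda>u. F u e) has_derivative (\<lambda>h. J y e *v h)) (at y)"
    using diff unfolding J_def jacobian_works .
  have "(\<lambda>k. (F (y + ?t k *\<^sub>R axis j 1) e - F y e) /\<^sub>R ?t k) \<longlonglongrightarrow> J y e *v axis j 1"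
    by (rule filterlim_compose[OF has_derivative_directional[OF der] filterlim_inverse_Suc_at_right])
  then have A: "(\<lambda>k. ((F (y + ?t k *\<^sub>R axis j 1) e - F y e) /\<^sub>R ?t k) $ i) \<longlonglongrightarrow> (J y e *v axis j 1) $ i"
    by (rule tendsto_vec_nth)
  have B: "(J y e *v axis j 1) $ i = J y e $ i $ j"
    by (simp add: matrix_vector_mult_basis column_def)
  have "\<forall>\<^sub>F k in sequentially. ((F (y + ?t k *\<^sub>R axis j 1) e - F y e) /\<^sub>R ?t k) $ i
      = real (Suc k) * (Ft (y + ?t k *\<^sub>R axis j 1) e - Ft y e) $ i"
  proof -
    have "(\<lambda>k. y + ?t k *\<^sub>R axis j 1) \<longlonglongrightarrow> y + 0 *\<^sub>R axis j 1"
      by (intro tendsto_intros LIMSEQ_Suc[OF lim_1_over_n])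
    then have "\<forall>\<^sub>F k in sequentially. y + ?t k *\<^sub>R axis j 1 \<in> D"
      using topological_tendstoD[OF _ D, of _ "y + 0 *\<^sub>R axis j 1"] y by simp
    then show ?thesis
      by eventually_elim (simp add: Ft_eq y e)
  qed
  from Lim_transform_eventually[OF A this]
  have "(\<lambda>k. real (Suc k) * (Ft (y + ?t k *\<^sub>R axis j 1) e - Ft y e) $ i) \<longlonglongrightarrow> J y e $ i $ j"
    unfolding B .
  then show "Jt y e $ i $ j = J y e $ i $ j" by (simp add: Jt_def limI)
qed

lemma AE_xi_regular: "AE e in distr M borel \<xi>. e \<in> \<Xi> \<and> C1_on D (\<lambda>y. F y e)"
proof -
  have "AE e in distr M borel \<xi>. e \<in> \<Xi>"
    by (subst AE_distr_iff) (use xi in \<open>auto intro: borel_closed\<close>)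
  then show ?thesis using b(1) by eventually_elim simp
qed

text \<open>Treating value and Jacobian as one map into a product gives a single modulus for both;
  domination by \<open>C\<close> makes it square integrable.\<close>

lemma ex_modulus:
  "\<exists>c\<in>borel_measurable borel. (\<forall>e. 0 \<le> c e) \<and> integrable M (\<lambda>\<omega>. (c (\<xi> \<omega>))\<^sup>2) \<and>
    (AE e in distr M borel \<xi>. regular_point c e)"
proof -
  note [measurable] = xi(1) c(1)
  let ?P = "\<lambda>y e. (Ft y e, Jt y e)"
  have C1: "?P y e = (F y e, J y e)" if "e \<in> \<Xi> \<and> C1_on D (\<lambda>y. F y e)" "y \<in> D" for y e
    using that by (auto simp: Ft_eq Jt_eq C1_on_def)
  have meas: "?P y \<in> borel_measurable borel" if "y \<in> D" for y by measurable
  have lip: "AE \<omega> in M. \<forall>y\<in>D. \<forall>y'\<in>D. norm (?P y (\<xi> \<omega>) - ?P y' (\<xi> \<omega>)) \<le> C \<omega> * norm (y - y')"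
    using AE_distrD[OF xi(1) AE_xi_regular] c(3)
  proof eventually_elim
    case (elim \<omega>)
    show ?case
    proof (intro ballI)
      fix y y' assume y: "y \<in> D" "y' \<in> D"
      have "norm (?P y (\<xi> \<omega>) - ?P y' (\<xi> \<omega>)) \<le> norm (F y (\<xi> \<omega>) - F y' (\<xi> \<omega>)) + norm (J y (\<xi> \<omega>) - J y' (\<xi> \<omega>))"
        unfolding C1[OF elim(1) y(1)] C1[OF elim(1) y(2)] diff_Pair by (rule norm_Pair_le)
      also have "\<dots> \<le> C \<omega> * norm (y - y')" using elim(2) y by (simp add: J_def)
      finally show "norm (?P y (\<xi> \<omega>) - ?P y' (\<xi> \<omega>)) \<le> C \<omega> * norm (y - y')" .
    qed
  qed
  obtain c where c': "c \<in> borel_measurable borel" "\<forall>e. 0 \<le> c e" "AE \<omega> in M. c (\<xi> \<omega>) \<le> \<bar>C \<omega>\<bar>"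
    "AE e in distr M borel \<xi>. continuous_on D (\<lambda>y. ?P y e) \<longrightarrow>
      (\<forall>y\<in>D. \<forall>y'\<in>D. norm (?P y e - ?P y' e) \<le> c e * norm (y - y'))"
    by (rule measurable_lipschitz_modulus[OF meas xi(1) lip])
  note [measurable] = c'(1)
  have "integrable M (\<lambda>\<omega>. (c (\<xi> \<omega>))\<^sup>2)"
  proof (rule Bochner_Integration.integrable_bound[OF c(2)])
    show "AE \<omega> in M. norm ((c (\<xi> \<omega>))\<^sup>2) \<le> norm ((C \<omega>)\<^sup>2)"
      using c'(3)
    proof eventually_elim
      case (elim \<omega>)
      then have "(c (\<xi> \<omega>))\<^sup>2 \<le> \<bar>C \<omega>\<bar>\<^sup>2" by (intro power_mono c'(2)[rule_format])
      then show ?case by simp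
    qed
  qed measurable
  moreover have "AE e in distr M borel \<xi>. regular_point c e"
    using c'(4) AE_xi_regular
  proof eventually_elim
    case (elim e)
    have diff: "(\<lambda>u. F u e) differentiable (at y)" if "y \<in> D" for y
      using elim(2) that by (auto simp: C1_on_def)
    have "continuous_on D (\<lambda>y. F y e)"
      by (intro differentiable_imp_continuous_on differentiable_at_imp_differentiable_on diff)
    moreover have "continuous_on D (\<lambda>y. J y e)" using elim(2) by (simp add: C1_on_def J_def)
    ultimately have "continuous_on D (\<lambda>y. (F y e, J y e))" by (rule continuous_on_Pair)
    then have "continuous_on D (\<lambda>y. ?P y e)"
      by (rule continuous_on_eq) (simp add: C1[OF elim(2)])
    then have l: "norm (?P y e - ?P y' e) \<le> c e * norm (y - y')" if "y \<in> D" "y' \<in> D" for y y'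
      using elim(1) that by blast
    have "norm (F y e - F y' e) \<le> c e * norm (y - y') \<and> norm (J y e - J y' e) \<le> c e * norm (y - y')"
      if y: "y \<in> D" "y' \<in> D" for y y'
    proof -
      have "norm (F y e - F y' e, J y e - J y' e) \<le> c e * norm (y - y')"
        using l[OF y] unfolding C1[OF elim(2) y(1)] C1[OF elim(2) y(2)] diff_Pair .
      then show ?thesis
        using norm_fst_le[of "F y e - F y' e" "J y e - J y' e"] norm_snd_le[of "J y e - J y' e" "F y e - F y' e"]
        by linarith
    qed
    then show ?case unfolding regular_point_def using diff elim(2) by blast
  qed
  ultimately show ?thesis using c'(1,2) by blast
qed

lemma xis_measurable[measurable]: "\<xi>s (Suc i) \<in> borel_measurable M"
  using iid(1) by (simp add: indep_vars_def)

lemma indep_xis: "indep_vars (\<lambda>_. borel) (\<lambda>i. \<xi>s (Suc i)) UNIV"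
  by (rule indep_vars_reindex_UNIV[OF iid(1)]) auto

lemma AE_xis:
  assumes "AE e in distr M borel \<xi>. P e"
  shows "AE \<omega> in M. \<forall>i\<ge>1. P (\<xi>s i \<omega>)"
proof -
  have "AE \<omega> in M. P (\<xi>s (Suc i) \<omega>)" for i
  proof -
    have eq: "distr M borel (\<xi>s (Suc i)) = distr M borel \<xi>" by (rule iid(2)) simp
    have "AE e in distr M borel (\<xi>s (Suc i)). P e" unfolding eq by (rule assms)
    then show ?thesis by (rule AE_distrD[OF xis_measurable])
  qed
  then have "AE \<omega> in M. \<forall>i. P (\<xi>s (Suc i) \<omega>)" by (simp add: AE_all_countable)
  then show ?thesis
  proof eventually_elim
    case (elim \<omega>)
    show ?case
    proof (intro allI impI)
      fix i :: nat assume "1 \<le> i"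
      then obtain j where "i = Suc j" by (cases i) auto
      then show "P (\<xi>s i \<omega>)" using elim by simp
    qed
  qed
qed

lemma sample_mean_slln:
  fixes h :: "real^'d \<Rightarrow> 'b::euclidean_space"
  assumes h: "h \<in> borel_measurable borel" and int: "integrable M (\<lambda>\<omega>. h (\<xi> \<omega>))"
  shows "AE \<omega> in M. (\<lambda>n. sample_mean n (\<lambda>i. h (\<xi>s i \<omega>))) \<longlonglongrightarrow> expectation (\<lambda>\<omega>. h (\<xi> \<omega>))"
  unfolding sample_mean_eq
  by (rule strong_law_euclidean[OF indep_xis _ xi(1) h int]) (simp add: iid)

lemma integrable_of_square:
  fixes f :: "'w \<Rightarrow> 'b::euclidean_space"
  assumes [measurable]: "f \<in> borel_measurable M" and "integrable M (\<lambda>\<omega>. (norm (f \<omega>))\<^sup>2)"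
  shows "integrable M f"
proof (rule Bochner_Integration.integrable_bound)
  show "integrable M (\<lambda>\<omega>. 1 + (norm (f \<omega>))\<^sup>2)" using assms(2) by simp
  show "AE \<omega> in M. norm (f \<omega>) \<le> norm (1 + (norm (f \<omega>))\<^sup>2)"
  proof (rule AE_I2)
    fix \<omega>
    have "2 * norm (f \<omega>) \<le> (norm (f \<omega>))\<^sup>2 + 1" using sum_squares_bound[of "norm (f \<omega>)" 1] by simp
    then have "norm (f \<omega>) \<le> 1 + (norm (f \<omega>))\<^sup>2"
      using zero_le_power2[of "norm (f \<omega>)"] by linarith
    then show "norm (f \<omega>) \<le> norm (1 + (norm (f \<omega>))\<^sup>2)" by simp
  qed
qed measurable

lemma Ft_xi:
  assumes y: "y \<in> D"
  shows "AE \<omega> in M. Ft y (\<xi> \<omega>) = F y (\<xi> \<omega>)" "integrable M (\<lambda>\<omega>. (norm (Ft y (\<xi> \<omega>)))\<^sup>2)"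
    "integrable M (\<lambda>\<omega>. Ft y (\<xi> \<omega>))" "expectation (\<lambda>\<omega>. Ft y (\<xi> \<omega>)) = expectation (\<lambda>\<omega>. F y (\<xi> \<omega>))"
proof -
  note [measurable] = xi(1)
  show eq: "AE \<omega> in M. Ft y (\<xi> \<omega>) = F y (\<xi> \<omega>)"
    using xi(3) by eventually_elim (simp add: Ft_eq y)
  have "(\<integral>\<^sup>+\<omega>. ennreal ((norm (Ft y (\<xi> \<omega>)))\<^sup>2) \<partial>M) = (\<integral>\<^sup>+\<omega>. ennreal ((norm (F y (\<xi> \<omega>)))\<^sup>2) \<partial>M)"
    by (rule nn_integral_cong_AE) (use eq in \<open>eventually_elim, simp\<close>)
  then show sq: "integrable M (\<lambda>\<omega>. (norm (Ft y (\<xi> \<omega>)))\<^sup>2)"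
    using a[OF y] by (intro integrableI_bounded) auto
  show "integrable M (\<lambda>\<omega>. Ft y (\<xi> \<omega>))" by (rule integrable_of_square[OF _ sq]) measurable
  show "expectation (\<lambda>\<omega>. Ft y (\<xi> \<omega>)) = expectation (\<lambda>\<omega>. F y (\<xi> \<omega>))"
    by (rule integral_cong_AE) (use eq F_int[OF y] in auto)
qed

lemma Jt_xi:
  assumes y: "y \<in> D"
  shows "AE \<omega> in M. Jt y (\<xi> \<omega>) = J y (\<xi> \<omega>)" "integrable M (\<lambda>\<omega>. Jt y (\<xi> \<omega>))"
proof -
  note [measurable] = xi(1)
  show eq: "AE \<omega> in M. Jt y (\<xi> \<omega>) = J y (\<xi> \<omega>)"
    using AE_distrD[OF xi(1) AE_xi_regular] by eventually_elim (auto simp: Jt_eq y C1_on_def)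
  have "(\<integral>\<^sup>+\<omega>. ennreal ((norm (Jt y (\<xi> \<omega>)))\<^sup>2) \<partial>M) = (\<integral>\<^sup>+\<omega>. ennreal ((norm (J y (\<xi> \<omega>)))\<^sup>2) \<partial>M)"
    by (rule nn_integral_cong_AE) (use eq in \<open>eventually_elim, simp\<close>)
  then have sq: "integrable M (\<lambda>\<omega>. (norm (Jt y (\<xi> \<omega>)))\<^sup>2)"
    using b(2)[OF y] by (intro integrableI_bounded) (auto simp: J_def)
  show "integrable M (\<lambda>\<omega>. Jt y (\<xi> \<omega>))" by (rule integrable_of_square[OF _ sq]) measurable
qed

text \<open>One sample path at a time: the mean of the moduli is a common Lipschitz constant on
  \<open>D\<close> for the sample average and its Jacobian. By the strong law these constants stay
  bounded almost surely.\<close>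

lemma sample_function:
  assumes e: "\<And>i. i \<ge> 1 \<Longrightarrow> regular_point c (e i)"
  defines "g \<equiv> \<lambda>n y. sample_mean n (\<lambda>i. F y (e i))" and "G \<equiv> \<lambda>n y. sample_mean n (\<lambda>i. J y (e i))"
    and "b \<equiv> \<lambda>n. sample_mean n (\<lambda>i. c (e i))"
  shows "y \<in> D \<Longrightarrow> (g n has_derivative (\<lambda>h. G n y *v h)) (at y)"
    and "(\<And>e. 0 \<le> c e) \<Longrightarrow> (b n)-lipschitz_on D (g n)"
    and "y \<in> D \<Longrightarrow> y' \<in> D \<Longrightarrow> norm (G n y *v h - G n y' *v h) \<le> b n * norm (y - y') * norm h"
proof -
  show "(g n has_derivative (\<lambda>h. G n y *v h)) (at y)" if y: "y \<in> D"
  proof -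
    have "((\<lambda>y. F y (e i)) has_derivative (\<lambda>h. J y (e i) *v h)) (at y)" if "i \<in> {1..n}" for i
      using e[of i] that y unfolding regular_point_def J_def jacobian_works by auto
    then have "((\<lambda>y. (1 / real n) *\<^sub>R (\<Sum>i=1..n. F y (e i))) has_derivative (\<lambda>h. (1 / real n) *\<^sub>R (\<Sum>i=1..n. J y (e i) *v h))) (at y)"
      by (intro has_derivative_scaleR_right has_derivative_sum)
    then show ?thesis
      unfolding g_def G_def bounded_linear_sample_mean[OF bounded_linear_matrix_vector_mult_left]
      by (simp add: sample_mean_def)
  qed
  have b_mult: "sample_mean n (\<lambda>i. c (e i) * t) = b n * t" for t
    by (simp add: b_def sample_mean_def sum_distrib_right[symmetric])
  show "(b n)-lipschitz_on D (g n)" if "\<And>e. 0 \<le> c e"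
  proof (rule lipschitz_onI)
    show "0 \<le> b n" using that by (simp add: b_def sample_mean_def sum_nonneg)
    show "dist (g n y) (g n y') \<le> b n * dist y y'" if "y \<in> D" "y' \<in> D" for y y'
      unfolding g_def dist_norm b_mult[symmetric]
      by (rule sample_mean_bound) (use e that in \<open>auto simp: regular_point_def\<close>)
  qed
  show "norm (G n y *v h - G n y' *v h) \<le> b n * norm (y - y') * norm h" if "y \<in> D" "y' \<in> D"
  proof -
    have "norm (G n y *v h - G n y' *v h) \<le> norm (G n y - G n y') * norm h"
      using norm_matrix_vector_mult_le[of "G n y - G n y'" h] by (simp add: matrix_vector_mult_diff_rdistrib)
    also have "norm (G n y - G n y') \<le> b n * norm (y - y')"
      unfolding G_def b_mult[symmetric]
      by (rule sample_mean_bound) (use e that in \<open>auto simp: regular_point_def\<close>)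
    finally show ?thesis by (simp add: mult_right_mono)
  qed
qed

text \<open>Differentiation under the expectation: almost every path has a quadratic remainder with
  the integrable constant \<open>c (\<xi> \<omega>)\<close>, and the mean of the remainders is again
  quadratic.\<close>

lemma expectation_has_derivative:
  assumes x0: "x0 \<in> D"
  shows "((\<lambda>y. expectation (\<lambda>\<omega>. F y (\<xi> \<omega>))) has_derivative (\<lambda>h. expectation (\<lambda>\<omega>. Jt x0 (\<xi> \<omega>)) *v h)) (at x0)"
proof -
  note [measurable] = xi(1)
  obtain c where c': "c \<in> borel_measurable borel" "\<forall>e. 0 \<le> c e" "integrable M (\<lambda>\<omega>. (c (\<xi> \<omega>))\<^sup>2)"
    "AE e in distr M borel \<xi>. regular_point c e"
    using ex_modulus by blast
  note [measurable] = c'(1)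
  have int_c: "integrable M (\<lambda>\<omega>. c (\<xi> \<omega>))"
    by (rule integrable_of_square) (use c'(3) in simp_all)
  obtain r where r: "r > 0" "ball x0 r \<subseteq> D" using D x0 open_contains_ball by blast
  have reg: "AE \<omega> in M. regular_point c (\<xi> \<omega>)" by (rule AE_distrD[OF xi(1) c'(4)])
  show ?thesis
  proof (rule has_derivative_quadraticI[OF _ r(1)])
    show "bounded_linear (\<lambda>h. expectation (\<lambda>\<omega>. Jt x0 (\<xi> \<omega>)) *v h)" by (rule matrix_vector_mul_bounded_linear)
    fix y assume y: "y \<in> ball x0 r"
    then have yD: "y \<in> D" using r(2) by blast
    let ?d = "\<lambda>\<omega>. F y (\<xi> \<omega>) - F x0 (\<xi> \<omega>) - Jt x0 (\<xi> \<omega>) *v (y - x0)"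
    have int_J: "integrable M (\<lambda>\<omega>. Jt x0 (\<xi> \<omega>) *v (y - x0))"
      "expectation (\<lambda>\<omega>. Jt x0 (\<xi> \<omega>) *v (y - x0)) = expectation (\<lambda>\<omega>. Jt x0 (\<xi> \<omega>)) *v (y - x0)"
      using integrable_bounded_linear[OF bounded_linear_matrix_vector_mult_left Jt_xi(2)[OF x0]]
        integral_bounded_linear[OF bounded_linear_matrix_vector_mult_left Jt_xi(2)[OF x0]] by auto
    have int_d: "integrable M ?d"
      by (intro Bochner_Integration.integrable_diff F_int int_J yD x0)
    have "expectation (\<lambda>\<omega>. F y (\<xi> \<omega>)) - expectation (\<lambda>\<omega>. F x0 (\<xi> \<omega>)) - expectation (\<lambda>\<omega>. Jt x0 (\<xi> \<omega>)) *v (y - x0) = expectation ?d"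
      using F_int[OF yD] F_int[OF x0] int_J by simp
    then have "norm (expectation (\<lambda>\<omega>. F y (\<xi> \<omega>)) - expectation (\<lambda>\<omega>. F x0 (\<xi> \<omega>)) - expectation (\<lambda>\<omega>. Jt x0 (\<xi> \<omega>)) *v (y - x0))
        \<le> expectation (\<lambda>\<omega>. norm (?d \<omega>))" by (simp add: integral_norm_bound)
    also have "\<dots> \<le> expectation (\<lambda>\<omega>. c (\<xi> \<omega>) * (norm (y - x0))\<^sup>2)"
    proof (rule integral_mono_AE)
      show "integrable M (\<lambda>\<omega>. norm (?d \<omega>))" by (rule integrable_norm[OF int_d])
      show "integrable M (\<lambda>\<omega>. c (\<xi> \<omega>) * (norm (y - x0))\<^sup>2)" using int_c by simp
      show "AE \<omega> in M. norm (?d \<omega>) \<le> c (\<xi> \<omega>) * (norm (y - x0))\<^sup>2"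
        using reg Jt_xi(1)[OF x0]
      proof eventually_elim
        case (elim \<omega>)
        have "norm (F y (\<xi> \<omega>) - F x0 (\<xi> \<omega>) - J x0 (\<xi> \<omega>) *v (y - x0)) \<le> c (\<xi> \<omega>) * (norm (y - x0))\<^sup>2"
        proof (rule quadratic_remainder_bound[OF convex_ball[of x0 r]])
          show "((\<lambda>y. F y (\<xi> \<omega>)) has_derivative (\<lambda>h. J u (\<xi> \<omega>) *v h)) (at u)" if "u \<in> ball x0 r" for u
            using elim(1) that r(2) unfolding regular_point_def J_def jacobian_works by blast
          show "norm (J u (\<xi> \<omega>) *v h - J v (\<xi> \<omega>) *v h) \<le> c (\<xi> \<omega>) * norm (u - v) * norm h"
            if "u \<in> ball x0 r" "v \<in> ball x0 r" for u v h
          proof -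
            have "norm (J u (\<xi> \<omega>) *v h - J v (\<xi> \<omega>) *v h) \<le> norm (J u (\<xi> \<omega>) - J v (\<xi> \<omega>)) * norm h"
              using norm_matrix_vector_mult_le[of "J u (\<xi> \<omega>) - J v (\<xi> \<omega>)" h] by (simp add: matrix_vector_mult_diff_rdistrib)
            also have "norm (J u (\<xi> \<omega>) - J v (\<xi> \<omega>)) \<le> c (\<xi> \<omega>) * norm (u - v)"
              using elim(1) that r(2) unfolding regular_point_def by blast
            finally show ?thesis by (simp add: mult_right_mono)
          qed
        qed (use c'(2) y r in auto)
        then show ?case by (simp add: elim(2))
      qed
    qed
    also have "\<dots> = expectation (\<lambda>\<omega>. c (\<xi> \<omega>)) * (norm (y - x0))\<^sup>2" by simp
    finally show "norm (expectation (\<lambda>\<omega>. F y (\<xi> \<omega>)) - expectation (\<lambda>\<omega>. F x0 (\<xi> \<omega>)) - expectation (\<lambda>\<omega>. Jt x0 (\<xi> \<omega>)) *v (y - x0))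
        \<le> expectation (\<lambda>\<omega>. c (\<xi> \<omega>)) * (norm (y - x0))\<^sup>2" .
  qed
qed

end

lemma sample_mean_cong:
  assumes "\<And>i. 1 \<le> i \<Longrightarrow> Y i = Y' i"
  shows "sample_mean n Y = sample_mean n Y'"
  using assms by (simp add: sample_mean_def)

lemma sample_covariance_cong:
  assumes "\<And>i. 1 \<le> i \<Longrightarrow> Y i = Y' i"
  shows "sample_covariance n Y = sample_covariance n Y'"
  using assms sample_mean_cong[of Y Y' n] by (simp add: sample_covariance_def)

context smooth_sampling
begin

definition centered :: "real^'q \<Rightarrow> real^'d \<Rightarrow> real^'q" where
  "centered x0 e = Ft x0 e - expectation (\<lambda>\<omega>. Ft x0 (\<xi> \<omega>))"

lemma centered_measurable[measurable]: "centered x0 \<in> borel_measurable borel"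
  unfolding centered_def by measurable

lemma centered_xi:
  assumes x0: "x0 \<in> D"
  shows "integrable M (\<lambda>\<omega>. (norm (centered x0 (\<xi> \<omega>)))\<^sup>2)" "integrable M (\<lambda>\<omega>. inner u (centered x0 (\<xi> \<omega>)))"
    "expectation (\<lambda>\<omega>. inner u (centered x0 (\<xi> \<omega>))) = 0"
    "integrable M (\<lambda>\<omega>. inner u (centered x0 (\<xi> \<omega>)) * inner v (centered x0 (\<xi> \<omega>)))"
proof -
  note [measurable] = xi(1)
  define m where "m = expectation (\<lambda>\<omega>. Ft x0 (\<xi> \<omega>))"
  have c: "centered x0 e = Ft x0 e - m" for e by (simp add: centered_def m_def)
  have int1: "integrable M (\<lambda>\<omega>. centered x0 (\<xi> \<omega>))"
    unfolding c using Ft_xi(3)[OF x0] by simp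
  show "integrable M (\<lambda>\<omega>. inner u (centered x0 (\<xi> \<omega>)))"
    using int1 by simp
  have "expectation (\<lambda>\<omega>. centered x0 (\<xi> \<omega>)) = 0"
    unfolding c using Ft_xi(3)[OF x0] by (simp add: prob_space m_def)
  then show "expectation (\<lambda>\<omega>. inner u (centered x0 (\<xi> \<omega>))) = 0"
    using integral_inner_right[of u M "\<lambda>\<omega>. centered x0 (\<xi> \<omega>)"] int1 by simp
  show sq: "integrable M (\<lambda>\<omega>. (norm (centered x0 (\<xi> \<omega>)))\<^sup>2)"
  proof (rule Bochner_Integration.integrable_bound)
    show "integrable M (\<lambda>\<omega>. 2 * (norm (Ft x0 (\<xi> \<omega>)))\<^sup>2 + 2 * (norm m)\<^sup>2)"
      using Ft_xi(2)[OF x0] by simp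
    show "AE \<omega> in M. norm ((norm (centered x0 (\<xi> \<omega>)))\<^sup>2) \<le> norm (2 * (norm (Ft x0 (\<xi> \<omega>)))\<^sup>2 + 2 * (norm m)\<^sup>2)"
    proof (rule AE_I2)
      fix \<omega>
      let ?a = "norm (Ft x0 (\<xi> \<omega>))" and ?b = "norm m"
      have "norm (centered x0 (\<xi> \<omega>)) \<le> ?a + ?b" unfolding c by (rule norm_triangle_ineq4)
      then have "(norm (centered x0 (\<xi> \<omega>)))\<^sup>2 \<le> (?a + ?b)\<^sup>2" by (rule power_mono) simp
      also have "\<dots> \<le> 2 * ?a\<^sup>2 + 2 * ?b\<^sup>2"
        using sum_squares_bound[of ?a ?b] by (simp add: power2_sum)
      finally show "norm ((norm (centered x0 (\<xi> \<omega>)))\<^sup>2) \<le> norm (2 * ?a\<^sup>2 + 2 * ?b\<^sup>2)" by simp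
    qed
  qed measurable
  show "integrable M (\<lambda>\<omega>. inner u (centered x0 (\<xi> \<omega>)) * inner v (centered x0 (\<xi> \<omega>)))"
    by (rule integrable_inner_mult[OF _ sq]) measurable
qed

text \<open>The covariance matrix as a bilinear form. Its nonnegativity, its kernel and the
  orthonormality required by the central limit theorem are read off from the right side.\<close>

lemma inner_covariance_matrix:
  assumes x0: "x0 \<in> D"
  shows "inner u (covariance_matrix M (\<lambda>\<omega>. F x0 (\<xi> \<omega>)) *v v)
    = expectation (\<lambda>\<omega>. inner u (centered x0 (\<xi> \<omega>)) * inner v (centered x0 (\<xi> \<omega>)))"
proof -
  note [measurable] = xi(1)
  let ?y = "\<lambda>\<omega>. centered x0 (\<xi> \<omega>)"
  have int: "integrable M (\<lambda>\<omega>. ?y \<omega> $ i * ?y \<omega> $ j)" for i j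
    using centered_xi(4)[OF x0, of "axis i 1" "axis j 1"] by (simp add: inner_axis')
  have comp: "(LINT \<omega>|M. F x0 (\<xi> \<omega>) $ i) = expectation (\<lambda>\<omega>. Ft x0 (\<xi> \<omega>)) $ i" for i
    unfolding Ft_xi(4)[OF x0]
    using integral_bounded_linear[OF bounded_linear_vec_nth F_int[OF x0], of i] by simp
  have entry: "covariance_matrix M (\<lambda>\<omega>. F x0 (\<xi> \<omega>)) $ i $ j = expectation (\<lambda>\<omega>. ?y \<omega> $ i * ?y \<omega> $ j)" for i j
  proof -
    have [measurable]: "(\<lambda>\<omega>. F x0 (\<xi> \<omega>)) \<in> borel_measurable M" using F_int[OF x0] by simp
    have "expectation (\<lambda>\<omega>. (F x0 (\<xi> \<omega>) $ i - (LINT \<omega>|M. F x0 (\<xi> \<omega>) $ i)) * (F x0 (\<xi> \<omega>) $ j - (LINT \<omega>|M. F x0 (\<xi> \<omega>) $ j)))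
      = expectation (\<lambda>\<omega>. ?y \<omega> $ i * ?y \<omega> $ j)"
    proof (rule integral_cong_AE)
      show "AE \<omega> in M. (F x0 (\<xi> \<omega>) $ i - (LINT \<omega>|M. F x0 (\<xi> \<omega>) $ i)) * (F x0 (\<xi> \<omega>) $ j - (LINT \<omega>|M. F x0 (\<xi> \<omega>) $ j))
          = ?y \<omega> $ i * ?y \<omega> $ j"
        using Ft_xi(1)[OF x0] by eventually_elim (simp add: comp centered_def)
    qed measurable
    then show ?thesis by (simp add: covariance_matrix_def)
  qed
  have "inner u (covariance_matrix M (\<lambda>\<omega>. F x0 (\<xi> \<omega>)) *v v)
      = (\<Sum>i\<in>UNIV. \<Sum>j\<in>UNIV. u $ i * v $ j * expectation (\<lambda>\<omega>. ?y \<omega> $ i * ?y \<omega> $ j))"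
    by (simp add: inner_vec_def matrix_vector_mult_def entry sum_distrib_left mult_ac)
  also have "\<dots> = expectation (\<lambda>\<omega>. \<Sum>i\<in>UNIV. \<Sum>j\<in>UNIV. u $ i * v $ j * (?y \<omega> $ i * ?y \<omega> $ j))"
    by (simp add: int)
  also have "\<dots> = expectation (\<lambda>\<omega>. inner u (?y \<omega>) * inner v (?y \<omega>))"
  proof (rule Bochner_Integration.integral_cong[OF refl])
    fix \<omega>
    show "(\<Sum>i\<in>UNIV. \<Sum>j\<in>UNIV. u $ i * v $ j * (?y \<omega> $ i * ?y \<omega> $ j)) = inner u (?y \<omega>) * inner v (?y \<omega>)"
      unfolding inner_vec_def sum_product by (intro sum.cong refl) (simp add: mult_ac)
  qed
  finally show ?thesis .
qed

text \<open>Strong laws for the values at \<open>x0\<close>, their products, the squared modulus and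
  the squared norm feed the comparison of rows with rate
  \<open>norm (x n \<omega> - x0)\<close>.\<close>

lemma sample_covariance_conv:
  assumes x0: "x0 \<in> D" and xD: "AE \<omega> in M. \<forall>n. x n \<omega> \<in> D" and xc: "AE \<omega> in M. (\<lambda>n. x n \<omega>) \<longlonglongrightarrow> x0"
  shows "AE \<omega> in M. (\<lambda>n. sample_covariance n (\<lambda>i. F (x n \<omega>) (\<xi>s i \<omega>))) \<longlonglongrightarrow> covariance_matrix M (\<lambda>\<omega>. F x0 (\<xi> \<omega>))"
proof -
  note [measurable] = xi(1)
  obtain c where c': "c \<in> borel_measurable borel" "\<forall>e. 0 \<le> c e" "integrable M (\<lambda>\<omega>. (c (\<xi> \<omega>))\<^sup>2)"
    "AE e in distr M borel \<xi>. regular_point c e"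
    using ex_modulus by blast
  note [measurable] = c'(1)
  define m where "m = expectation (\<lambda>\<omega>. Ft x0 (\<xi> \<omega>))"
  have int2: "integrable M (\<lambda>\<omega>. Ft x0 (\<xi> \<omega>) $ j * Ft x0 (\<xi> \<omega>) $ k)" for j k
    using integrable_inner_mult[OF _ Ft_xi(2)[OF x0], of "axis j 1" "axis k 1"] by (simp add: inner_axis')
  have cov: "covariance_matrix M (\<lambda>\<omega>. F x0 (\<xi> \<omega>)) = (\<chi> j k. expectation (\<lambda>\<omega>. Ft x0 (\<xi> \<omega>) $ j * Ft x0 (\<xi> \<omega>) $ k) - m $ j * m $ k)"
  proof -
    have mj: "expectation (\<lambda>\<omega>. Ft x0 (\<xi> \<omega>) $ j) = m $ j" "integrable M (\<lambda>\<omega>. Ft x0 (\<xi> \<omega>) $ j)" for j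
      using integral_bounded_linear[OF bounded_linear_vec_nth Ft_xi(3)[OF x0], of j]
        integrable_bounded_linear[OF bounded_linear_vec_nth Ft_xi(3)[OF x0], of j] by (auto simp: m_def)
    have "covariance_matrix M (\<lambda>\<omega>. F x0 (\<xi> \<omega>)) $ j $ k = expectation (\<lambda>\<omega>. Ft x0 (\<xi> \<omega>) $ j * Ft x0 (\<xi> \<omega>) $ k) - m $ j * m $ k" for j k
    proof -
      have "covariance_matrix M (\<lambda>\<omega>. F x0 (\<xi> \<omega>)) $ j $ k = inner (axis j 1) (covariance_matrix M (\<lambda>\<omega>. F x0 (\<xi> \<omega>)) *v axis k 1)"
        by (simp add: inner_axis' matrix_vector_mult_basis column_def)
      also have "\<dots> = expectation (\<lambda>\<omega>. (Ft x0 (\<xi> \<omega>) $ j - m $ j) * (Ft x0 (\<xi> \<omega>) $ k - m $ k))"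
        unfolding inner_covariance_matrix[OF x0] by (simp add: inner_axis' centered_def m_def)
      also have "\<dots> = expectation (\<lambda>\<omega>. Ft x0 (\<xi> \<omega>) $ j * Ft x0 (\<xi> \<omega>) $ k - m $ k * Ft x0 (\<xi> \<omega>) $ j - m $ j * Ft x0 (\<xi> \<omega>) $ k + m $ j * m $ k)"
        by (simp add: algebra_simps)
      also have "\<dots> = expectation (\<lambda>\<omega>. Ft x0 (\<xi> \<omega>) $ j * Ft x0 (\<xi> \<omega>) $ k) - m $ k * m $ j - m $ j * m $ k + m $ j * m $ k"
        using int2 mj by (simp add: prob_space)
      finally show ?thesis by simp
    qed
    then show ?thesis by (simp add: vec_eq_iff)
  qed
  have s1: "AE \<omega> in M. (\<lambda>n. sample_mean n (\<lambda>i. Ft x0 (\<xi>s i \<omega>))) \<longlonglongrightarrow> m"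
    unfolding m_def by (rule sample_mean_slln) (auto intro: Ft_xi x0)
  have s2: "AE \<omega> in M. \<forall>j k. (\<lambda>n. sample_mean n (\<lambda>i. Ft x0 (\<xi>s i \<omega>) $ j * Ft x0 (\<xi>s i \<omega>) $ k)) \<longlonglongrightarrow> expectation (\<lambda>\<omega>. Ft x0 (\<xi> \<omega>) $ j * Ft x0 (\<xi> \<omega>) $ k)"
  proof -
    have "AE \<omega> in M. (\<lambda>n. sample_mean n (\<lambda>i. Ft x0 (\<xi>s i \<omega>) $ j * Ft x0 (\<xi>s i \<omega>) $ k)) \<longlonglongrightarrow> expectation (\<lambda>\<omega>. Ft x0 (\<xi> \<omega>) $ j * Ft x0 (\<xi> \<omega>) $ k)" for j k
      by (rule sample_mean_slln[of "\<lambda>e. Ft x0 e $ j * Ft x0 e $ k"]) (auto intro: int2)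
    then show ?thesis by (simp add: AE_all_countable)
  qed
  have s3: "AE \<omega> in M. (\<lambda>n. sample_mean n (\<lambda>i. (c (\<xi>s i \<omega>))\<^sup>2)) \<longlonglongrightarrow> expectation (\<lambda>\<omega>. (c (\<xi> \<omega>))\<^sup>2)"
    by (rule sample_mean_slln) (use c'(3) in auto)
  have s4: "AE \<omega> in M. (\<lambda>n. sample_mean n (\<lambda>i. (norm (Ft x0 (\<xi>s i \<omega>)))\<^sup>2)) \<longlonglongrightarrow> expectation (\<lambda>\<omega>. (norm (Ft x0 (\<xi> \<omega>)))\<^sup>2)"
    by (rule sample_mean_slln[of "\<lambda>e. (norm (Ft x0 e))\<^sup>2"]) (use Ft_xi(2)[OF x0] in auto)
  show ?thesis
    using s1 s2 s3 s4 AE_xis[OF c'(4)] xD xc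
  proof eventually_elim
    case (elim \<omega>)
    have eq: "Ft x0 (\<xi>s i \<omega>) = F x0 (\<xi>s i \<omega>)" if "1 \<le> i" for i
      using elim(5) that x0 by (auto simp: regular_point_def Ft_eq)
    show ?case unfolding cov
    proof (rule sample_covariance_tendsto[where ?Y0.0 = "\<lambda>i. Ft x0 (\<xi>s i \<omega>)" and \<gamma> = "\<lambda>i. c (\<xi>s i \<omega>)" and d = "\<lambda>n. norm (x n \<omega> - x0)"])
      show "norm (F (x n \<omega>) (\<xi>s i \<omega>) - Ft x0 (\<xi>s i \<omega>)) \<le> norm (x n \<omega> - x0) * c (\<xi>s i \<omega>)" if "1 \<le> i" for n i
      proof -
        have "regular_point c (\<xi>s i \<omega>)" "x n \<omega> \<in> D" using elim(5,6) that by auto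
        then have "norm (F (x n \<omega>) (\<xi>s i \<omega>) - F x0 (\<xi>s i \<omega>)) \<le> c (\<xi>s i \<omega>) * norm (x n \<omega> - x0)"
          using x0 unfolding regular_point_def by blast
        then show ?thesis by (simp add: eq[OF that] mult.commute)
      qed
      show "(\<lambda>n. norm (x n \<omega> - x0)) \<longlonglongrightarrow> 0" using elim(7) by (simp add: LIM_zero tendsto_norm_zero)
      show "Bseq (\<lambda>n. sample_mean n (\<lambda>i. (c (\<xi>s i \<omega>))\<^sup>2))" by (rule convergent_imp_Bseq[OF convergentI[OF elim(3)]])
      show "Bseq (\<lambda>n. sample_mean n (\<lambda>i. (norm (Ft x0 (\<xi>s i \<omega>)))\<^sup>2))" by (rule convergent_imp_Bseq[OF convergentI[OF elim(4)]])
      show "(\<lambda>n. sample_mean n (\<lambda>i. Ft x0 (\<xi>s i \<omega>))) \<longlonglongrightarrow> m" by (rule elim(1))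
      show "(\<lambda>n. sample_mean n (\<lambda>i. Ft x0 (\<xi>s i \<omega>) $ j * Ft x0 (\<xi>s i \<omega>) $ k)) \<longlonglongrightarrow> expectation (\<lambda>\<omega>. Ft x0 (\<xi> \<omega>) $ j * Ft x0 (\<xi> \<omega>) $ k)" for j k
        using elim(2) by blast
    qed simp
  qed
qed

text \<open>The \<open>g\<^sub>n\<close> of the overview, built from \<open>Ft\<close> to be
  measurable. For \<open>n > 0\<close> it is almost surely the sample mean at \<open>x0\<close>
  minus its expectation; for \<open>n = 0\<close> it is 0.\<close>

definition centered_mean :: "real^'q \<Rightarrow> nat \<Rightarrow> 'w \<Rightarrow> real^'q" where
  "centered_mean x0 n \<omega> = (\<Sum>i<n. centered x0 (\<xi>s (Suc i) \<omega>)) /\<^sub>R real n"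

lemma centered_mean_measurable[measurable]: "centered_mean x0 n \<in> borel_measurable M"
  unfolding centered_mean_def by measurable

lemma centered_mean_eq:
  assumes "0 < n" and "\<And>i. 1 \<le> i \<Longrightarrow> Ft x0 (\<xi>s i \<omega>) = F x0 (\<xi>s i \<omega>)"
  shows "centered_mean x0 n \<omega> = sample_mean n (\<lambda>i. F x0 (\<xi>s i \<omega>)) - expectation (\<lambda>\<omega>. Ft x0 (\<xi> \<omega>))"
  using assms by (simp add: centered_mean_def centered_def sample_mean_eq sum_subtractf scaleR_diff_right sum_constant_scaleR del: sum_constant)

lemma xis_transfer:
  fixes h :: "real^'d \<Rightarrow> real"
  assumes [measurable]: "h \<in> borel_measurable borel"
  shows "integrable M (\<lambda>\<omega>. h (\<xi>s (Suc i) \<omega>)) \<longleftrightarrow> integrable M (\<lambda>\<omega>. h (\<xi> \<omega>))"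
    "expectation (\<lambda>\<omega>. h (\<xi>s (Suc i) \<omega>)) = expectation (\<lambda>\<omega>. h (\<xi> \<omega>))"
proof -
  note [measurable] = xi(1)
  have eq: "distr M borel (\<xi>s (Suc i)) = distr M borel \<xi>" by (rule iid(2)) simp
  show "integrable M (\<lambda>\<omega>. h (\<xi>s (Suc i) \<omega>)) \<longleftrightarrow> integrable M (\<lambda>\<omega>. h (\<xi> \<omega>))"
    "expectation (\<lambda>\<omega>. h (\<xi>s (Suc i) \<omega>)) = expectation (\<lambda>\<omega>. h (\<xi> \<omega>))"
    by (rule identically_distributed_transfer[OF eq]; measurable)+
qed

lemma centered_indep: "indep_vars (\<lambda>_. borel) (\<lambda>i \<omega>. centered x0 (\<xi>s (Suc i) \<omega>)) UNIV"
  by (rule indep_vars_compose2[OF indep_xis]) measurable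

text \<open>The random variable is the squared norm of the sum divided by \<open>n\<close>, so
  independence gives the variance; the inequality accounts for \<open>n = 0\<close>.\<close>

lemma centered_mean_second_moment:
  assumes x0: "x0 \<in> D"
  shows "integrable M (\<lambda>\<omega>. real n * (norm (centered_mean x0 n \<omega>))\<^sup>2)"
    "expectation (\<lambda>\<omega>. real n * (norm (centered_mean x0 n \<omega>))\<^sup>2) \<le> expectation (\<lambda>\<omega>. (norm (centered x0 (\<xi> \<omega>)))\<^sup>2)"
proof -
  let ?v = "expectation (\<lambda>\<omega>. (norm (centered x0 (\<xi> \<omega>)))\<^sup>2)"
  have t: "integrable M (\<lambda>\<omega>. (norm (centered x0 (\<xi>s (Suc i) \<omega>)))\<^sup>2)"
    "expectation (\<lambda>\<omega>. (norm (centered x0 (\<xi>s (Suc i) \<omega>)))\<^sup>2) = ?v"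
    "integrable M (\<lambda>\<omega>. inner (centered x0 (\<xi>s (Suc i) \<omega>)) u)"
    "expectation (\<lambda>\<omega>. inner (centered x0 (\<xi>s (Suc i) \<omega>)) u) = 0" for i u
    using xis_transfer[of "\<lambda>e. (norm (centered x0 e))\<^sup>2" i] xis_transfer[of "\<lambda>e. inner (centered x0 e) u" i]
      centered_xi(1)[OF x0] centered_xi(2)[OF x0, of u] centered_xi(3)[OF x0, of u] by (simp_all add: inner_commute)
  note sm = second_moment_sum_indep[OF centered_indep t(1,2,3,4), of n]
  have eq: "real n * (norm (centered_mean x0 n \<omega>))\<^sup>2 = (norm (\<Sum>i<n. centered x0 (\<xi>s (Suc i) \<omega>)))\<^sup>2 / real n" for \<omega>
    by (cases "n = 0") (auto simp: centered_mean_def power_mult_distrib power2_eq_square field_simps)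
  show "integrable M (\<lambda>\<omega>. real n * (norm (centered_mean x0 n \<omega>))\<^sup>2)"
    unfolding eq using sm(1) by simp
  have "0 \<le> ?v" by (rule Bochner_Integration.integral_nonneg) simp
  then show "expectation (\<lambda>\<omega>. real n * (norm (centered_mean x0 n \<omega>))\<^sup>2) \<le> ?v"
    unfolding eq using sm(2) by (cases "n = 0") auto
qed

text \<open>Whitening: the eigenvectors with positive eigenvalue, divided by the square roots of
  their eigenvalues, are orthonormal for the covariance form, and the pseudo-inverse gives the sum
  of the squares of these coordinates.\<close>

lemma centered_mean_quadratic_weak_limit:
  assumes x0: "x0 \<in> D" and V: "orthogonal_matrix V"
    and \<Sigma>: "covariance_matrix M (\<lambda>\<omega>. F x0 (\<xi> \<omega>)) = spectral_matrix V e"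
  shows "weak_conv_m (\<lambda>n. distr M borel (\<lambda>\<omega>. real n * inner (centered_mean x0 n \<omega>)
      (spectral_matrix V (\<lambda>k. if 0 < e k then 1 / e k else 0) *v centered_mean x0 n \<omega>))) (chi_square (card {k. 0 < e k}))"
proof -
  let ?l = "card {k. 0 < e k}"
  obtain h where "bij_betw h {0..<?l} {k. 0 < e k}" using ex_bij_betw_nat_finite[of "{k. 0 < e k}"] by auto
  then have h: "bij_betw h {..<?l} {k. 0 < e k}" by (simp add: lessThan_atLeast0)
  have he: "0 < e (h j)" if "j < ?l" for j using bij_betwE[OF h] that by auto
  define a where "a j = V $ h j /\<^sub>R sqrt (e (h j))" for j
  let ?Y = "\<lambda>i \<omega>. centered x0 (\<xi>s (Suc i) \<omega>)"
  have lim: "weak_conv_m (\<lambda>n. distr M borel (\<lambda>\<omega>. \<Sum>k<?l. (inner (a k) (\<Sum>i<n. ?Y i \<omega>) / sqrt (real n))\<^sup>2)) (chi_square ?l)"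
  proof (rule clt_sum_of_squares[OF centered_indep])
    have "distr M borel (?Y i) = distr (distr M borel (\<xi>s (Suc i))) borel (centered x0)" for i
      by (subst distr_distr) (auto simp: comp_def)
    moreover have "distr M borel (\<xi>s (Suc i)) = distr M borel \<xi>" for i by (rule iid(2)) simp
    ultimately show "distr M borel (?Y i) = distr M borel (?Y 0)" for i by simp
    show "integrable M (\<lambda>\<omega>. (norm (?Y 0 \<omega>))\<^sup>2)"
      using xis_transfer(1)[of "\<lambda>e. (norm (centered x0 e))\<^sup>2" 0] centered_xi(1)[OF x0] by simp
    show "expectation (\<lambda>\<omega>. inner u (?Y 0 \<omega>)) = 0" for u
      using xis_transfer(2)[of "\<lambda>e. inner u (centered x0 e)" 0] centered_xi(3)[OF x0] by simp
    show "expectation (\<lambda>\<omega>. inner (a j) (?Y 0 \<omega>) * inner (a k) (?Y 0 \<omega>)) = (if j = k then 1 else 0)"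
      if j: "j < ?l" and k: "k < ?l" for j k
    proof -
      have "expectation (\<lambda>\<omega>. inner (a j) (?Y 0 \<omega>) * inner (a k) (?Y 0 \<omega>)) = inner (a j) (spectral_matrix V e *v a k)"
        using xis_transfer(2)[of "\<lambda>e. inner (a j) (centered x0 e) * inner (a k) (centered x0 e)" 0]
        by (simp add: inner_covariance_matrix[OF x0, symmetric] \<Sigma>)
      also have "\<dots> = e (h k) / (sqrt (e (h j)) * sqrt (e (h k))) * inner (V $ h j) (V $ h k)"
        by (simp add: a_def matrix_vector_mult_scaleR spectral_matrix_eigenvalue(1)[OF V] divide_inverse mult_ac)
      also have "inner (V $ h j) (V $ h k) = (if h j = h k then 1 else 0)"
        using orthogonal_matrix_entries(2)[OF V, of "h j" "h k"] by (simp add: inner_vec_def)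
      also have "h j = h k \<longleftrightarrow> j = k"
        using h j k by (auto simp: bij_betw_def inj_on_def)
      finally show ?thesis using he[OF k] by auto
    qed
  qed
  have "real n * inner (centered_mean x0 n \<omega>) (spectral_matrix V (\<lambda>k. if 0 < e k then 1 / e k else 0) *v centered_mean x0 n \<omega>)
      = (\<Sum>k<?l. (inner (a k) (\<Sum>i<n. ?Y i \<omega>) / sqrt (real n))\<^sup>2)" for n \<omega>
  proof (cases "n = 0")
    case False
    let ?S = "\<Sum>i<n. ?Y i \<omega>"
    have "real n * inner (centered_mean x0 n \<omega>) (spectral_matrix V (\<lambda>k. if 0 < e k then 1 / e k else 0) *v centered_mean x0 n \<omega>)
        = (\<Sum>k\<in>UNIV. if 0 < e k then (inner (V $ k) ?S)\<^sup>2 / (e k * real n) else 0)"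
      unfolding inner_spectral_matrix sum_distrib_left
      using False by (intro sum.cong refl) (simp add: centered_mean_def power2_eq_square field_simps)
    also have "\<dots> = (\<Sum>k\<in>{k. 0 < e k}. (inner (V $ k) ?S)\<^sup>2 / (e k * real n))"
      by (simp add: sum.If_cases)
    also have "\<dots> = (\<Sum>j<?l. (inner (V $ h j) ?S)\<^sup>2 / (e (h j) * real n))"
      by (rule sum.reindex_bij_betw[OF h, symmetric])
    also have "\<dots> = (\<Sum>j<?l. (inner (a j) ?S / sqrt (real n))\<^sup>2)"
      using he by (intro sum.cong refl) (simp add: a_def power_divide power_mult_distrib less_imp_le power_inverse divide_inverse mult_ac)
    finally show ?thesis .
  qed simp
  then show ?thesis using lim by simp
qed

text \<open>The coordinate along an eigenvector for the eigenvalue 0 has mean 0 and variance 0,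
  hence vanishes almost surely at every sample point.\<close>

lemma centered_mean_kernel:
  assumes x0: "x0 \<in> D" and V: "orthogonal_matrix V"
    and \<Sigma>: "covariance_matrix M (\<lambda>\<omega>. F x0 (\<xi> \<omega>)) = spectral_matrix V e"
  shows "AE \<omega> in M. \<forall>n k. e k = 0 \<longrightarrow> inner (V $ k) (centered_mean x0 n \<omega>) = 0"
proof -
  note [measurable] = xi(1)
  have "AE y in distr M borel \<xi>. inner (V $ k) (centered x0 y) = 0" if "e k = 0" for k
  proof -
    have "expectation (\<lambda>\<omega>. inner (V $ k) (centered x0 (\<xi> \<omega>)) * inner (V $ k) (centered x0 (\<xi> \<omega>))) = 0"
      using that by (simp add: inner_covariance_matrix[OF x0, symmetric] \<Sigma> spectral_matrix_eigenvalue(1)[OF V])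
    then have "AE \<omega> in M. inner (V $ k) (centered x0 (\<xi> \<omega>)) * inner (V $ k) (centered x0 (\<xi> \<omega>)) = 0"
      by (subst (asm) integral_nonneg_eq_0_iff_AE) (auto intro: centered_xi(4)[OF x0])
    then have "AE \<omega> in M. inner (V $ k) (centered x0 (\<xi> \<omega>)) = 0" by simp
    then show ?thesis by (subst AE_distr_iff) auto
  qed
  then have "AE y in distr M borel \<xi>. \<forall>k\<in>{k. e k = 0}. inner (V $ k) (centered x0 y) = 0"
    by (intro AE_finite_allI) auto
  from AE_xis[OF this] show ?thesis
  proof eventually_elim
    case (elim \<omega>)
    then show ?case by (auto simp: centered_mean_def inner_sum_right)
  qed
qed

lemma xis_measurable_completion[measurable]: "\<xi>s (Suc i) \<in> borel_measurable (completion M)"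
  by (rule measurable_completion) measurable

lemma sample_covariance_measurable:
  assumes X[measurable]: "X \<in> borel_measurable (completion M)" and XD: "AE \<omega> in M. X \<omega> \<in> D"
  shows "(\<lambda>\<omega>. sample_covariance n (\<lambda>i. F (X \<omega>) (\<xi>s i \<omega>))) \<in> borel_measurable (completion M)"
proof (rule completion.measurable_AE_eq)
  have eq: "sample_covariance n Y = (\<chi> j k. (1 / (real n - 1)) *
        (\<Sum>i<n. (Y (Suc i) $ j - sample_mean n Y $ j) * (Y (Suc i) $ k - sample_mean n Y $ k)))" for Y :: "nat \<Rightarrow> real^'q"
    by (simp add: sample_covariance_def sum.atLeast1_atMost_eq)
  show "(\<lambda>\<omega>. sample_covariance n (\<lambda>i. Ft (X \<omega>) (\<xi>s i \<omega>))) \<in> borel_measurable (completion M)"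
    unfolding eq sample_mean_eq
    by (intro borel_measurable_vecI) (unfold vec_lambda_beta, measurable)
  show "AE \<omega> in completion M. sample_covariance n (\<lambda>i. Ft (X \<omega>) (\<xi>s i \<omega>)) = sample_covariance n (\<lambda>i. F (X \<omega>) (\<xi>s i \<omega>))"
    using AE_completion[OF XD] AE_completion[OF AE_xis[OF AE_xi_regular]]
    by eventually_elim (rule sample_covariance_cong, simp add: Ft_eq)
qed simp

text \<open>\<open>B_deriv\<close> is a definite description, which gives no hold on measurability;
  as a directional derivative it is almost surely the limit of difference quotients of a measurable
  map along the steps \<open>1 / real (Suc k)\<close>.\<close>

lemma B_deriv_normal_map_measurable:
  assumes poly: "polyhedron S" and ne: "S \<noteq> {}" and Z[measurable]: "Z \<in> borel_measurable (completion M)"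
    and ZD: "AE \<omega> in M. closest_point S (Z \<omega>) \<in> D"
  shows "(\<lambda>\<omega>. B_deriv (normal_map S (\<lambda>y. sample_mean n (\<lambda>i. F y (\<xi>s i \<omega>)))) (Z \<omega>) (z0 - Z \<omega>)) \<in> borel_measurable (completion M)"
proof (rule completion.measurable_AE_eq)
  obtain c where c': "c \<in> borel_measurable borel" "\<forall>e. 0 \<le> c e" "integrable M (\<lambda>\<omega>. (c (\<xi> \<omega>))\<^sup>2)"
    "AE e in distr M borel \<xi>. regular_point c e"
    using ex_modulus by blast
  have cl: "closed S" and cv: "convex S"
    using poly by (auto simp: polyhedron_imp_closed polyhedron_imp_convex)
  have contP: "continuous_on UNIV (closest_point S)" by (rule continuous_on_closest_point[OF cv cl ne])
  have [measurable]: "closest_point S \<in> borel_measurable borel"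
    by (rule borel_measurable_continuous_onI[OF contP])
  let ?H = "\<lambda>k \<omega>. Z \<omega> + (1 / real (Suc k)) *\<^sub>R (z0 - Z \<omega>)"
  let ?N = "\<lambda>y \<omega>. sample_mean n (\<lambda>i. Ft (closest_point S y) (\<xi>s i \<omega>)) + y - closest_point S y"
  show "(\<lambda>\<omega>. lim (\<lambda>k. (?N (?H k \<omega>) \<omega> - ?N (Z \<omega>) \<omega>) /\<^sub>R (1 / real (Suc k)))) \<in> borel_measurable (completion M)"
    unfolding sample_mean_eq by measurable
  show "AE \<omega> in completion M. lim (\<lambda>k. (?N (?H k \<omega>) \<omega> - ?N (Z \<omega>) \<omega>) /\<^sub>R (1 / real (Suc k)))
      = B_deriv (normal_map S (\<lambda>y. sample_mean n (\<lambda>i. F y (\<xi>s i \<omega>)))) (Z \<omega>) (z0 - Z \<omega>)"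
    using AE_completion[OF ZD] AE_completion[OF AE_xis[OF c'(4)]]
  proof eventually_elim
    case (elim \<omega>)
    let ?g = "\<lambda>y. sample_mean n (\<lambda>i. F y (\<xi>s i \<omega>))"
    have reg: "\<And>i. i \<ge> 1 \<Longrightarrow> regular_point c (\<xi>s i \<omega>)" using elim(2) by blast
    have N: "?N y \<omega> = normal_map S ?g y" if "closest_point S y \<in> D" for y
    proof -
      have "sample_mean n (\<lambda>i. Ft (closest_point S y) (\<xi>s i \<omega>)) = sample_mean n (\<lambda>i. F (closest_point S y) (\<xi>s i \<omega>))"
        by (rule sample_mean_cong) (use reg that in \<open>simp add: regular_point_def Ft_eq\<close>)
      then show ?thesis by (simp add: normal_map_def)
    qed
    obtain G where Bd: "has_B_derivative (normal_map S ?g) G (Z \<omega>)"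
      using has_B_derivative_normal_map[OF poly ne D elim(1)
        sample_function(2)[where n = n and e = "\<lambda>i. \<xi>s i \<omega>", OF reg c'(2)[rule_format]]
        sample_function(1)[where n = n and e = "\<lambda>i. \<xi>s i \<omega>", OF reg elim(1)]] ..
    have "(\<lambda>k. (normal_map S ?g (?H k \<omega>) - normal_map S ?g (Z \<omega>)) /\<^sub>R (1 / real (Suc k)))
        \<longlonglongrightarrow> B_deriv (normal_map S ?g) (Z \<omega>) (z0 - Z \<omega>)"
      unfolding B_deriv_eq[OF Bd]
      by (rule filterlim_compose[OF has_B_derivative_directional[OF Bd] filterlim_inverse_Suc_at_right])
    moreover have "\<forall>\<^sub>F k in sequentially. (normal_map S ?g (?H k \<omega>) - normal_map S ?g (Z \<omega>)) /\<^sub>R (1 / real (Suc k))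
        = (?N (?H k \<omega>) \<omega> - ?N (Z \<omega>) \<omega>) /\<^sub>R (1 / real (Suc k))"
    proof -
      have "(\<lambda>k. ?H k \<omega>) \<longlonglongrightarrow> Z \<omega> + 0 *\<^sub>R (z0 - Z \<omega>)"
        by (intro tendsto_intros LIMSEQ_Suc[OF lim_1_over_n])
      then have "(\<lambda>k. closest_point S (?H k \<omega>)) \<longlonglongrightarrow> closest_point S (Z \<omega>)"
        by (intro continuous_on_tendsto_compose[OF contP]) auto
      from topological_tendstoD[OF this D elim(1)] show ?thesis
        by eventually_elim (simp add: N elim(1))
    qed
    ultimately have "(\<lambda>k. (?N (?H k \<omega>) \<omega> - ?N (Z \<omega>) \<omega>) /\<^sub>R (1 / real (Suc k)))
        \<longlonglongrightarrow> B_deriv (normal_map S ?g) (Z \<omega>) (z0 - Z \<omega>)"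
      by (rule Lim_transform_eventually)
    then show ?case by (rule limI)
  qed
qed simp

text \<open>Path by path application of the deterministic bound. The strong law supplies bounded
  Lipschitz constants and convergence of the sample Jacobians at \<open>x0\<close>.\<close>

lemma AE_normal_map_error_bound:
  assumes poly: "polyhedron S" and ne: "S \<noteq> {}" and x0: "x0 \<in> D" "x0 = closest_point S z0"
    and z0: "z0 = x0 - expectation (\<lambda>\<omega>. F x0 (\<xi> \<omega>))"
    and z: "AE \<omega> in M. (\<lambda>n. z n \<omega>) \<longlonglongrightarrow> z0"
    and sol: "AE \<omega> in M. \<forall>\<^sub>F n in sequentially. normal_map S (\<lambda>y. sample_mean n (\<lambda>i. F y (\<xi>s i \<omega>))) (z n \<omega>) = 0"
    and coercive: "\<kappa>0 > 0" "\<And>h. \<kappa>0 * norm h \<le> norm (expectation (\<lambda>\<omega>. Jt x0 (\<xi> \<omega>)) *v closest_point (critical_cone S z0) h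
        + h - closest_point (critical_cone S z0) h)"
  shows "AE \<omega> in M. \<exists>\<kappa>\<ge>0. \<forall>\<^sub>F n in sequentially.
    norm (B_deriv (normal_map S (\<lambda>y. sample_mean n (\<lambda>i. F y (\<xi>s i \<omega>)))) (z n \<omega>) (z0 - z n \<omega>) - centered_mean x0 n \<omega>)
      \<le> \<kappa> * norm (z n \<omega> - z0) * norm (centered_mean x0 n \<omega>)"
proof -
  note [measurable] = xi(1)
  obtain c where c': "c \<in> borel_measurable borel" "\<forall>e. 0 \<le> c e" "integrable M (\<lambda>\<omega>. (c (\<xi> \<omega>))\<^sup>2)"
    "AE e in distr M borel \<xi>. regular_point c e"
    using ex_modulus by blast
  note [measurable] = c'(1)
  let ?J = "expectation (\<lambda>\<omega>. Jt x0 (\<xi> \<omega>))"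
  have s1: "AE \<omega> in M. (\<lambda>n. sample_mean n (\<lambda>i. c (\<xi>s i \<omega>))) \<longlonglongrightarrow> expectation (\<lambda>\<omega>. c (\<xi> \<omega>))"
    by (rule sample_mean_slln[OF c'(1)], rule integrable_of_square) (use c'(3) in simp_all)
  have s2: "AE \<omega> in M. (\<lambda>n. sample_mean n (\<lambda>i. Jt x0 (\<xi>s i \<omega>))) \<longlonglongrightarrow> ?J"
    by (rule sample_mean_slln[OF Jt_measurable Jt_xi(2)[OF x0(1)]])
  show ?thesis
    using s1 s2 z sol AE_xis[OF c'(4)]
  proof eventually_elim
    case (elim \<omega>)
    let ?g = "\<lambda>n y. sample_mean n (\<lambda>i. F y (\<xi>s i \<omega>))" and ?G = "\<lambda>n y. sample_mean n (\<lambda>i. J y (\<xi>s i \<omega>))"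
    have reg: "\<And>i. i \<ge> 1 \<Longrightarrow> regular_point c (\<xi>s i \<omega>)" using elim(5) by blast
    have GJ: "?G n x0 = sample_mean n (\<lambda>i. Jt x0 (\<xi>s i \<omega>))" for n
      by (rule sample_mean_cong) (use reg x0(1) in \<open>simp add: regular_point_def Jt_eq\<close>)
    have "\<exists>\<kappa>\<ge>0. \<forall>\<^sub>F n in sequentially.
      norm (B_deriv (normal_map S (?g n)) (z n \<omega>) (z0 - z n \<omega>) - (?g n x0 - expectation (\<lambda>\<omega>. F x0 (\<xi> \<omega>))))
        \<le> \<kappa> * norm (z n \<omega> - z0) * norm (?g n x0 - expectation (\<lambda>\<omega>. F x0 (\<xi> \<omega>)))"
    proof (rule normal_map_error_bound[OF poly ne D x0 z0 elim(3) elim(4), where J = "\<lambda>n y h. ?G n y *v h"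
          and e = "\<lambda>n. norm (?G n x0 - ?J)" and L = "\<lambda>h. ?J *v h" and c = \<kappa>0 and b = "\<lambda>n. sample_mean n (\<lambda>i. c (\<xi>s i \<omega>))"])
      show "(sample_mean n (\<lambda>i. c (\<xi>s i \<omega>)))-lipschitz_on D (?g n)" for n
        by (rule sample_function(2)[OF reg c'(2)[rule_format]])
      show "(?g n has_derivative (\<lambda>h. ?G n y *v h)) (at y)" if "y \<in> D" for n y
        by (rule sample_function(1)[OF reg that])
      show "norm (?G n y *v h - ?G n y' *v h) \<le> sample_mean n (\<lambda>i. c (\<xi>s i \<omega>)) * norm (y - y') * norm h"
        if "y \<in> D" "y' \<in> D" for n y y' h
        by (rule sample_function(3)[OF reg that])
      show "Bseq (\<lambda>n. sample_mean n (\<lambda>i. c (\<xi>s i \<omega>)))" by (rule convergent_imp_Bseq[OF convergentI[OF elim(1)]])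
      show "norm (?G n x0 *v h - ?J *v h) \<le> norm (?G n x0 - ?J) * norm h" for n h
        using norm_matrix_vector_mult_le[of "?G n x0 - ?J" h] by (simp add: matrix_vector_mult_diff_rdistrib)
      show "(\<lambda>n. norm (?G n x0 - ?J)) \<longlonglongrightarrow> 0"
        unfolding GJ using elim(2) by (simp add: LIM_zero tendsto_norm_zero)
    qed (rule coercive)+
    then obtain \<kappa> where \<kappa>: "\<kappa> \<ge> 0" "\<forall>\<^sub>F n in sequentially.
      norm (B_deriv (normal_map S (?g n)) (z n \<omega>) (z0 - z n \<omega>) - (?g n x0 - expectation (\<lambda>\<omega>. F x0 (\<xi> \<omega>))))
        \<le> \<kappa> * norm (z n \<omega> - z0) * norm (?g n x0 - expectation (\<lambda>\<omega>. F x0 (\<xi> \<omega>)))" by blast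
    have "Ft x0 (\<xi>s i \<omega>) = F x0 (\<xi>s i \<omega>)" if "1 \<le> i" for i
      using reg[OF that] x0(1) by (simp add: regular_point_def Ft_eq)
    then have cm: "centered_mean x0 n \<omega> = ?g n x0 - expectation (\<lambda>\<omega>. F x0 (\<xi> \<omega>))" if "0 < n" for n
      using centered_mean_eq[OF that] Ft_xi(4)[OF x0(1)] by simp
    show ?case
    proof (intro exI[of _ \<kappa>] conjI \<kappa>(1))
      show "\<forall>\<^sub>F n in sequentially. norm (B_deriv (normal_map S (?g n)) (z n \<omega>) (z0 - z n \<omega>) - centered_mean x0 n \<omega>)
        \<le> \<kappa> * norm (z n \<omega> - z0) * norm (centered_mean x0 n \<omega>)"
        using \<kappa>(2) eventually_gt_at_top[of 0] by eventually_elim (simp add: cm)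
    qed
  qed
qed

text \<open>Error bound, matrix convergence and second moment of \<open>centered_mean\<close> meet
  in the ratio criterion. Measurability is asked of the quadratic form as a whole, since in the
  theorem \<open>A n\<close> is built from \<Delta> and its own measurability is not at
  hand.\<close>

lemma quadratic_form_prob_limit:
  assumes x0: "x0 \<in> D" and z: "AE \<omega> in M. (\<lambda>n. z n \<omega>) \<longlonglongrightarrow> z0"
    and T: "\<And>n. (\<lambda>\<omega>. real n * inner (w n \<omega>) (A n \<omega> *v w n \<omega>)) \<in> borel_measurable (completion M)"
    and A: "AE \<omega> in M. (\<lambda>n. A n \<omega>) \<longlonglongrightarrow> B"
    and w: "AE \<omega> in M. \<exists>\<kappa>\<ge>0. \<forall>\<^sub>F n in sequentially.
      norm (w n \<omega> - centered_mean x0 n \<omega>) \<le> \<kappa> * norm (z n \<omega> - z0) * norm (centered_mean x0 n \<omega>)"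
    and \<delta>: "\<delta> > 0"
  shows "(\<lambda>n. measure (completion M) {\<omega>\<in>space (completion M). \<delta> < \<bar>real n * inner (w n \<omega>) (A n \<omega> *v w n \<omega>)
      - real n * inner (centered_mean x0 n \<omega>) (B *v centered_mean x0 n \<omega>)\<bar>}) \<longlonglongrightarrow> 0"
proof -
  interpret N: prob_space "completion M" by (rule prob_space_completion)
  have [measurable]: "centered_mean x0 n \<in> borel_measurable (completion M)" for n
    by (rule measurable_completion) measurable
  note [measurable] = T
  have [measurable]: "(\<lambda>\<omega>. B *v centered_mean x0 n \<omega>) \<in> borel_measurable (completion M)" for n
    by (intro borel_measurable_vecI) (unfold matrix_vector_mult_def vec_lambda_beta, measurable)
  show ?thesis
  proof (rule N.AE_tendsto_0_ratio_imp_prob[where V = "\<lambda>n \<omega>. real n * (norm (centered_mean x0 n \<omega>))\<^sup>2"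
        and v = "expectation (\<lambda>\<omega>. (norm (centered x0 (\<xi> \<omega>)))\<^sup>2)", OF _ _ _ _ _ \<delta>])
    fix n
    have int: "integrable M (\<lambda>\<omega>. real n * (norm (centered_mean x0 n \<omega>))\<^sup>2)" by (rule centered_mean_second_moment(1)[OF x0])
    then have meas: "(\<lambda>\<omega>. real n * (norm (centered_mean x0 n \<omega>))\<^sup>2) \<in> borel_measurable M" by simp
    show "integrable (completion M) (\<lambda>\<omega>. real n * (norm (centered_mean x0 n \<omega>))\<^sup>2)"
      using int meas by (simp add: integrable_completion)
    show "N.expectation (\<lambda>\<omega>. real n * (norm (centered_mean x0 n \<omega>))\<^sup>2) \<le> expectation (\<lambda>\<omega>. (norm (centered x0 (\<xi> \<omega>)))\<^sup>2)"
      unfolding integral_completion[OF meas] by (rule centered_mean_second_moment(2)[OF x0])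
    show "AE \<omega> in completion M. (\<lambda>n. (real n * inner (w n \<omega>) (A n \<omega> *v w n \<omega>)
        - real n * inner (centered_mean x0 n \<omega>) (B *v centered_mean x0 n \<omega>)) / (1 + real n * (norm (centered_mean x0 n \<omega>))\<^sup>2)) \<longlonglongrightarrow> 0"
      using AE_completion[OF A] AE_completion[OF w] AE_completion[OF z]
    proof eventually_elim
      case (elim \<omega>)
      obtain \<kappa> where \<kappa>: "\<kappa> \<ge> 0" "\<forall>\<^sub>F n in sequentially.
        norm (w n \<omega> - centered_mean x0 n \<omega>) \<le> \<kappa> * norm (z n \<omega> - z0) * norm (centered_mean x0 n \<omega>)"
        using elim(2) by blast
      show ?case
      proof (rule quadratic_form_perturbation[OF elim(1) _ _ \<kappa>(2)])
        have "(\<lambda>n. norm (z n \<omega> - z0)) \<longlonglongrightarrow> 0" using elim(3) by (simp add: LIM_zero tendsto_norm_zero)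
        then show "(\<lambda>n. \<kappa> * norm (z n \<omega> - z0)) \<longlonglongrightarrow> 0" by (rule tendsto_mult_right_zero)
      qed (use \<kappa>(1) in simp)
    qed
  qed (auto intro: borel_measurable_diff T)
qed

end

section \<open>Confidence regions in the singular case\<close>

lemma isCont_threshold:
  fixes u v :: "real \<Rightarrow> real"
  assumes "isCont u \<mu>" "isCont v \<mu>" "\<mu> \<noteq> \<rho>"
  shows "isCont (\<lambda>t. if \<rho> \<le> t then u t else v t) \<mu>"
proof (cases "\<mu> < \<rho>")
  case True
  then have "\<forall>\<^sub>F t in nhds \<mu>. (if \<rho> \<le> t then u t else v t) = v t"
    by (intro eventually_mono[OF eventually_nhds_in_open[of "{..<\<rho>}"]]) auto
  from isCont_cong[OF this] show ?thesis using assms(2) by simp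
next
  case False
  then have "\<forall>\<^sub>F t in nhds \<mu>. (if \<rho> \<le> t then u t else v t) = u t"
    using assms(3) by (intro eventually_mono[OF eventually_nhds_in_open[of "{\<rho><..}"]]) auto
  from isCont_cong[OF this] show ?thesis using assms(1) by simp
qed

lemma inner_transpose_matrix_mult:
  fixes A :: "real^'n^'m"
  shows "inner x ((transpose A ** A) *v x) = (norm (A *v x))\<^sup>2"
proof -
  have "inner x ((transpose A ** A) *v x) = inner x ((A *v x) v* A)"
    by (simp flip: matrix_vector_mul_assoc)
  also have "\<dots> = inner (A *v x) (A *v x)"
    by (subst inner_commute) (rule dot_lmul_matrix)
  finally show ?thesis by (simp add: power2_norm_eq_inner)
qed

lemma (in prob_space) prob_eventually_tendsto_0:
  assumes [measurable]: "\<And>n. {\<omega>\<in>space M. P n \<omega>} \<in> events" and ev: "AE \<omega> in M. \<forall>\<^sub>F n in sequentially. \<not> P n \<omega>"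
  shows "(\<lambda>n. prob {\<omega>\<in>space M. P n \<omega>}) \<longlonglongrightarrow> 0"
proof -
  have "(\<lambda>n. prob {\<omega>\<in>space M. 1/2 < \<bar>indicator {\<omega>\<in>space M. P n \<omega>} \<omega> :: real\<bar>}) \<longlonglongrightarrow> 0"
  proof (rule AE_tendsto_0_imp_prob)
    show "AE \<omega> in M. (\<lambda>n. indicator {\<omega>\<in>space M. P n \<omega>} \<omega> :: real) \<longlonglongrightarrow> 0"
      using ev
    proof eventually_elim
      case (elim \<omega>)
      then have "\<forall>\<^sub>F n in sequentially. indicator {\<omega>\<in>space M. P n \<omega>} \<omega> = (0::real)"
        by eventually_elim simp
      then show ?case by (rule tendsto_eventually)
    qed
  qed auto
  moreover have "{\<omega>\<in>space M. 1/2 < \<bar>indicator {\<omega>\<in>space M. P n \<omega>} \<omega> :: real\<bar>} = {\<omega>\<in>space M. P n \<omega>}" for n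
    by (auto simp: indicator_def)
  ultimately show ?thesis by simp
qed

theorem theorem4p2:
  fixes M :: "'w measure"
    and \<xi> :: "'w \<Rightarrow> real^'d" and \<xi>s :: "nat \<Rightarrow> 'w \<Rightarrow> real^'d" and \<Xi> :: "(real^'d) set"
    and D S X0 Z :: "(real^'q::{finite,linorder}) set"
    and F :: "real^'q::_ \<Rightarrow> real^'d \<Rightarrow> real^'q::_"
    and f0 :: "real^'q::_ \<Rightarrow> real^'q::_" and f :: "nat \<Rightarrow> 'w \<Rightarrow> real^'q::_ \<Rightarrow> real^'q::_"
    and C :: "'w \<Rightarrow> real"
    and x0 z0 :: "real^'q::_" and L L_K :: "real^'q::_ \<Rightarrow> real^'q::_" and K :: "(real^'q::_) set"
    and z x :: "nat \<Rightarrow> 'w \<Rightarrow> real^'q::_"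
    and \<Sigma>0 :: "real^'q::_^'q::_" and \<Sigma> U \<Delta> U1 U2 Dinv :: "nat \<Rightarrow> 'w \<Rightarrow> real^'q::_^'q::_"
    and \<alpha> \<rho> \<rho>0 :: real and l :: nat and lr :: "nat \<Rightarrow> 'w \<Rightarrow> nat"
    and cv :: "nat \<Rightarrow> ereal"
    and w :: "nat \<Rightarrow> 'w \<Rightarrow> real^'q::_ \<Rightarrow> real^'q::_"
    and R :: "nat \<Rightarrow> real \<Rightarrow> 'w \<Rightarrow> (real^'q::_) set"
  assumes prob: "prob_space M"
    and xi: "\<xi> \<in> borel_measurable M" "closed \<Xi>" "AE \<omega> in M. \<xi> \<omega> \<in> \<Xi>"
    and D: "open D"
    and F_meas: "(\<lambda>(y, e). F y e) \<in> borel_measurable (restrict_space borel (D \<times> \<Xi>))"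
    and F_int: "\<And>y. y \<in> D \<Longrightarrow> integrable M (\<lambda>\<omega>. F y (\<xi> \<omega>))"
    and f0: "f0 = (\<lambda>y. LINT \<omega>|M. F y (\<xi> \<omega>))"
    and S: "polyhedron S"
    and iid: "prob_space.indep_vars M (\<lambda>_. borel) \<xi>s {1..}"
      "\<And>i. i \<ge> 1 \<Longrightarrow> distr M borel (\<xi>s i) = distr M borel \<xi>"
    and f: "f = (\<lambda>n \<omega> y. sample_mean n (\<lambda>i. F y (\<xi>s i \<omega>)))"
    \<comment> \<open>hypotheses (a), (b), (c)\<close>
    and a: "\<And>y. y \<in> D \<Longrightarrow> (\<integral>\<^sup>+\<omega>. ennreal ((norm (F y (\<xi> \<omega>)))\<^sup>2) \<partial>M) < \<infinity>"
    and b: "AE e in distr M borel \<xi>. C1_on D (\<lambda>y. F y e)"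
      "\<And>y. y \<in> D \<Longrightarrow>
         (\<integral>\<^sup>+\<omega>. ennreal ((norm (jacobian (\<lambda>u. F u (\<xi> \<omega>)) (at y)))\<^sup>2) \<partial>M) < \<infinity>"
    and c: "C \<in> borel_measurable M" "integrable M (\<lambda>\<omega>. (C \<omega>)\<^sup>2)"
      "AE \<omega> in M. \<forall>y\<in>D. \<forall>y'\<in>D.
         norm (F y (\<xi> \<omega>) - F y' (\<xi> \<omega>)) +
         norm (jacobian (\<lambda>u. F u (\<xi> \<omega>)) (at y) - jacobian (\<lambda>u. F u (\<xi> \<omega>)) (at y'))
         \<le> C \<omega> * norm (y - y')"
    \<comment> \<open>the true problem\<close>
    and x0: "x0 \<in> D" "x0 \<in> vi_solutions S f0"
    and z0: "z0 = x0 - f0 x0"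
    and L: "L = frechet_derivative f0 (at x0)"
    and K: "K = tangent_cone S x0 \<inter> {v. inner v (z0 - x0) = 0}"
    and L_K: "L_K = (\<lambda>h. L (closest_point K h) + h - closest_point K h)"
      "\<exists>g. homeomorphism UNIV UNIV L_K g"
    \<comment> \<open>the sample average solutions near \<open>z0\<close> and \<open>x0\<close>\<close>
    and nbhds: "X0 \<subseteq> D" "x0 \<in> interior X0" "z0 \<in> interior Z"
    and z_meas: "\<And>n. z n \<in> borel_measurable (completion M)"
    and z_dom: "AE \<omega> in M. \<forall>n. closest_point S (z n \<omega>) \<in> D"
    and x: "x = (\<lambda>n \<omega>. closest_point S (z n \<omega>))"
    and z_sol: "AE \<omega> in M. \<exists>N. \<forall>n\<ge>N.
        {y \<in> Z. closest_point S y \<in> D \<and> normal_map S (f n \<omega>) y = 0} = {z n \<omega>} \<and>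
        X0 \<inter> vi_solutions S (f n \<omega>) = {x n \<omega>}"
    and conv: "AE \<omega> in M. (\<lambda>n. z n \<omega>) \<longlonglongrightarrow> z0" "AE \<omega> in M. (\<lambda>n. x n \<omega>) \<longlonglongrightarrow> x0"
    \<comment> \<open>covariance matrices\<close>
    and \<Sigma>0: "\<Sigma>0 = covariance_matrix M (\<lambda>\<omega>. F x0 (\<xi> \<omega>))"
    and \<Sigma>: "\<Sigma> = (\<lambda>n \<omega>. sample_covariance n (\<lambda>i. F (x n \<omega>) (\<xi>s i \<omega>)))"
    and \<alpha>: "0 \<le> \<alpha>" "\<alpha> \<le> 1"
    and singular: "\<not> invertible \<Sigma>0"
    and \<rho>: "\<rho> > 0" "real_eigenvalue \<Sigma>0 \<rho>"
      "\<And>\<mu>. real_eigenvalue \<Sigma>0 \<mu> \<Longrightarrow> \<mu> > 0 \<Longrightarrow> \<rho> \<le> \<mu>"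
    and l: "l = num_pos_eigenvalues \<Sigma>0"
    and \<rho>0: "0 < \<rho>0" "\<rho>0 < \<rho>"
    and U_meas: "\<And>n. U n \<in> borel_measurable (completion M)"
    and decomp: "AE \<omega> in M. \<forall>n. \<Sigma> n \<omega> = transpose (U n \<omega>) ** \<Delta> n \<omega> ** U n \<omega> \<and>
        orthogonal_matrix (U n \<omega>) \<and> is_diagonal (\<Delta> n \<omega>) \<and> decreasing_diagonal (\<Delta> n \<omega>)"
    and lr: "lr = (\<lambda>n \<omega>. card {i. \<rho>0 \<le> \<Delta> n \<omega> $ i $ i})"
    and Dinv: "Dinv = (\<lambda>n \<omega>. diag_block_inv (first_indices (lr n \<omega>)) (\<Delta> n \<omega>))"
    and U1: "U1 = (\<lambda>n \<omega>. row_block (first_indices (lr n \<omega>)) (U n \<omega>))"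
    and U2: "U2 = (\<lambda>n \<omega>. row_block (- first_indices (lr n \<omega>)) (U n \<omega>))"
    \<comment> \<open>\<open>w n \<omega> y\<close> is \<open>d(f\<^sub>n)\<^sub>S(z\<^sub>n)(y - z\<^sub>n)\<close>\<close>
    and w: "w = (\<lambda>n \<omega> y. B_deriv (normal_map S (f n \<omega>)) (z n \<omega>) (y - z n \<omega>))"
    and crit: "\<And>k. 1 \<le> k \<Longrightarrow> k \<le> CARD('q) \<Longrightarrow> chi_square_critical k \<alpha> (cv k)"
    and R: "R = (\<lambda>n \<epsilon> \<omega>. {y.
        ereal (real n * inner (w n \<omega> y)
          ((transpose (U1 n \<omega>) ** Dinv n \<omega> ** U1 n \<omega>) *v w n \<omega> y)) \<le> cv (lr n \<omega>) \<and>
        infnorm (sqrt (real n) *\<^sub>R (U2 n \<omega> *v w n \<omega> y)) \<le> \<epsilon>})"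
  shows "(AE \<omega> in M. \<forall>\<^sub>F n in sequentially. lr n \<omega> = l) \<and>
    weak_conv_m
      (\<lambda>n. distr (completion M) borel (\<lambda>\<omega>. real n * inner (w n \<omega> z0)
         ((transpose (U1 n \<omega>) ** Dinv n \<omega> ** U1 n \<omega>) *v w n \<omega> z0)))
      (chi_square l) \<and>
    weak_conv_m
      (\<lambda>n. distr (completion M) borel (\<lambda>\<omega>. real n * inner (w n \<omega> z0)
         ((transpose (U2 n \<omega>) ** U2 n \<omega>) *v w n \<omega> z0)))
      (return borel 0) \<and>
    (\<forall>\<epsilon>>0. (\<lambda>n. measure (completion M) {\<omega> \<in> space M. z0 \<in> R n \<epsilon> \<omega>}) \<longlonglongrightarrow> 1 - \<alpha>)"
proof -
  interpret prob_space M by (rule prob)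
  interpret smooth_sampling M \<xi> \<xi>s \<Xi> D F C
    by unfold_locales (fact assms)+
  interpret N: prob_space "completion M" by (rule prob_space_completion)

  \<comment> \<open>The true problem: \<open>x0\<close> as a projection, the derivative
    \<open>L\<close> and coercivity of \<open>L_K\<close>\<close>
  obtain v where "0 = f0 x0 + v" "v \<in> normal_cone S x0" and x0S: "x0 \<in> S"
    using x0(2) by (auto simp: vi_solutions_def)
  then have nc: "- f0 x0 \<in> normal_cone S x0" by (metis add_eq_0_iff)
  have ne: "S \<noteq> {}" using x0S by blast
  \<comment> \<open>\<open>z0 - x0 = - f0 x0\<close> is normal to \<open>S\<close> at
    \<open>x0\<close>, which is the variational inequality of the projection.\<close>
  have proj0: "closest_point S z0 = x0"
    by (rule closest_point_eqI) (use nc x0S S in \<open>auto simp: polyhedron_imp_closed polyhedron_imp_convex normal_cone_def z0\<close>)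
  have K_eq: "K = critical_cone S z0" by (simp add: K critical_cone_def proj0)
  let ?J = "expectation (\<lambda>\<omega>. Jt x0 (\<xi> \<omega>))"
  have L_eq: "L = (\<lambda>h. ?J *v h)"
    unfolding L f0 by (rule frechet_derivative_at[OF expectation_has_derivative[OF x0(1)], symmetric])
  have "\<exists>\<kappa>>0. \<forall>h. \<kappa> * norm h \<le> norm (L_K h)"
  proof (rule positively_homogeneous_coercive)
    obtain g where g: "homeomorphism UNIV UNIV L_K g" using L_K(2) by blast
    show "continuous_on UNIV L_K" by (rule homeomorphism_cont1[OF g])
    show "inj L_K" by (rule inj_on_inverseI[of _ g]) (simp add: homeomorphism_apply1[OF g])
    show "L_K (t *\<^sub>R h) = t *\<^sub>R L_K h" if "t > 0" for t h
      using closest_point_cone(7)[OF critical_cone[OF S ne] that, of z0 h]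
      by (simp add: L_K(1) L_eq K_eq matrix_vector_mult_scaleR algebra_simps)
  qed
  then obtain \<kappa>0 where \<kappa>0: "\<kappa>0 > 0" "\<And>h. \<kappa>0 * norm h \<le> norm (L_K h)" by blast

  \<comment> \<open>Linearization at the sample solutions\<close>
  define w0 where "w0 n \<omega> = w n \<omega> z0" for n \<omega>
  have w0_eq: "w0 n \<omega> = B_deriv (normal_map S (\<lambda>y. sample_mean n (\<lambda>i. F y (\<xi>s i \<omega>)))) (z n \<omega>) (z0 - z n \<omega>)" for n \<omega>
    by (simp add: w0_def w f)
  have xD: "AE \<omega> in M. \<forall>n. x n \<omega> \<in> D" using z_dom by (simp add: x)
  have w0_meas[measurable]: "w0 n \<in> borel_measurable (completion M)" for n
    unfolding w0_eq[abs_def]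
    by (rule B_deriv_normal_map_measurable[OF S ne z_meas]) (use z_dom in \<open>eventually_elim, blast\<close>)
  have w0_lim: "AE \<omega> in M. \<exists>\<kappa>\<ge>0. \<forall>\<^sub>F n in sequentially.
      norm (w0 n \<omega> - centered_mean x0 n \<omega>) \<le> \<kappa> * norm (z n \<omega> - z0) * norm (centered_mean x0 n \<omega>)"
    unfolding w0_eq
  proof (rule AE_normal_map_error_bound[OF S ne x0(1) proj0[symmetric] _ conv(1) _ \<kappa>0(1)])
    show "z0 = x0 - expectation (\<lambda>\<omega>. F x0 (\<xi> \<omega>))" by (simp add: z0 f0)
    show "AE \<omega> in M. \<forall>\<^sub>F n in sequentially. normal_map S (\<lambda>y. sample_mean n (\<lambda>i. F y (\<xi>s i \<omega>))) (z n \<omega>) = 0"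
      using z_sol
    proof eventually_elim
      case (elim \<omega>)
      then obtain m where m: "\<forall>n\<ge>m. {y \<in> Z. closest_point S y \<in> D \<and> normal_map S (f n \<omega>) y = 0} = {z n \<omega>}" by blast
      have "normal_map S (f n \<omega>) (z n \<omega>) = 0" if "n \<ge> m" for n using m that by blast
      then show ?case unfolding f eventually_sequentially by blast
    qed
    show "\<kappa>0 * norm h \<le> norm (?J *v closest_point (critical_cone S z0) h + h - closest_point (critical_cone S z0) h)" for h
      using \<kappa>0(2)[of h] by (simp add: L_K(1) L_eq K_eq)
  qed

  \<comment> \<open>Sample covariance matrices: convergence and measurability\<close>
  have \<Sigma>_lim: "AE \<omega> in M. (\<lambda>n. \<Sigma> n \<omega>) \<longlonglongrightarrow> \<Sigma>0"
    unfolding \<Sigma> \<Sigma>0 by (rule sample_covariance_conv[OF x0(1) xD conv(2)])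
  have x_meas[measurable]: "x n \<in> borel_measurable (completion M)" for n
  proof -
    have "continuous_on UNIV (closest_point S)"
      using S ne by (intro continuous_on_closest_point) (auto simp: polyhedron_imp_closed polyhedron_imp_convex)
    from measurable_compose[OF z_meas borel_measurable_continuous_onI[OF this]] show ?thesis by (simp add: x)
  qed
  have \<Sigma>_meas[measurable]: "\<Sigma> n \<in> borel_measurable (completion M)" for n
    unfolding \<Sigma> by (rule sample_covariance_measurable[OF x_meas]) (use xD in \<open>eventually_elim, blast\<close>)
  note [measurable] = U_meas

  \<comment> \<open>Spectral data of the sample covariances and of \<Sigma>0\<close>
  have dec: "AE \<omega> in M. \<forall>n. orthogonal_matrix (U n \<omega>) \<and> \<Sigma> n \<omega> = spectral_matrix (U n \<omega>) (\<lambda>k. \<Delta> n \<omega> $ k $ k) \<and>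
      first_indices (lr n \<omega>) = {k. \<rho>0 \<le> \<Delta> n \<omega> $ k $ k}"
    using decomp
  proof eventually_elim
    case (elim \<omega>)
    show ?case
    proof
      fix n
      have d: "\<Sigma> n \<omega> = transpose (U n \<omega>) ** \<Delta> n \<omega> ** U n \<omega>" "orthogonal_matrix (U n \<omega>)"
        "is_diagonal (\<Delta> n \<omega>)" "decreasing_diagonal (\<Delta> n \<omega>)" using elim by blast+
      show "orthogonal_matrix (U n \<omega>) \<and> \<Sigma> n \<omega> = spectral_matrix (U n \<omega>) (\<lambda>k. \<Delta> n \<omega> $ k $ k) \<and>
        first_indices (lr n \<omega>) = {k. \<rho>0 \<le> \<Delta> n \<omega> $ k $ k}"
        unfolding d(1) lr using d(2) spectral_matrix_diagonal[OF d(3)] first_indices_decreasing[OF d(4)] by simp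
    qed
  qed
  \<comment> \<open>The claim inside does not depend on \<omega>: a single good sample path yields a
    diagonalization of \<Sigma>0 as a limit of those of \<open>\<Sigma> n \<omega>\<close>.\<close>
  have "AE \<omega> in M. \<exists>V e. orthogonal_matrix V \<and> \<Sigma>0 = spectral_matrix V e"
    using dec \<Sigma>_lim
  proof eventually_elim
    case (elim \<omega>)
    have "\<Sigma> n \<omega> = spectral_matrix (U n \<omega>) (\<lambda>k. \<Delta> n \<omega> $ k $ k)" "orthogonal_matrix (U n \<omega>)" for n
      using elim(1) by blast+
    then have "(\<lambda>n. spectral_matrix (U n \<omega>) (\<lambda>k. \<Delta> n \<omega> $ k $ k)) \<longlonglongrightarrow> \<Sigma>0" "\<And>n. orthogonal_matrix (U n \<omega>)"
      using elim(2) by simp_all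
    from spectral_subsequence[OF this] show ?case by blast
  qed
  then obtain V e where V: "orthogonal_matrix V" and \<Sigma>0_eq: "\<Sigma>0 = spectral_matrix V e" by auto
  have cov_eq: "covariance_matrix M (\<lambda>\<omega>. F x0 (\<xi> \<omega>)) = spectral_matrix V e" using \<Sigma>0 \<Sigma>0_eq by simp
  have e_nonneg: "0 \<le> e k" for k
  proof -
    have "e k * inner (V $ k) (V $ k) = inner (V $ k) (\<Sigma>0 *v (V $ k))"
      by (simp add: \<Sigma>0_eq spectral_matrix_eigenvalue(1)[OF V])
    also have "\<dots> \<ge> 0"
      unfolding \<Sigma>0 inner_covariance_matrix[OF x0(1)] by (rule Bochner_Integration.integral_nonneg) simp
    finally have "0 \<le> e k * inner (V $ k) (V $ k)" .
    moreover have "0 < inner (V $ k) (V $ k)" using spectral_matrix_eigenvalue(2)[OF V, of k] by simp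
    ultimately show ?thesis by (simp add: zero_le_mult_iff)
  qed
  \<comment> \<open>Positive eigenvalues are at least \<rho>, and \<rho>0 is positive and below
    \<rho>, so the threshold falls into a gap of the spectrum.\<close>
  have eig_cases: "\<mu> \<noteq> \<rho>0" if "real_eigenvalue \<Sigma>0 \<mu>" for \<mu>
    using \<rho>(3)[OF that] \<rho>0 by force
  have e_pos: "\<rho>0 \<le> e k \<longleftrightarrow> 0 < e k" for k
    using \<rho>(3)[of "e k"] spectral_matrix_eigenvalue(3)[OF V, of e k] \<rho>0 by (auto simp: \<Sigma>0_eq)
  have l_eq: "l = card {k. 0 < e k}"
    unfolding l \<Sigma>0_eq by (rule num_pos_eigenvalues_spectral_matrix[OF V])
  \<comment> \<open>Critical values are available for \<open>1 \<le> k\<close> and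
    \<open>k \<le> CARD('q)\<close>, and positivity of \<open>l\<close> also excludes atoms of
    \<open>chi_square l\<close>.\<close>
  have l1: "1 \<le> l"
  proof -
    obtain k where "e k = \<rho>" using \<rho>(2) real_eigenvalue_spectral_matrix[OF V, of e \<rho>] \<Sigma>0_eq by auto
    then have "{k. 0 < e k} \<noteq> {}" using \<rho>(1) by auto
    then show ?thesis by (simp add: l_eq Suc_le_eq card_gt_0_iff)
  qed
  have lq: "l \<le> CARD('q)" unfolding l_eq by (rule card_mono) auto

  \<comment> \<open>Stabilization of the number of retained eigenvalues and convergence of spectral
    functions\<close>
  have lr_lim: "AE \<omega> in M. \<forall>\<^sub>F n in sequentially. lr n \<omega> = l"
    using dec \<Sigma>_lim
  proof eventually_elim
    case (elim \<omega>)
    have d: "\<Sigma> n \<omega> = spectral_matrix (U n \<omega>) (\<lambda>k. \<Delta> n \<omega> $ k $ k)" "orthogonal_matrix (U n \<omega>)" for n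
      using elim(1) by blast+
    have "\<forall>\<^sub>F n in sequentially. card {k. \<rho>0 \<le> \<Delta> n \<omega> $ k $ k} = card {k. \<rho>0 \<le> e k}"
    proof (rule eventually_card_spectrum_above[where d = "\<lambda>n k. \<Delta> n \<omega> $ k $ k", OF _ d(2) V])
      show "(\<lambda>n. spectral_matrix (U n \<omega>) (\<lambda>k. \<Delta> n \<omega> $ k $ k)) \<longlonglongrightarrow> spectral_matrix V e"
        using elim(2) by (simp add: d(1) \<Sigma>0_eq)
      show "\<not> real_eigenvalue (spectral_matrix V e) \<rho>0" using eig_cases unfolding \<Sigma>0_eq by blast
    qed
    then show ?case by (simp add: lr l_eq e_pos)
  qed
  have spec_lim: "AE \<omega> in M. (\<lambda>n. spectral_matrix (U n \<omega>) (\<lambda>k. \<phi> (\<Delta> n \<omega> $ k $ k))) \<longlonglongrightarrow> spectral_matrix V (\<lambda>k. \<phi> (e k))"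
    if \<phi>: "\<forall>\<mu>. real_eigenvalue \<Sigma>0 \<mu> \<longrightarrow> isCont \<phi> \<mu>" for \<phi> :: "real \<Rightarrow> real"
    using dec \<Sigma>_lim
  proof eventually_elim
    case (elim \<omega>)
    have d: "\<Sigma> n \<omega> = spectral_matrix (U n \<omega>) (\<lambda>k. \<Delta> n \<omega> $ k $ k)" "orthogonal_matrix (U n \<omega>)" for n
      using elim(1) by blast+
    show ?case
    proof (rule tendsto_spectral_function[where d = "\<lambda>n k. \<Delta> n \<omega> $ k $ k" and \<phi> = \<phi>, OF _ d(2) V])
      show "(\<lambda>n. spectral_matrix (U n \<omega>) (\<lambda>k. \<Delta> n \<omega> $ k $ k)) \<longlonglongrightarrow> spectral_matrix V e"
        using elim(2) by (simp add: d(1) \<Sigma>0_eq)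
      show "isCont \<phi> \<mu>" if "real_eigenvalue (spectral_matrix V e) \<mu>" for \<mu>
        using \<phi> that unfolding \<Sigma>0_eq by blast
    qed
  qed

  \<comment> \<open>The matrices of the two quadratic forms as cut-off functions of the sample
    covariance\<close>
  define \<phi>1 :: "real \<Rightarrow> real" where "\<phi>1 t = (if \<rho>0 \<le> t then 1 / t else 0)" for t
  define \<phi>2 :: "real \<Rightarrow> real" where "\<phi>2 t = (if \<rho>0 \<le> t then 0 else 1)" for t
  have [measurable]: "\<phi>1 \<in> borel_measurable borel" "\<phi>2 \<in> borel_measurable borel"
    unfolding \<phi>1_def \<phi>2_def by measurable
  have \<phi>1_cont: "\<forall>\<mu>. real_eigenvalue \<Sigma>0 \<mu> \<longrightarrow> isCont \<phi>1 \<mu>"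
  proof (intro allI impI)
    fix \<mu> assume \<mu>: "real_eigenvalue \<Sigma>0 \<mu>"
    show "isCont \<phi>1 \<mu>"
    proof (cases "\<mu> = 0")
      \<comment> \<open>\<open>1 / t\<close> has no continuous value at 0, but the cut-off makes
        \<phi>1 vanish near 0.\<close>
      case True
      then have "\<forall>\<^sub>F t in nhds \<mu>. \<phi>1 t = 0"
        using \<rho>0(1) by (intro eventually_mono[OF eventually_nhds_in_open[of "{..<\<rho>0}"]]) (auto simp: \<phi>1_def)
      from isCont_cong[OF this] show ?thesis by simp
    next
      case False
      then show ?thesis unfolding \<phi>1_def using eig_cases[OF \<mu>] by (intro isCont_threshold) auto
    qed
  qed
  have \<phi>2_cont: "\<forall>\<mu>. real_eigenvalue \<Sigma>0 \<mu> \<longrightarrow> isCont \<phi>2 \<mu>"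
    unfolding \<phi>2_def using eig_cases by (intro allI impI isCont_threshold) auto
  define A1 where "A1 n \<omega> = transpose (U1 n \<omega>) ** Dinv n \<omega> ** U1 n \<omega>" for n \<omega>
  define A2 where "A2 n \<omega> = transpose (U2 n \<omega>) ** U2 n \<omega>" for n \<omega>
  have A_eq: "AE \<omega> in M. \<forall>n. A1 n \<omega> = spectral_matrix (U n \<omega>) (\<lambda>k. \<phi>1 (\<Delta> n \<omega> $ k $ k)) \<and>
      A2 n \<omega> = spectral_matrix (U n \<omega>) (\<lambda>k. \<phi>2 (\<Delta> n \<omega> $ k $ k))"
    using dec
  proof eventually_elim
    case (elim \<omega>)
    then have "first_indices (lr n \<omega>) = {k. \<rho>0 \<le> \<Delta> n \<omega> $ k $ k}" for n by blast
    then show ?case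
      by (simp add: A1_def A2_def U1 U2 Dinv row_block_products \<phi>1_def \<phi>2_def)
        (auto intro!: arg_cong2[where f = spectral_matrix])
  qed
  have A1_lim: "AE \<omega> in M. (\<lambda>n. A1 n \<omega>) \<longlonglongrightarrow> spectral_matrix V (\<lambda>k. if 0 < e k then 1 / e k else 0)"
    using A_eq spec_lim[OF \<phi>1_cont] by eventually_elim (simp add: \<phi>1_def e_pos)
  have A2_lim: "AE \<omega> in M. (\<lambda>n. A2 n \<omega>) \<longlonglongrightarrow> spectral_matrix V (\<lambda>k. if 0 < e k then 0 else 1)"
    using A_eq spec_lim[OF \<phi>2_cont] by eventually_elim (simp add: \<phi>2_def e_pos)

  \<comment> \<open>Measurability of the eigenvalues and of the quadratic forms\<close>
  define dm where "dm n \<omega> k = (\<Sum>i\<in>UNIV. \<Sum>j\<in>UNIV. U n \<omega> $ k $ i * \<Sigma> n \<omega> $ i $ j * U n \<omega> $ k $ j)" for n \<omega> k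
  have dm_meas[measurable]: "(\<lambda>\<omega>. dm n \<omega> k) \<in> borel_measurable (completion M)" for n k
    unfolding dm_def by measurable
  \<comment> \<open>\<Delta> comes without measurability; its diagonal is recovered from the
    measurable \<open>U\<close> and \<Sigma>.\<close>
  have dm_eq: "AE \<omega> in M. \<forall>n k. \<Delta> n \<omega> $ k $ k = dm n \<omega> k"
    using dec
  proof eventually_elim
    case (elim \<omega>)
    show ?case
    proof (intro allI)
      fix n k
      show "\<Delta> n \<omega> $ k $ k = dm n \<omega> k"
        unfolding dm_def by (rule spectral_matrix_entry_back[of "U n \<omega>" "\<Sigma> n \<omega>"]) (use elim in blast)+
    qed
  qed
  have quad_meas: "(\<lambda>\<omega>. real n * inner (w0 n \<omega>) (A n \<omega> *v w0 n \<omega>)) \<in> borel_measurable (completion M)"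
    if [measurable]: "\<phi> \<in> borel_measurable borel"
      and A: "AE \<omega> in M. \<forall>n. A n \<omega> = spectral_matrix (U n \<omega>) (\<lambda>k. \<phi> (\<Delta> n \<omega> $ k $ k))"
    for \<phi> :: "real \<Rightarrow> real" and A and n
  proof (rule completion.measurable_AE_eq)
    show "(\<lambda>\<omega>. real n * (\<Sum>k\<in>UNIV. \<phi> (dm n \<omega> k) * inner (U n \<omega> $ k) (w0 n \<omega>) * inner (U n \<omega> $ k) (w0 n \<omega>)))
      \<in> borel_measurable (completion M)" by measurable
    show "AE \<omega> in completion M. real n * (\<Sum>k\<in>UNIV. \<phi> (dm n \<omega> k) * inner (U n \<omega> $ k) (w0 n \<omega>) * inner (U n \<omega> $ k) (w0 n \<omega>))
      = real n * inner (w0 n \<omega>) (A n \<omega> *v w0 n \<omega>)"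
      using AE_completion[OF A] AE_completion[OF dm_eq] by eventually_elim (simp add: inner_spectral_matrix)
  qed simp
  define T1 where "T1 n \<omega> = real n * inner (w0 n \<omega>) (A1 n \<omega> *v w0 n \<omega>)" for n \<omega>
  define T2 where "T2 n \<omega> = real n * inner (w0 n \<omega>) (A2 n \<omega> *v w0 n \<omega>)" for n \<omega>
  have T1_meas[measurable]: "T1 n \<in> borel_measurable (completion M)" for n
    unfolding T1_def[abs_def] by (rule quad_meas[of \<phi>1]) (use A_eq in \<open>auto elim: eventually_mono\<close>)
  have T2_meas[measurable]: "T2 n \<in> borel_measurable (completion M)" for n
    unfolding T2_def[abs_def] by (rule quad_meas[of \<phi>2]) (use A_eq in \<open>auto elim: eventually_mono\<close>)

  \<comment> \<open>Limits of the two quadratic forms\<close>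
  have T1_lim: "weak_conv_m (\<lambda>n. distr (completion M) borel (T1 n)) (chi_square l)"
  proof (rule N.weak_conv_m_perturb[OF T1_meas _ real_distribution_chi_square])
    let ?B = "spectral_matrix V (\<lambda>k. if 0 < e k then 1 / e k else 0)"
    let ?Y = "\<lambda>n \<omega>. real n * inner (centered_mean x0 n \<omega>) (?B *v centered_mean x0 n \<omega>)"
    have Y_meas: "?Y n \<in> borel_measurable M" for n
      unfolding inner_spectral_matrix by measurable
    then show "?Y n \<in> borel_measurable (completion M)" for n by (rule measurable_completion)
    show "(\<lambda>n. N.prob {\<omega>\<in>space (completion M). \<delta> < \<bar>T1 n \<omega> - ?Y n \<omega>\<bar>}) \<longlonglongrightarrow> 0" if "\<delta> > 0" for \<delta>
      unfolding T1_def
      by (rule quadratic_form_prob_limit[OF x0(1) conv(1) _ A1_lim w0_lim that]) (use T1_meas in \<open>simp add: T1_def[abs_def]\<close>)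
    show "weak_conv_m (\<lambda>n. distr (completion M) borel (?Y n)) (chi_square l)"
      using centered_mean_quadratic_weak_limit[OF x0(1) V cov_eq] by (simp only: distr_completion[OF Y_meas] l_eq)
  qed
  have T2_prob: "(\<lambda>n. N.prob {\<omega>\<in>space (completion M). \<delta> < \<bar>T2 n \<omega>\<bar>}) \<longlonglongrightarrow> 0" if "\<delta> > 0" for \<delta>
  proof -
    let ?B = "spectral_matrix V (\<lambda>k. if 0 < e k then 0 else 1)"
    let ?Y = "\<lambda>n \<omega>. real n * inner (centered_mean x0 n \<omega>) (?B *v centered_mean x0 n \<omega>)"
    have [measurable]: "?Y n \<in> borel_measurable (completion M)" for n
      by (rule measurable_completion, unfold inner_spectral_matrix) measurable
    have lim: "(\<lambda>n. N.prob {\<omega>\<in>space (completion M). \<delta> < \<bar>T2 n \<omega> - ?Y n \<omega>\<bar>}) \<longlonglongrightarrow> 0"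
      unfolding T2_def
      by (rule quadratic_form_prob_limit[OF x0(1) conv(1) _ A2_lim w0_lim that]) (use T2_meas in \<open>simp add: T2_def[abs_def]\<close>)
    \<comment> \<open>The limiting form sees only kernel directions of \<Sigma>0, in which the
      centered means vanish almost surely.\<close>
    have "AE \<omega> in M. \<forall>n. ?Y n \<omega> = 0"
      using centered_mean_kernel[OF x0(1) V cov_eq]
    proof eventually_elim
      case (elim \<omega>)
      have "(if 0 < e k then 0 else 1) * inner (V $ k) (centered_mean x0 n \<omega>) * inner (V $ k) (centered_mean x0 n \<omega>) = 0" for n k
        using elim e_nonneg[of k] by auto
      then show ?case unfolding inner_spectral_matrix by (simp only: sum.neutral_const mult_zero_right simp_thms)
    qed
    then have Y0: "AE \<omega> in completion M. \<forall>n. ?Y n \<omega> = 0" by (rule AE_completion)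
    have "N.prob {\<omega>\<in>space (completion M). \<delta> < \<bar>T2 n \<omega> - ?Y n \<omega>\<bar>} = N.prob {\<omega>\<in>space (completion M). \<delta> < \<bar>T2 n \<omega>\<bar>}" for n
    proof (rule N.finite_measure_eq_AE)
      show "AE \<omega> in completion M. \<omega> \<in> {\<omega>\<in>space (completion M). \<delta> < \<bar>T2 n \<omega> - ?Y n \<omega>\<bar>} \<longleftrightarrow>
          \<omega> \<in> {\<omega>\<in>space (completion M). \<delta> < \<bar>T2 n \<omega>\<bar>}"
        using Y0
      proof eventually_elim
        case (elim \<omega>)
        then have "T2 n \<omega> - ?Y n \<omega> = T2 n \<omega>" by (metis diff_zero)
        then show ?case by (simp only: mem_Collect_eq)
      qed
    qed measurable
    with lim show ?thesis by (simp only:)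
  qed
  have T2_lim: "weak_conv_m (\<lambda>n. distr (completion M) borel (T2 n)) (return borel 0)"
  proof (rule N.weak_conv_m_perturb[where Y = "\<lambda>_ _. 0", OF T2_meas])
    show "real_distribution (return borel (0::real))"
      by (simp add: real_distribution_def real_distribution_axioms_def prob_space_return)
    show "weak_conv_m (\<lambda>n. distr (completion M) borel (\<lambda>_. 0)) (return borel 0)"
      by (simp add: weak_conv_m_def weak_conv_def N.distr_const)
  qed (use T2_prob in simp_all)

  \<comment> \<open>Coverage probability of the confidence region\<close>
  have R_lim: "(\<lambda>n. measure (completion M) {\<omega> \<in> space M. z0 \<in> R n \<epsilon> \<omega>}) \<longlonglongrightarrow> 1 - \<alpha>" if \<epsilon>: "\<epsilon> > 0" for \<epsilon>
  proof -
    \<comment> \<open>\<open>P\<close> keeps only the first inequality of the region at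
      \<open>z0\<close>, with the limiting critical value, while \<open>Q\<close> is membership of
      \<open>z0\<close>. They can differ only when \<open>lr n \<omega> \<noteq> l\<close> or when
      the second form is large.\<close>
    define P where "P n \<omega> \<longleftrightarrow> ereal (T1 n \<omega>) \<le> cv l" for n \<omega>
    define Q where "Q n \<omega> \<longleftrightarrow> ereal (T1 n \<omega>) \<le> cv (lr n \<omega>) \<and> infnorm (sqrt (real n) *\<^sub>R (U2 n \<omega> *v w0 n \<omega>)) \<le> \<epsilon>" for n \<omega>
    have lr_meas[measurable]: "lr n \<in> measurable (completion M) (count_space UNIV)" for n
    proof (rule completion.measurable_AE_eq)
      show "(\<lambda>\<omega>. \<Sum>k\<in>(UNIV :: 'q set). if \<rho>0 \<le> dm n \<omega> k then 1 else 0 :: nat) \<in> measurable (completion M) (count_space UNIV)"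
        by measurable
      show "AE \<omega> in completion M. (\<Sum>k\<in>UNIV. if \<rho>0 \<le> dm n \<omega> k then 1 else 0) = lr n \<omega>"
        using AE_completion[OF dm_eq] by eventually_elim (simp add: lr sum.If_cases)
    qed simp
    have U2w_meas[measurable]: "(\<lambda>\<omega>. U2 n \<omega> *v w0 n \<omega>) \<in> borel_measurable (completion M)" for n
    proof (rule completion.measurable_AE_eq)
      show "(\<lambda>\<omega>. \<chi> k. (if \<rho>0 \<le> dm n \<omega> k then 0 else 1) * inner (U n \<omega> $ k) (w0 n \<omega>)) \<in> borel_measurable (completion M)"
        by (intro borel_measurable_vecI) (unfold vec_lambda_beta, measurable)
      show "AE \<omega> in completion M. (\<chi> k. (if \<rho>0 \<le> dm n \<omega> k then 0 else 1) * inner (U n \<omega> $ k) (w0 n \<omega>)) = U2 n \<omega> *v w0 n \<omega>"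
        using AE_completion[OF dm_eq] AE_completion[OF dec]
        by eventually_elim (auto simp: vec_eq_iff U2 row_block_def matrix_vector_mult_def inner_vec_def)
    qed simp
    have [measurable]: "(infnorm :: real^'q::_ \<Rightarrow> real) \<in> borel_measurable borel"
      by (intro borel_measurable_continuous_onI continuous_at_imp_continuous_on ballI continuous_infnorm continuous_ident)
    have cv_lr: "(\<lambda>\<omega>. cv (lr n \<omega>)) \<in> borel_measurable (completion M)" for n
      by (rule measurable_compose[OF lr_meas]) simp
    note [measurable] = cv_lr
    have Q_meas[measurable]: "Measurable.pred (completion M) (Q n)" for n unfolding Q_def by measurable
    have P_meas[measurable]: "Measurable.pred (completion M) (P n)" for n unfolding P_def by measurable
    have P_lim: "(\<lambda>n. N.prob {\<omega>\<in>space (completion M). P n \<omega>}) \<longlonglongrightarrow> 1 - \<alpha>"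
    proof -
      interpret X: real_distribution "chi_square l" by (rule real_distribution_chi_square)
      have cr: "measure (chi_square l) {x. cv l < ereal x} = \<alpha>"
        using crit[OF l1 lq] by (simp add: chi_square_critical_def)
      show ?thesis
      proof (cases "cv l")
        case (real r)
        have "isCont (cdf (chi_square l)) r"
          unfolding X.isCont_cdf by (rule measure_chi_square_singleton[OF l1])
        then have "(\<lambda>n. cdf (distr (completion M) borel (T1 n)) r) \<longlonglongrightarrow> cdf (chi_square l) r"
          using T1_lim by (simp add: weak_conv_m_def weak_conv_def)
        moreover have "cdf (distr (completion M) borel (T1 n)) r = N.prob {\<omega>\<in>space (completion M). P n \<omega>}" for n
          unfolding cdf_def by (subst measure_distr) (auto simp: P_def real intro!: arg_cong[where f = "measure _"])
        moreover have "cdf (chi_square l) r = 1 - \<alpha>"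
        proof -
          have "{..r} = space (chi_square l) - {x. cv l < ereal x}" by (auto simp: real)
          moreover have "{x. cv l < ereal x} \<in> sets (chi_square l)" by (simp add: real) 
          ultimately show ?thesis unfolding cdf_def using X.prob_compl[of "{x. cv l < ereal x}"] cr by simp
        qed
        ultimately show ?thesis by simp
      next
        \<comment> \<open>A critical value \<infinity> means \<alpha> = 0 and \<open>P\<close>
          always true; in the remaining case, minus infinity, \<alpha> = 1 and \<open>P\<close> is
          never true.\<close>
        case PInf
        then show ?thesis using cr by (simp add: P_def prob_space)
      next
        case MInf
        then show ?thesis using cr X.prob_space by (simp add: P_def)
      qed
    qed
    let ?b = "\<lambda>n. N.prob {\<omega>\<in>space (completion M). lr n \<omega> \<noteq> l} + N.prob {\<omega>\<in>space (completion M). \<epsilon>\<^sup>2 / 2 < \<bar>T2 n \<omega>\<bar>}"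
    have "(\<lambda>n. N.prob {\<omega>\<in>space (completion M). lr n \<omega> \<noteq> l}) \<longlonglongrightarrow> 0"
    proof (rule N.prob_eventually_tendsto_0)
      show "{\<omega>\<in>space (completion M). lr n \<omega> \<noteq> l} \<in> N.events" for n by measurable
      show "AE \<omega> in completion M. \<forall>\<^sub>F n in sequentially. \<not> lr n \<omega> \<noteq> l"
        using AE_completion[OF lr_lim] by simp
    qed
    from tendsto_add[OF this T2_prob[of "\<epsilon>\<^sup>2 / 2"]] have b_lim: "?b \<longlonglongrightarrow> 0" using \<epsilon> by simp
    have diff: "\<bar>N.prob {\<omega>\<in>space (completion M). Q n \<omega>} - N.prob {\<omega>\<in>space (completion M). P n \<omega>}\<bar> \<le> ?b n" for n
    proof -
      let ?Q = "{\<omega>\<in>space (completion M). Q n \<omega>}" and ?P = "{\<omega>\<in>space (completion M). P n \<omega>}"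
      let ?E = "{\<omega>\<in>space (completion M). lr n \<omega> \<noteq> l}" and ?G = "{\<omega>\<in>space (completion M). \<epsilon>\<^sup>2 / 2 < \<bar>T2 n \<omega>\<bar>}"
      have large: "\<omega> \<in> ?G" if \<omega>: "\<omega> \<in> space (completion M)" "\<not> infnorm (sqrt (real n) *\<^sub>R (U2 n \<omega> *v w0 n \<omega>)) \<le> \<epsilon>" for \<omega>
      proof -
        \<comment> \<open>The maximum norm is at most the Euclidean norm, and the square of the
          latter is the second quadratic form.\<close>
        have "\<epsilon> < norm (sqrt (real n) *\<^sub>R (U2 n \<omega> *v w0 n \<omega>))"
          using \<omega>(2) infnorm_le_norm[of "sqrt (real n) *\<^sub>R (U2 n \<omega> *v w0 n \<omega>)"] by linarith
        then have "\<epsilon>\<^sup>2 < (norm (sqrt (real n) *\<^sub>R (U2 n \<omega> *v w0 n \<omega>)))\<^sup>2"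
          using \<epsilon> by (intro power_strict_mono) auto
        also have "\<dots> = T2 n \<omega>"
          by (simp add: T2_def A2_def inner_transpose_matrix_mult power_mult_distrib)
        finally have "\<epsilon>\<^sup>2 < T2 n \<omega>" .
        moreover have "0 < \<epsilon>\<^sup>2" using \<epsilon> by simp
        ultimately show ?thesis using \<omega>(1) by simp
      qed
      have ms: "?Q \<in> N.events" "?P \<in> N.events" "?E \<in> N.events" "?G \<in> N.events" by measurable
      have "?Q \<subseteq> ?P \<union> (?E \<union> ?G)" by (auto simp: Q_def P_def)
      then have "N.prob ?Q \<le> N.prob (?P \<union> (?E \<union> ?G))" by (rule N.finite_measure_mono) (intro sets.Un ms)
      also have "\<dots> \<le> N.prob ?P + (N.prob ?E + N.prob ?G)"
        by (intro order_trans[OF measure_Un_le] add_left_mono measure_Un_le sets.Un ms)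
      finally have 1: "N.prob ?Q \<le> N.prob ?P + (N.prob ?E + N.prob ?G)" .
      have "?P \<subseteq> ?Q \<union> (?E \<union> ?G)" using large by (auto simp: Q_def P_def)
      then have "N.prob ?P \<le> N.prob (?Q \<union> (?E \<union> ?G))" by (rule N.finite_measure_mono) (intro sets.Un ms)
      also have "\<dots> \<le> N.prob ?Q + (N.prob ?E + N.prob ?G)"
        by (intro order_trans[OF measure_Un_le] add_left_mono measure_Un_le sets.Un ms)
      finally show ?thesis using 1 by linarith
    qed
    have "(\<lambda>n. N.prob {\<omega>\<in>space (completion M). Q n \<omega>} - N.prob {\<omega>\<in>space (completion M). P n \<omega>}) \<longlonglongrightarrow> 0"
      by (rule Lim_null_comparison[OF always_eventually b_lim]) (use diff in simp)
    then have "(\<lambda>n. N.prob {\<omega>\<in>space (completion M). Q n \<omega>}) \<longlonglongrightarrow> 1 - \<alpha>"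
      by (rule Lim_transform[OF P_lim])
    moreover have "{\<omega>\<in>space (completion M). Q n \<omega>} = {\<omega> \<in> space M. z0 \<in> R n \<epsilon> \<omega>}" for n
      by (simp add: R Q_def T1_def A1_def w0_def)
    ultimately show ?thesis by simp
  qed
  show ?thesis
    using lr_lim T1_lim T2_lim R_lim by (simp add: T1_def[abs_def] T2_def[abs_def] A1_def A2_def w0_def)
qed

end
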